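(* The center of $\mathcal{H}(G,I)$ is the same as the center of $\mathcal{H}_0$, which is generated (as a $\mathbb{C}$-algebra with identity $\iota$) by the element $\Theta_{1,0}+\Theta_{-1,0}$.
   Context: $F$ is a two-dimensional local field with last residue field $F_0=\mathbb{F}_q$, and $v:F^\times\to\mathbb{Z}^2$ is a fixed discrete valuation of rank two, where $\mathbb{Z}^2$ carries the lexicographic order from the right: $(i,j)<(k,l)$ iff $j<l$, or $j=l$ and $i<k$. $t_1,t_2$ are local parameters, with $v(t_1)=(1,0)$, $v(t_2)=(0,1)$. $O=\{x\in F: x=0 \text{ or } v(x)\ge(0,0)\}$, with $O/t_1O=\mathbb{F}_q$. $G=SL_2(F)$, and $I=\left\{\begin{pmatrix} a&b\\c&d\end{pmatrix}\in SL_2(O): c\in t_1O\right\}$. For $(i,j)\in\mathbb{Z}^2$ set $\eta^{(1)}_{i,j}=\begin{pmatrix} t_1^i t_2^j & 0\\ 0 & t_1^{-i}t_2^{-j}\end{pmatrix}$, $\eta^{(2)}_{i,j}=\begin{pmatrix} 0 & t_1^i t_2^j\\ -t_1^{-i}t_2^{-j} & 0\end{pmatrix}$, and $C^{(a)}_{i,j}=I\eta^{(a)}_{i,j}I$. By the (known) Bruhat decomposition, $G$ is the disjoint union of all the $C^{(a)}_{i,j}$, $a\in\{1,2\}$, $(i,j)\in\mathbb{Z}^2$. Let $\eta$ be the map on $G$ with $\eta(x)=\eta^{(a)}_{i,j}$ for $x\in C^{(a)}_{i,j}$. Let $\chi^{(a)}_{i,j}$ be the characteristic function of $C^{(a)}_{i,j}$,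 and $C_j=\bigcup_{m\in\mathbb{Z}}(C^{(1)}_{m,j}\cup C^{(2)}_{m,j})$. The convolution product is defined by $$(\chi^{(a)}_{i,j}*\chi^{(b)}_{k,l})(x)=\begin{cases} q^{-1}\sum_z \chi^{(a)}_{i,j}(\eta(x)z^{-1}) & \text{if } x\in C_{j+l}\text{ and } jl\ge0,\\ 0 & \text{otherwise,}\end{cases}$$ where $z$ runs over a set of representatives of the decomposition $C^{(b)}_{k,l}=\coprod_z Iz$ into right cosets of $I$; the sum has only finitely many nonzero terms for each $x$. $\mathcal{H}(G,I)$ is the $\mathbb{C}$-vector space generated by the functions $\sum_{r\le i}c_r\chi^{(a)}_{r,j}$ ($j>0$), $\sum_{r\ge i}c_r\chi^{(a)}_{r,j}$ ($j<0$), and $\sum_{i\le r\le i'}c_r\chi^{(a)}_{r,0}$, with $i,i',j\in\mathbb{Z}$, $a\in\{1,2\}$, $c_r\in\mathbb{C}$. The product $*$ is extended (infinite-)linearly to $\mathcal{H}(G,I)$, i.e. $(\sum_\alpha c_\alpha\alpha)*(\sum_\beta d_\beta\beta)=\sum_{\alpha,\beta}c_\alpha d_\beta\,\alpha*\beta$ for $\alpha,\beta$ running over the functions $\chi^{(a)}_{i,j}$, which is well-defined since only finitely many terms contribute to each coefficient. The element $\iota=q\chi^{(1)}_{0,0}$ is the identity. $\mathcal{H}_0$ is the subalgebra of $\mathcal{H}(G,I)$ consisting of the functions supported in $C_0$; it is isomorphic to the usual affine Hecke algebra of $SL_2$. Define $\Theta_{1,0}=\chi^{(1)}_{1,0}$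 and $\Theta_{-1,0}=\chi^{(1)}_{-1,0}-(q-1)\chi^{(2)}_{-1,0}-(q-1)\chi^{(2)}_{0,0}+q(q+q^{-1}-2)\chi^{(1)}_{0,0}$; one has $\Theta_{1,0}^{-1}=\Theta_{-1,0}$. The center of an algebra is the set of its elements that commute with all of its elements. *)

theory Defs
  imports
    "HOL-Analysis.Analysis"
    "HOL-Library.Function_Algebras"
    "HOL-Algebra.QuotRing"
    "HOL-Algebra.Algebraic_Closure_Type"
begin

section \<open>Two-dimensional local fields\<close>

text \<open>Valuations are total functions; their value at zero is irrelevant.\<close>

definition discrete_valuation :: "('a, 'b) ring_scheme \<Rightarrow> ('a \<Rightarrow> int) \<Rightarrow> bool" where
  "discrete_valuation K w \<longleftrightarrow>
     Ring.field K \<and>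
     w ` (carrier K - {\<zero>\<^bsub>K\<^esub>}) = UNIV \<and>
     (\<forall>x \<in> carrier K - {\<zero>\<^bsub>K\<^esub>}. \<forall>y \<in> carrier K - {\<zero>\<^bsub>K\<^esub>}.
        w (x \<otimes>\<^bsub>K\<^esub> y) = w x + w y \<and>
        (x \<oplus>\<^bsub>K\<^esub> y \<noteq> \<zero>\<^bsub>K\<^esub> \<longrightarrow> min (w x) (w y) \<le> w (x \<oplus>\<^bsub>K\<^esub> y)))"

definition valuation_ring :: "('a, 'b) ring_scheme \<Rightarrow> ('a \<Rightarrow> int) \<Rightarrow> 'a set" where
  "valuation_ring K w = {x \<in> carrier K. x = \<zero>\<^bsub>K\<^esub> \<or> 0 \<le> w x}"

definition valuation_ideal :: "('a, 'b) ring_scheme \<Rightarrow> ('a \<Rightarrow> int) \<Rightarrow> 'a set" where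
  "valuation_ideal K w = {x \<in> carrier K. x = \<zero>\<^bsub>K\<^esub> \<or> 0 < w x}"

definition residue_field :: "('a, 'b) ring_scheme \<Rightarrow> ('a \<Rightarrow> int) \<Rightarrow> 'a set ring" where
  "residue_field K w = (K\<lparr>carrier := valuation_ring K w\<rparr>) Quot valuation_ideal K w"

definition val_close :: "('a, 'b) ring_scheme \<Rightarrow> ('a \<Rightarrow> int) \<Rightarrow> int \<Rightarrow> 'a \<Rightarrow> 'a \<Rightarrow> bool" where
  "val_close K w n x y \<longleftrightarrow> x = y \<or> n \<le> w (x \<ominus>\<^bsub>K\<^esub> y)"

definition valuation_complete :: "('a, 'b) ring_scheme \<Rightarrow> ('a \<Rightarrow> int) \<Rightarrow> bool" where
  "valuation_complete K w \<longleftrightarrow>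
     (\<forall>s :: nat \<Rightarrow> 'a. range s \<subseteq> carrier K \<longrightarrow>
        (\<forall>n. \<exists>N. \<forall>m\<ge>N. \<forall>k\<ge>N. val_close K w n (s m) (s k)) \<longrightarrow>
        (\<exists>l \<in> carrier K. \<forall>n. \<exists>N. \<forall>m\<ge>N. val_close K w n (s m) l))"

text \<open>
  \<open>q\<close> is the number of elements of the last residue field, which determines that finite
  field up to isomorphism.
\<close>

definition two_dim_local_field :: "('a, 'b) ring_scheme \<Rightarrow> nat \<Rightarrow> bool" where
  "two_dim_local_field K q \<longleftrightarrow>
     (\<exists>w w'. discrete_valuation K w \<and> valuation_complete K w \<and>
        discrete_valuation (residue_field K w) w' \<and>
        valuation_complete (residue_field K w) w' \<and>
        finite (carrier (residue_field (residue_field K w) w')) \<and>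
        card (carrier (residue_field (residue_field K w) w')) = q)"

text \<open>The lexicographic order from the right.\<close>

definition lex_less :: "int \<times> int \<Rightarrow> int \<times> int \<Rightarrow> bool" where
  "lex_less = (\<lambda>(i, j) (k, l). j < l \<or> (j = l \<and> i < k))"

definition lex_le :: "int \<times> int \<Rightarrow> int \<times> int \<Rightarrow> bool" where
  "lex_le p p' \<longleftrightarrow> p = p' \<or> lex_less p p'"

definition rank_two_valuation :: "('f::field \<Rightarrow> int \<times> int) \<Rightarrow> bool" where
  "rank_two_valuation v \<longleftrightarrow>
     v ` (UNIV - {0}) = UNIV \<and>
     (\<forall>x y. x \<noteq> 0 \<longrightarrow> y \<noteq> 0 \<longrightarrow> v (x * y) = (fst (v x) + fst (v y), snd (v x) + snd (v y))) \<and>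
     (\<forall>x y. x \<noteq> 0 \<longrightarrow> y \<noteq> 0 \<longrightarrow> x + y \<noteq> 0 \<longrightarrow>
        lex_le (v x) (v (x + y)) \<or> lex_le (v y) (v (x + y)))"

definition rank_two_integers :: "('f::field \<Rightarrow> int \<times> int) \<Rightarrow> 'f set" where
  "rank_two_integers v = {x. x = 0 \<or> lex_le (0, 0) (v x)}"


section \<open>The Hecke algebra of SL2\<close>

text \<open>
  The last two assumptions express that \<open>O / t\<^sub>1 O\<close> is the field with \<open>q\<close> elements.
  The valuation \<open>v\<close> is not explicitly tied to the valuations occurring in
  \<open>two_dim_local_field\<close>: on such a field the latter are unique, and \<open>snd \<circ> v\<close> and the
  valuation induced by \<open>fst \<circ> v\<close> on the first residue field necessarily agree with them.
\<close>

locale sl2_hecke =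
  fixes v :: "'f::field \<Rightarrow> int \<times> int" and t1 t2 :: 'f and q :: nat
  assumes two_dim: "two_dim_local_field (ring_of_type_algebra :: 'f ring) q"
    and valuation: "rank_two_valuation v"
    and t1: "t1 \<noteq> 0" "v t1 = (1, 0)"
    and t2: "t2 \<noteq> 0" "v t2 = (0, 1)"
    and finite_residues:
      "finite (carrier ((ring_of_type_algebra\<lparr>carrier := rank_two_integers v\<rparr>)
                 Quot ((\<lambda>x. t1 * x) ` rank_two_integers v)))"
    and card_residues:
      "card (carrier ((ring_of_type_algebra\<lparr>carrier := rank_two_integers v\<rparr>)
                 Quot ((\<lambda>x. t1 * x) ` rank_two_integers v))) = q"
begin

definition iwahori :: "('f^2^2) set" where
  "iwahori = {g. det g = 1 \<and> (\<forall>i j. g $ i $ j \<in> rank_two_integers v) \<and>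
                 g $ 2 $ 1 \<in> (\<lambda>x. t1 * x) ` rank_two_integers v}"

text \<open>The upper index ranges over the two-element type \<open>2\<close>, whose elements are 1 and 2.\<close>

definition eta :: "2 \<Rightarrow> int \<Rightarrow> int \<Rightarrow> 'f^2^2" where
  "eta a i j =
     (if a = 1
      then vector [vector [t1 powi i * t2 powi j, 0],
                   vector [0, t1 powi (-i) * t2 powi (-j)]]
      else vector [vector [0, t1 powi i * t2 powi j],
                   vector [- (t1 powi (-i) * t2 powi (-j)), 0]])"

definition dcoset :: "2 \<Rightarrow> int \<Rightarrow> int \<Rightarrow> ('f^2^2) set" where
  "dcoset a i j = {g ** eta a i j ** h | g h. g \<in> iwahori \<and> h \<in> iwahori}"

definition dcoset_level :: "int \<Rightarrow> ('f^2^2) set" where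
  "dcoset_level j = (\<Union>m. dcoset 1 m j \<union> dcoset 2 m j)"

text \<open>
  The map \<open>\<eta>\<close>; well defined on SL2 because the double cosets are pairwise disjoint and
  cover SL2. Its values outside SL2 are never used.
\<close>

definition eta_of :: "'f^2^2 \<Rightarrow> 'f^2^2" where
  "eta_of x = (THE y. \<exists>a i j. x \<in> dcoset a i j \<and> y = eta a i j)"

text \<open>Functions on SL2 are extended by zero to all matrices.\<close>

definition chi :: "2 \<Rightarrow> int \<Rightarrow> int \<Rightarrow> 'f^2^2 \<Rightarrow> complex" where
  "chi a i j = indicator (dcoset a i j)"

definition right_coset :: "'f^2^2 \<Rightarrow> ('f^2^2) set" where
  "right_coset z = (\<lambda>h. h ** z) ` iwahori"

definition is_coset_reps :: "('f^2^2) set \<Rightarrow> ('f^2^2) set \<Rightarrow> bool" where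
  "is_coset_reps R A \<longleftrightarrow> A = (\<Union>z\<in>R. right_coset z) \<and> disjoint_family_on right_coset R"

definition coset_reps :: "2 \<Rightarrow> int \<Rightarrow> int \<Rightarrow> ('f^2^2) set" where
  "coset_reps b k l = (SOME R. is_coset_reps R (dcoset b k l))"

text \<open>
  The product of two characteristic functions. The sum over all representatives has only
  finitely many nonzero terms, so it is written as the sum of these. It does not depend on the
  choice of representatives, as the double cosets are right invariant under the Iwahori
  subgroup.
\<close>

definition conv_chi ::
    "2 \<Rightarrow> int \<Rightarrow> int \<Rightarrow> 2 \<Rightarrow> int \<Rightarrow> int \<Rightarrow> 'f^2^2 \<Rightarrow> complex" where
  "conv_chi a i j b k l x =
     (if x \<in> dcoset_level (j + l) \<and> j * l \<ge> 0
      then inverse (of_nat q) *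
        (\<Sum>z \<in> {z \<in> coset_reps b k l. chi a i j (eta_of x ** matrix_inv z) \<noteq> 0}.
           chi a i j (eta_of x ** matrix_inv z))
      else 0)"

text \<open>
  The possibly infinite linear combination of the \<open>\<chi>\<close> with upper index \<open>a\<close> and lower indices
  \<open>(r, j)\<close>, \<open>r \<in> R\<close>. By disjointness of the double cosets, at most one term of it is nonzero at
  each point.
\<close>

definition chi_series :: "2 \<Rightarrow> int \<Rightarrow> int set \<Rightarrow> (int \<Rightarrow> complex) \<Rightarrow> 'f^2^2 \<Rightarrow> complex" where
  "chi_series a j R c x = (\<Sum>r \<in> {r \<in> R. chi a r j x \<noteq> 0}. c r * chi a r j x)"

definition hecke_generators :: "('f^2^2 \<Rightarrow> complex) set" where
  "hecke_generators =
     {chi_series a j {..i} c | a i j c. j > 0} \<union>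
     {chi_series a j {i..} c | a i j c. j < 0} \<union>
     {chi_series a 0 {i..i'} c | a i i' c. True}"

definition hecke :: "('f^2^2 \<Rightarrow> complex) set" where
  "hecke = module.span (\<lambda>c f x. c * f x) hecke_generators"

text \<open>
  The infinite-linear extension of the product. The coefficient of \<open>\<chi>\<close> with indices \<open>a, i, j\<close>
  in \<open>f\<close> is \<open>f (eta a i j)\<close>, by disjointness of the double cosets. At each point only finitely
  many terms of the double sum are nonzero, and the sum is taken over these.
\<close>

definition conv :: "('f^2^2 \<Rightarrow> complex) \<Rightarrow> ('f^2^2 \<Rightarrow> complex) \<Rightarrow> 'f^2^2 \<Rightarrow> complex" where
  "conv f g x =
     (let term = (\<lambda>((a, i, j), (b, k, l)). f (eta a i j) * g (eta b k l) * conv_chi a i j b k l x)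
      in \<Sum>p \<in> {p. term p \<noteq> 0}. term p)"

definition iota :: "'f^2^2 \<Rightarrow> complex" where
  "iota = (\<lambda>x. of_nat q * chi 1 0 0 x)"

definition hecke0 :: "('f^2^2 \<Rightarrow> complex) set" where
  "hecke0 = {f \<in> hecke. \<forall>x. f x \<noteq> 0 \<longrightarrow> x \<in> dcoset_level 0}"

definition Theta_plus :: "'f^2^2 \<Rightarrow> complex" where
  "Theta_plus = chi 1 1 0"

definition Theta_minus :: "'f^2^2 \<Rightarrow> complex" where
  "Theta_minus = (\<lambda>x. chi 1 (-1) 0 x - (of_nat q - 1) * chi 2 (-1) 0 x
     - (of_nat q - 1) * chi 2 0 0 x
     + of_nat q * (of_nat q + inverse (of_nat q) - 2) * chi 1 0 0 x)"

end

definition algebra_center :: "('a \<Rightarrow> 'a \<Rightarrow> 'a) \<Rightarrow> 'a set \<Rightarrow> 'a set" where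
  "algebra_center mul A = {z \<in> A. \<forall>f\<in>A. mul z f = mul f z}"

text \<open>
  The complex algebra of functions, with product \<open>mul\<close> and identity \<open>one\<close>, generated by \<open>S\<close>.
\<close>

inductive_set generated_algebra ::
    "(('g \<Rightarrow> complex) \<Rightarrow> ('g \<Rightarrow> complex) \<Rightarrow> ('g \<Rightarrow> complex)) \<Rightarrow> ('g \<Rightarrow> complex) \<Rightarrow>
     ('g \<Rightarrow> complex) set \<Rightarrow> ('g \<Rightarrow> complex) set"
  for mul one S where
  one: "one \<in> generated_algebra mul one S"
| gen: "f \<in> S \<Longrightarrow> f \<in> generated_algebra mul one S"
| add: "f \<in> generated_algebra mul one S \<Longrightarrow> g \<in> generated_algebra mul one S \<Longrightarrow>
    (\<lambda>x. f x + g x) \<in> generated_algebra mul one S"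
| scale: "f \<in> generated_algebra mul one S \<Longrightarrow> (\<lambda>x. c * f x) \<in> generated_algebra mul one S"
| mul: "f \<in> generated_algebra mul one S \<Longrightarrow> g \<in> generated_algebra mul one S \<Longrightarrow>
    mul f g \<in> generated_algebra mul one S"

end

theory Submission
  imports Defs
begin

text \<open>
  The double cosets of the Iwahori subgroup \<open>I\<close> are indexed here by
  \<open>\<int> \<times> \<int>\<close>: the pair \<open>(2 i, j)\<close> stands for the
  diagonal matrix \<open>eta 1 i j\<close> and \<open>(2 i + 1, j)\<close> for the
  antidiagonal matrix \<open>eta 2 i j\<close>. In these coordinates left multiplication by
  the two simple reflections \<open>(1, 0)\<close> and \<open>(-1, 0)\<close> is \<open>(k,
  j) \<mapsto> (1 - k, - j)\<close> and \<open>(k, j) \<mapsto> (- 1 - k, - j)\<close>, and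
  the first of them shortens exactly the positive pairs for the lexicographic order from the
  right, the second exactly the negative ones. Let \<open>T\<^sub>w\<close> be
  \<open>q\<close> times the characteristic function of the double coset of
  \<open>w\<close>. Left convolution by \<open>T\<^sub>s\<close> for a simple reflection
  \<open>s\<close> is then an explicit operator (\<open>left_simple\<close>) on all
  functions on \<open>\<int> \<times> \<int>\<close>, at every level \<open>j\<close>.

  Since \<open>s\<close> exchanges the levels \<open>j\<close> and \<open>- j\<close>, the
  product of the Hecke algebra truncates such convolutions at the levels other than zero,
  and it is not associative there. The argument therefore works with the untruncated
  operators. For an element \<open>h\<close> supported at level zero, left convolution by
  \<open>h\<close> is the operator \<open>left_action q h\<close>, a combination of products
  of the operators \<open>left_simple\<close> (\<open>cell_transversal_count\<close>,
  \<open>conv_finitary_left\<close>). Right convolution by \<open>h\<close> is its conjugate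
  under the inversion of the group (\<open>conv_finitary_right\<close>). Restricting the
  argument to one level and evaluating at that level gives the truncated product.

  The element \<open>f = Theta_plus + Theta_minus\<close> acts from the left by
  \<open>bernstein_op\<close>, and expanding this operator
  (\<open>bernstein_op_formula\<close>) shows that it commutes with inversion: apart from
  the pairs \<open>(k, 0)\<close> with \<open>\<bar>k\<bar> \<le> 1\<close> it is
  \<open>\<psi> \<mapsto> q\<inverse> \<psi> (k - 2, j) + q \<psi> (k + 2, j)\<close> on
  positive pairs and its mirror image on negative ones. Hence \<open>f\<close> and all
  polynomials in \<open>f\<close> act in the same way from both sides, at all levels, so
  that the algebra generated by \<open>f\<close> is central
  (\<open>generated_central\<close>).

  Conversely, let \<open>z\<close> be central and \<open>n > 0\<close>. The reflection
  \<open>(-1, 0)\<close> lengthens every element of level \<open>n\<close> from the left and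
  moves it to level \<open>- n\<close>, so the truncated left product with it vanishes on
  the part of \<open>z\<close> at level \<open>n\<close>. Right multiplication by the same
  reflection preserves the level and is injective, so this part is zero; the other
  reflection does the same for \<open>n < 0\<close> (\<open>center_hecke_subset\<close>).
  Finally, a central element of level zero is a polynomial in \<open>f\<close> by induction
  on the maximal length in its support: commutation with the two reflections forces this
  length to be even, \<open>2 m\<close> say, and the two coefficients of that length to
  agree, so that a multiple of \<open>f\<^sup>m\<close> can be subtracted
  (\<open>central_in_bernstein_span\<close>).
\<close>

section \<open>Transversals and double cosets\<close>

lemma ex1_in_filter:
  assumes "\<exists>!z. z \<in> R \<and> P z" "\<And>z. z \<in> R \<Longrightarrow> P z \<Longrightarrow> Q z"
  shows "\<exists>!z. z \<in> {z \<in> R. Q z} \<and> P z"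
proof -
  obtain z where z: "z \<in> R" "P z" "\<And>z'. z' \<in> R \<Longrightarrow> P z' \<Longrightarrow> z' = z" using assms(1) by auto
  show ?thesis by (rule ex1I[of _ z]) (use z assms(2) in blast)+
qed

text \<open>
  A relation that is a perfect matching counts both sides without an explicit bijection;
  below the matching is ``lie in the same coset''.
\<close>
lemma card_eq_of_unique_matching:
  assumes "\<And>a. a \<in> A \<Longrightarrow> \<exists>!b. b \<in> B \<and> P a b"
    and "\<And>b. b \<in> B \<Longrightarrow> \<exists>!a. a \<in> A \<and> P a b"
  shows "card A = card B"
proof -
  define f where "f = (\<lambda>a. THE b. b \<in> B \<and> P a b)"
  have f: "f a \<in> B \<and> P a (f a)" if "a \<in> A" for a
    unfolding f_def by (rule theI') (rule assms(1)[OF that])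
  have f_eq: "f a = b" if "a \<in> A" "b \<in> B" "P a b" for a b
    using assms(1)[OF that(1)] f[OF that(1)] that by blast
  have "bij_betw f A B"
  proof (rule bij_betw_imageI)
    show "inj_on f A"
    proof (rule inj_onI)
      fix a a' assume a: "a \<in> A" "a' \<in> A" "f a = f a'"
      then have "P a (f a)" "P a' (f a)" "f a \<in> B" using f by metis+
      then show "a = a'" using assms(2)[of "f a"] a by blast
    qed
    have "b \<in> f ` A" if "b \<in> B" for b
      using assms(2)[OF that] f_eq[OF _ that] by blast
    then show "f ` A = B" using f by blast
  qed
  then show ?thesis by (rule bij_betw_same_card)
qed

context group
begin

lemma inv_mult_cancel_left:
  assumes "x \<in> carrier G" "y \<in> carrier G"
  shows "inv x \<otimes> (x \<otimes> y) = y" and "x \<otimes> (inv x \<otimes> y) = y"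
proof -
  have "inv x \<otimes> (x \<otimes> y) = inv x \<otimes> x \<otimes> y" "x \<otimes> (inv x \<otimes> y) = x \<otimes> inv x \<otimes> y"
    by (rule m_assoc[symmetric]; use assms in simp)+
  then show "inv x \<otimes> (x \<otimes> y) = y" "x \<otimes> (inv x \<otimes> y) = y" using assms by simp_all
qed

lemmas group_normalize = m_assoc inv_mult_group inv_mult_cancel_left

definition left_transversal :: "'a set \<Rightarrow> 'a set \<Rightarrow> 'a set \<Rightarrow> bool" where
  "left_transversal H Y A \<longleftrightarrow>
     Y \<subseteq> A \<and> A \<subseteq> carrier G \<and> (\<forall>x\<in>A. \<exists>!y. y \<in> Y \<and> inv y \<otimes> x \<in> H)"

definition right_transversal :: "'a set \<Rightarrow> 'a set \<Rightarrow> 'a set \<Rightarrow> bool" where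
  "right_transversal H Z A \<longleftrightarrow>
     Z \<subseteq> A \<and> A \<subseteq> carrier G \<and> (\<forall>x\<in>A. \<exists>!z. z \<in> Z \<and> x \<otimes> inv z \<in> H)"

text \<open>
  Both sides count the pairs of a coset \<open>H z\<close> in \<open>B\<close> and a coset
  \<open>y H\<close> in \<open>A\<close> with \<open>x \<in> y H z\<close>, each of which
  determines the other. The left side is the number that defines the convolution of the
  characteristic functions of \<open>A\<close> and \<open>B\<close> at \<open>x\<close>; the
  right side is finite as soon as \<open>A\<close> consists of finitely many cosets, even
  when \<open>B\<close> does not.
\<close>
lemma card_right_transversal_eq_left:
  assumes R: "right_transversal H R B" and Y: "left_transversal H Y A"
    and AH: "\<And>a h. a \<in> A \<Longrightarrow> h \<in> H \<Longrightarrow> a \<otimes> h \<in> A"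
    and HB: "\<And>h b. h \<in> H \<Longrightarrow> b \<in> B \<Longrightarrow> h \<otimes> b \<in> B"
    and x: "x \<in> carrier G"
  shows "card {z \<in> R. x \<otimes> inv z \<in> A} = card {y \<in> Y. inv y \<otimes> x \<in> B}"
proof (rule card_eq_of_unique_matching[where P = "\<lambda>z y. inv y \<otimes> (x \<otimes> inv z) \<in> H"])
  fix z assume z: "z \<in> {z \<in> R. x \<otimes> inv z \<in> A}"
  then have zB: "z \<in> B" "z \<in> carrier G" using R by (auto simp: right_transversal_def)
  have in_B: "inv y \<otimes> x \<in> B" if "y \<in> Y" "inv y \<otimes> (x \<otimes> inv z) \<in> H" for y
  proof -
    have y: "y \<in> carrier G" using that Y by (auto simp: left_transversal_def)
    have "inv y \<otimes> (x \<otimes> inv z) \<otimes> z \<in> B" using HB[OF that(2) zB(1)] .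
    then show ?thesis using y x zB by (simp add: m_assoc)
  qed
  have "\<exists>!y. y \<in> Y \<and> inv y \<otimes> (x \<otimes> inv z) \<in> H"
    using z Y unfolding left_transversal_def by blast
  then show "\<exists>!y. y \<in> {y \<in> Y. inv y \<otimes> x \<in> B} \<and> inv y \<otimes> (x \<otimes> inv z) \<in> H"
    by (rule ex1_in_filter) (rule in_B)
next
  fix y assume y: "y \<in> {y \<in> Y. inv y \<otimes> x \<in> B}"
  then have yA: "y \<in> A" "y \<in> carrier G" using Y by (auto simp: left_transversal_def)
  have zc: "z \<in> carrier G" if "z \<in> R" for z using that R by (auto simp: right_transversal_def)
  have in_A: "x \<otimes> inv z \<in> A" if "z \<in> R" "inv y \<otimes> (x \<otimes> inv z) \<in> H" for z
  proof -
    have "y \<otimes> (inv y \<otimes> (x \<otimes> inv z)) \<in> A" using AH[OF yA(1) that(2)] .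
    then show ?thesis using yA x zc[OF that(1)] by (simp add: m_assoc[symmetric])
  qed
  have "\<exists>!z. z \<in> R \<and> inv y \<otimes> (x \<otimes> inv z) \<in> H"
  proof -
    have "\<exists>!z. z \<in> R \<and> inv y \<otimes> x \<otimes> inv z \<in> H"
      using y R unfolding right_transversal_def by blast
    moreover have "inv y \<otimes> x \<otimes> inv z \<in> H \<longleftrightarrow> inv y \<otimes> (x \<otimes> inv z) \<in> H" if "z \<in> R" for z
      using zc[OF that] x yA(2) by (simp add: m_assoc)
    ultimately show ?thesis by (simp cong: conj_cong)
  qed
  then show "\<exists>!z. z \<in> {z \<in> R. x \<otimes> inv z \<in> A} \<and> inv y \<otimes> (x \<otimes> inv z) \<in> H"
    by (rule ex1_in_filter) (rule in_A)
qed

text \<open>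
  The companion for a set \<open>B\<close> with finitely many cosets: the inverses of a left
  transversal of the inverse of \<open>B\<close> form a right transversal of
  \<open>B\<close>. Thus right convolution becomes left convolution after inversion.
\<close>
lemma card_right_transversal_eq_inverse:
  assumes H: "subgroup H G"
    and R: "right_transversal H R B" and Y: "left_transversal H Y B'"
    and B': "B' = (\<lambda>b. inv b) ` B"
    and AH: "\<And>a h. a \<in> A \<Longrightarrow> h \<in> H \<Longrightarrow> a \<otimes> h \<in> A"
    and x: "x \<in> carrier G"
  shows "card {z \<in> R. x \<otimes> inv z \<in> A} = card {y \<in> Y. x \<otimes> y \<in> A}"
proof (rule card_eq_of_unique_matching[where P = "\<lambda>z y. z \<otimes> y \<in> H"])
  have zc: "z \<in> carrier G \<and> z \<in> B" if "z \<in> R" for z using that R by (auto simp: right_transversal_def)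
  have yc: "y \<in> carrier G \<and> y \<in> B'" if "y \<in> Y" for y using that Y by (auto simp: left_transversal_def)
  have inv_iff: "inv a \<in> H \<longleftrightarrow> a \<in> H" if "a \<in> carrier G" for a
    using subgroup.m_inv_closed[OF H, of a] subgroup.m_inv_closed[OF H, of "inv a"] that by auto
  have iff: "x \<otimes> inv z \<in> A \<longleftrightarrow> x \<otimes> y \<in> A" if "z \<in> R" "y \<in> Y" "z \<otimes> y \<in> H" for z y
  proof
    assume "x \<otimes> inv z \<in> A"
    then have "x \<otimes> inv z \<otimes> (z \<otimes> y) \<in> A" using AH that by blast
    moreover have "x \<otimes> inv z \<otimes> (z \<otimes> y) = x \<otimes> y"
      using x zc[OF that(1)] yc[OF that(2)] by (simp add: group_normalize)
    ultimately show "x \<otimes> y \<in> A" by simp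
  next
    assume "x \<otimes> y \<in> A"
    then have "x \<otimes> y \<otimes> inv (z \<otimes> y) \<in> A" using AH subgroup.m_inv_closed[OF H that(3)] by blast
    moreover have "x \<otimes> y \<otimes> inv (z \<otimes> y) = x \<otimes> inv z"
      using x zc[OF that(1)] yc[OF that(2)] by (simp add: group_normalize)
    ultimately show "x \<otimes> inv z \<in> A" by simp
  qed
  {
    fix z assume z: "z \<in> {z \<in> R. x \<otimes> inv z \<in> A}"
    have "inv z \<in> B'" using z zc B' by auto
    then have "\<exists>!y. y \<in> Y \<and> inv y \<otimes> inv z \<in> H" using Y by (auto simp: left_transversal_def)
    moreover have "inv y \<otimes> inv z \<in> H \<longleftrightarrow> z \<otimes> y \<in> H" if "y \<in> Y" for y
      using inv_iff[of "z \<otimes> y"] z zc yc[OF that] by (simp add: inv_mult_group)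
    ultimately have "\<exists>!y. y \<in> Y \<and> z \<otimes> y \<in> H" by (simp cong: conj_cong)
    then show "\<exists>!y. y \<in> {y \<in> Y. x \<otimes> y \<in> A} \<and> z \<otimes> y \<in> H"
      by (rule ex1_in_filter) (use iff z in auto)
  }
  {
    fix y assume y: "y \<in> {y \<in> Y. x \<otimes> y \<in> A}"
    then obtain b where b: "b \<in> B" "y = inv b" using yc B' by auto
    have bc: "b \<in> carrier G" using b R by (auto simp: right_transversal_def)
    have "\<exists>!z. z \<in> R \<and> b \<otimes> inv z \<in> H" using R b by (auto simp: right_transversal_def)
    moreover have "b \<otimes> inv z \<in> H \<longleftrightarrow> z \<otimes> y \<in> H" if "z \<in> R" for z
      using inv_iff[of "z \<otimes> y"] bc b zc[OF that] by (simp add: inv_mult_group)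
    ultimately have "\<exists>!z. z \<in> R \<and> z \<otimes> y \<in> H" by (simp cong: conj_cong)
    then show "\<exists>!z. z \<in> {z \<in> R. x \<otimes> inv z \<in> A} \<and> z \<otimes> y \<in> H"
      by (rule ex1_in_filter) (use iff y in auto)
  }
qed

definition double_coset :: "'a set \<Rightarrow> 'a \<Rightarrow> 'a set" where
  "double_coset H w = {g \<otimes> w \<otimes> h | g h. g \<in> H \<and> h \<in> H}"

end

section \<open>Left multiplication by a simple reflection\<close>

text \<open>
  A simple reflection relative to an Iwahori subgroup, without reference to a Weyl group.
  The elements \<open>u s\<close> with \<open>u \<in> U\<close> represent the left cosets of
  \<open>H\<close> in \<open>H s H\<close> (assumption \<open>coset\<close>), and
  \<open>quadratic\<close> is what remains of the axiom \<open>s H s \<subseteq> H \<union>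
  H s H\<close> of a BN-pair.
\<close>
locale hecke_reflection = group G + subgroup H G for G (structure) and H +
  fixes s and U
  assumes s_closed: "s \<in> carrier G"
    and s_square: "s \<otimes> s \<in> H"
    and U_subset: "U \<subseteq> H" and U_finite: "finite U"
    and coset: "g \<in> H \<Longrightarrow> \<exists>!u. u \<in> U \<and> inv s \<otimes> inv u \<otimes> g \<otimes> s \<in> H"
    and quadratic: "u \<in> U \<Longrightarrow> u' \<in> U \<Longrightarrow> u \<noteq> u' \<Longrightarrow> inv s \<otimes> inv u \<otimes> u' \<otimes> s \<in> double_coset H s"
begin

text \<open>
  For SL2 the set \<open>U\<close> represents an affine root subgroup \<open>N\<close>
  modulo its intersection with the conjugate of \<open>H\<close> by \<open>s\<close>. The
  condition says that the inverse of \<open>w\<close> carries this root to a positive root,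
  which is the usual criterion for \<open>s w\<close> to be longer than \<open>w\<close>.
\<close>
definition ascent :: "'a \<Rightarrow> bool" where
  "ascent w \<longleftrightarrow> w \<in> carrier G \<and> (\<forall>u\<in>U. inv w \<otimes> u \<otimes> w \<in> H)"

lemma H_carrier: "h \<in> H \<Longrightarrow> h \<in> carrier G"
  using subset by blast

lemma U_carrier: "u \<in> U \<Longrightarrow> u \<in> carrier G"
  using U_subset H_carrier by blast

lemma double_cosetI: "g \<in> H \<Longrightarrow> h \<in> H \<Longrightarrow> g \<otimes> w \<otimes> h \<in> double_coset H w"
  by (auto simp: double_coset_def)

lemma double_coset_eq:
  assumes y: "y \<in> carrier G" and x: "x \<in> double_coset H y"
  shows "double_coset H x = double_coset H y"
proof -
  obtain a b where ab: "x = a \<otimes> y \<otimes> b" "a \<in> H" "b \<in> H" using x by (auto simp: double_coset_def)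
  have 1: "g \<otimes> x \<otimes> h = (g \<otimes> a) \<otimes> y \<otimes> (b \<otimes> h)"
    and 2: "g \<otimes> y \<otimes> h = (g \<otimes> inv a) \<otimes> x \<otimes> (inv b \<otimes> h)" if "g \<in> H" "h \<in> H" for g h
    using that ab y H_carrier by (simp_all add: group_normalize)
  show ?thesis
  proof (intro equalityI subsetI)
    fix z assume "z \<in> double_coset H x"
    then obtain g h where z: "z = g \<otimes> x \<otimes> h" "g \<in> H" "h \<in> H" by (auto simp: double_coset_def)
    show "z \<in> double_coset H y"
      unfolding z(1) 1[OF z(2,3)] by (intro double_cosetI m_closed z(2,3) ab(2,3))
  next
    fix z assume "z \<in> double_coset H y"
    then obtain g h where z: "z = g \<otimes> y \<otimes> h" "g \<in> H" "h \<in> H" by (auto simp: double_coset_def)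
    show "z \<in> double_coset H x"
      unfolding z(1) 2[OF z(2,3)] by (intro double_cosetI m_closed m_inv_closed z(2,3) ab(2,3))
  qed
qed

lemma double_coset_carrier: "w \<in> carrier G \<Longrightarrow> x \<in> double_coset H w \<Longrightarrow> x \<in> carrier G"
  by (auto simp: double_coset_def H_carrier)

lemma double_coset_left:
  assumes "w \<in> carrier G" "x \<in> double_coset H w" "h \<in> H"
  shows "h \<otimes> x \<in> double_coset H w"
proof -
  obtain a b where x: "x = a \<otimes> w \<otimes> b" "a \<in> H" "b \<in> H" using assms by (auto simp: double_coset_def)
  have "h \<otimes> x = (h \<otimes> a) \<otimes> w \<otimes> b" using x assms H_carrier by (simp add: m_assoc)
  moreover have "h \<otimes> a \<in> H" using x assms by simp
  ultimately show ?thesis using x unfolding double_coset_def by blast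
qed

lemma double_coset_right:
  assumes "w \<in> carrier G" "x \<in> double_coset H w" "h \<in> H"
  shows "x \<otimes> h \<in> double_coset H w"
proof -
  obtain a b where x: "x = a \<otimes> w \<otimes> b" "a \<in> H" "b \<in> H" using assms by (auto simp: double_coset_def)
  have "x \<otimes> h = a \<otimes> w \<otimes> (b \<otimes> h)" using x assms H_carrier by (simp add: m_assoc)
  moreover have "b \<otimes> h \<in> H" using x assms by simp
  ultimately show ?thesis using x unfolding double_coset_def by blast
qed

lemma double_coset_self:
  assumes "w \<in> carrier G"
  shows "w \<in> double_coset H w"
  using double_cosetI[of \<one> \<one> w] subgroup.one_closed[OF subgroup_axioms] assms by simp

text \<open>
  The rule \<open>H s H w H = H s w H\<close> for adding lengths.
\<close>
lemma ascent_mult: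
  assumes w: "ascent w" and x: "x \<in> double_coset H s" and y: "y \<in> double_coset H w"
  shows "x \<otimes> y \<in> double_coset H (s \<otimes> w)"
proof -
  have wc: "w \<in> carrier G" using w by (simp add: ascent_def)
  obtain a b where x': "x = a \<otimes> s \<otimes> b" "a \<in> H" "b \<in> H" using x by (auto simp: double_coset_def)
  obtain c d where y': "y = c \<otimes> w \<otimes> d" "c \<in> H" "d \<in> H" using y by (auto simp: double_coset_def)
  have bc: "b \<otimes> c \<in> H" "inv (b \<otimes> c) \<in> H" using x' y' by auto
  obtain u where u: "u \<in> U" "inv s \<otimes> inv u \<otimes> inv (b \<otimes> c) \<otimes> s \<in> H"
    using coset[OF bc(2)] by auto
  define k where "k = (s \<otimes> s) \<otimes> inv (inv s \<otimes> inv u \<otimes> inv (b \<otimes> c) \<otimes> s) \<otimes> inv (s \<otimes> s)"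
  have k: "k \<in> H" using u s_square by (simp add: k_def)
  note cl = s_closed wc H_carrier[OF x'(2)] H_carrier[OF x'(3)] H_carrier[OF y'(2)]
    H_carrier[OF y'(3)] U_carrier[OF u(1)] H_carrier[OF k]
  have uw: "inv w \<otimes> inv u \<otimes> w \<in> H"
  proof -
    have "inv (inv w \<otimes> u \<otimes> w) \<in> H" using w u by (simp add: ascent_def)
    then show ?thesis using cl by (simp add: group_normalize)
  qed
  \<comment> \<open>The element \<open>u\<close> was chosen so that \<open>b c\<close> moves past \<open>s\<close> up to a factor \<open>inv u\<close>,
    which the ascent condition absorbs on the other side of \<open>w\<close>.\<close>
  have "x \<otimes> y = (a \<otimes> k) \<otimes> (s \<otimes> w) \<otimes> ((inv w \<otimes> inv u \<otimes> w) \<otimes> d)"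
    unfolding x' y' k_def using cl by (simp add: group_normalize)
  moreover have "a \<otimes> k \<in> H" "(inv w \<otimes> inv u \<otimes> w) \<otimes> d \<in> H" using x' y' k uw by auto
  ultimately show ?thesis unfolding double_coset_def by blast
qed

lemma inv_s_inv_U:
  assumes u: "u \<in> U"
  shows "inv s \<otimes> inv u \<in> double_coset H s"
proof -
  have "inv s = inv (s \<otimes> s) \<otimes> s \<otimes> \<one>" using s_closed by (simp add: group_normalize)
  then have "inv s \<in> double_coset H s"
    using double_cosetI[of "inv (s \<otimes> s)" \<one> s] s_square by simp
  then show ?thesis using u U_subset by (intro double_coset_right s_closed) auto
qed

lemma ascent_carrier: "ascent w \<Longrightarrow> w \<in> carrier G"
  by (simp add: ascent_def)

text \<open>
  Left convolution by the characteristic function of \<open>H s H\<close>, evaluated on a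
  double coset that \<open>s\<close> lengthens: all \<open>card U\<close> translates of
  \<open>x\<close> lie in the double coset of \<open>s w\<close>.
\<close>
lemma sum_ascent:
  fixes \<phi> :: "'a \<Rightarrow> complex"
  assumes w: "ascent w" and x: "x \<in> double_coset H w"
    and \<phi>: "\<And>y. y \<in> double_coset H (s \<otimes> w) \<Longrightarrow> \<phi> y = c"
  shows "(\<Sum>u\<in>U. \<phi> (inv s \<otimes> inv u \<otimes> x)) = of_nat (card U) * c"
proof -
  have "(\<Sum>u\<in>U. \<phi> (inv s \<otimes> inv u \<otimes> x)) = (\<Sum>u\<in>U. c)"
    by (intro sum.cong refl \<phi> ascent_mult[OF w _ x] inv_s_inv_U)
  then show ?thesis by simp
qed

text \<open>
  On a double coset that \<open>s\<close> shortens, exactly one translate of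
  \<open>x\<close> falls into the shorter double coset; the quadratic relation keeps the
  others where they were.
\<close>
lemma sum_descent:
  fixes \<phi> :: "'a \<Rightarrow> complex"
  assumes w: "ascent w" and x: "x \<in> double_coset H (s \<otimes> w)"
    and c: "\<And>y. y \<in> double_coset H w \<Longrightarrow> \<phi> y = c"
    and d: "\<And>y. y \<in> double_coset H (s \<otimes> w) \<Longrightarrow> \<phi> y = d"
  shows "(\<Sum>u\<in>U. \<phi> (inv s \<otimes> inv u \<otimes> x)) = c + (of_nat (card U) - 1) * d"
proof -
  note wc = ascent_carrier[OF w]
  obtain g h where gh: "x = g \<otimes> (s \<otimes> w) \<otimes> h" "g \<in> H" "h \<in> H"
    using x by (auto simp: double_coset_def)
  obtain u0 where u0: "u0 \<in> U" "inv s \<otimes> inv u0 \<otimes> g \<otimes> s \<in> H" using coset[OF gh(2)] by auto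
  have "inv s \<otimes> inv u0 \<otimes> g \<otimes> s \<otimes> w \<otimes> h \<in> double_coset H w"
    using u0 gh by (intro double_cosetI)
  then have x0: "inv s \<otimes> inv u0 \<otimes> x \<in> double_coset H w"
    using gh H_carrier U_carrier[OF u0(1)] s_closed wc by (simp add: m_assoc)
  have "\<phi> (inv s \<otimes> inv u \<otimes> x) = d" if u: "u \<in> U - {u0}" for u
  proof -
    have "inv s \<otimes> inv u \<otimes> u0 \<otimes> s \<in> double_coset H s" using quadratic u u0 by auto
    from ascent_mult[OF w this x0]
    have "inv s \<otimes> inv u \<otimes> x \<in> double_coset H (s \<otimes> w)"
      using u U_carrier u0 s_closed double_coset_carrier[OF _ x] wc by (simp add: group_normalize)
    then show ?thesis by (rule d)
  qed
  then have "(\<Sum>u\<in>U. \<phi> (inv s \<otimes> inv u \<otimes> x)) = c + (\<Sum>u\<in>U - {u0}. d)"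
    by (subst sum.remove[OF U_finite u0(1)]) (simp add: c[OF x0])
  moreover have "card U > 0" using U_finite u0 by (auto simp: card_gt_0_iff)
  then have "card U \<ge> 1" by simp
  ultimately show ?thesis using u0 by (simp add: U_finite of_nat_diff)
qed

text \<open>
  When lengths add, a transversal of \<open>H s w H\<close> is the product of transversals
  of \<open>H s H\<close> and \<open>H w H\<close>. Therefore left convolution by
  \<open>T\<close> of \<open>s w\<close> is the composition of the left convolutions by
  \<open>T\<close> of \<open>s\<close> and of \<open>w\<close>, on arbitrary bi-invariant
  functions.
\<close>
lemma left_transversal_step:
  assumes w: "ascent w" and disjnt: "double_coset H w \<inter> double_coset H (s \<otimes> w) = {}"
    and Y: "left_transversal H Y (double_coset H w)"
  shows "inj_on (\<lambda>(u, y). u \<otimes> s \<otimes> y) (U \<times> Y)" (is ?inj)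
    and "left_transversal H ((\<lambda>(u, y). u \<otimes> s \<otimes> y) ` (U \<times> Y)) (double_coset H (s \<otimes> w))" (is ?trans)
proof -
  have wc: "w \<in> carrier G" using w by (simp add: ascent_def)
  have Yc: "y \<in> carrier G" "y \<in> double_coset H w" if "y \<in> Y" for y
    using that Y by (auto simp: left_transversal_def)
  have us: "u \<otimes> s \<in> double_coset H s" if "u \<in> U" for u
    using that U_subset double_coset_self[OF s_closed] s_closed
    by (intro double_coset_left) auto
  have unique: "u = u' \<and> y = y'"
    if u: "u \<in> U" "u' \<in> U" and y: "y \<in> Y" "y' \<in> Y" and x: "x \<in> carrier G"
      and xy: "inv (u \<otimes> s \<otimes> y) \<otimes> x \<in> H" "inv (u' \<otimes> s \<otimes> y') \<otimes> x \<in> H" for u u' y y' x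
  proof -
    note cl = s_closed wc U_carrier[OF u(1)] U_carrier[OF u(2)] Yc(1)[OF y(1)] Yc(1)[OF y(2)] x
    define p where "p = inv s \<otimes> inv u \<otimes> x"
    define p' where "p' = inv s \<otimes> inv u' \<otimes> x"
    have h: "inv y \<otimes> p \<in> H" "inv y' \<otimes> p' \<in> H"
      using xy cl by (simp_all add: p_def p'_def group_normalize)
    have "y \<otimes> (inv y \<otimes> p) \<in> double_coset H w" "y' \<otimes> (inv y' \<otimes> p') \<in> double_coset H w"
      using h y Yc wc by (auto intro!: double_coset_right)
    then have p: "p \<in> double_coset H w" "p' \<in> double_coset H w"
      using cl by (simp_all add: p_def p'_def group_normalize)
    have "u = u'"
    proof (rule ccontr)
      assume "u \<noteq> u'"
      then have "inv s \<otimes> inv u' \<otimes> u \<otimes> s \<in> double_coset H s" using quadratic u by auto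
      from ascent_mult[OF w this p(1)] have "p' \<in> double_coset H (s \<otimes> w)"
        using cl by (simp add: p_def p'_def group_normalize)
      then show False using p disjnt by blast
    qed
    then have "p = p'" by (simp add: p_def p'_def)
    then have "y = y'" using h y p Y by (auto simp: left_transversal_def)
    then show ?thesis using \<open>u = u'\<close> by simp
  qed
  show ?inj
  proof (rule inj_onI, clarify)
    fix u y u' y' assume *: "u \<in> U" "u' \<in> U" "y \<in> Y" "y' \<in> Y" "u \<otimes> s \<otimes> y = u' \<otimes> s \<otimes> y'"
    have "inv (u \<otimes> s \<otimes> y) \<otimes> (u \<otimes> s \<otimes> y) \<in> H"
      using * U_carrier Yc s_closed by (subst l_inv) auto
    then show "u = u' \<and> y = y'"
      using * U_carrier Yc s_closed by (intro unique[of u u' y y' "u \<otimes> s \<otimes> y"]) auto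
  qed
  have ex: "\<exists>u\<in>U. \<exists>y\<in>Y. inv (u \<otimes> s \<otimes> y) \<otimes> x \<in> H" if x: "x \<in> double_coset H (s \<otimes> w)" for x
  proof -
    obtain g h where gh: "x = g \<otimes> (s \<otimes> w) \<otimes> h" "g \<in> H" "h \<in> H"
      using x by (auto simp: double_coset_def)
    obtain u where u: "u \<in> U" "inv s \<otimes> inv u \<otimes> g \<otimes> s \<in> H" using coset[OF gh(2)] by auto
    have "inv s \<otimes> inv u \<otimes> g \<otimes> s \<otimes> w \<otimes> h \<in> double_coset H w"
      unfolding double_coset_def using u gh by blast
    then obtain y where y: "y \<in> Y" "inv y \<otimes> (inv s \<otimes> inv u \<otimes> g \<otimes> s \<otimes> w \<otimes> h) \<in> H"
      using Y by (auto simp: left_transversal_def)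
    have "inv (u \<otimes> s \<otimes> y) \<otimes> x = inv y \<otimes> (inv s \<otimes> inv u \<otimes> g \<otimes> s \<otimes> w \<otimes> h)"
      using s_closed wc U_carrier[OF u(1)] Yc(1)[OF y(1)] H_carrier gh
      by (simp add: group_normalize)
    then show ?thesis using u y by (intro bexI[of _ u] bexI[of _ y]) simp_all
  qed
  have "(\<lambda>(u, y). u \<otimes> s \<otimes> y) ` (U \<times> Y) \<subseteq> double_coset H (s \<otimes> w)"
    using ascent_mult[OF w us] Yc by auto
  moreover have "double_coset H (s \<otimes> w) \<subseteq> carrier G"
    using double_coset_carrier wc s_closed by blast
  moreover have "\<exists>!z. z \<in> (\<lambda>(u, y). u \<otimes> s \<otimes> y) ` (U \<times> Y) \<and> inv z \<otimes> x \<in> H"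
    if x: "x \<in> double_coset H (s \<otimes> w)" for x
  proof -
    have xc: "x \<in> carrier G" using x double_coset_carrier wc s_closed by blast
    obtain u y where uy: "u \<in> U" "y \<in> Y" "inv (u \<otimes> s \<otimes> y) \<otimes> x \<in> H" using ex[OF x] by blast
    show ?thesis
    proof (rule ex1I[of _ "u \<otimes> s \<otimes> y"])
      fix z assume "z \<in> (\<lambda>(u, y). u \<otimes> s \<otimes> y) ` (U \<times> Y) \<and> inv z \<otimes> x \<in> H"
      then obtain u' y' where z: "z = u' \<otimes> s \<otimes> y'" "u' \<in> U" "y' \<in> Y" "inv (u' \<otimes> s \<otimes> y') \<otimes> x \<in> H"
        by auto
      have "u = u' \<and> y = y'" by (rule unique[OF uy(1) z(2) uy(2) z(3) xc uy(3) z(4)])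
      then show "z = u \<otimes> s \<otimes> y" using z by simp
    qed (use uy in auto)
  qed
  ultimately show ?trans unfolding left_transversal_def by (intro conjI ballI)
qed

end

section \<open>The two generators as operators on functions on the Weyl group\<close>

type_synonym index = "int \<times> int"

text \<open>
  Left multiplication by a simple reflection: \<open>True\<close> stands for the reflection
  \<open>(1, 0)\<close> and \<open>False\<close> for \<open>(-1, 0)\<close>.
\<close>
definition flip :: "bool \<Rightarrow> index \<Rightarrow> index" where
  "flip b = (\<lambda>(k, j). ((if b then 1 else - 1) - k, - j))"

text \<open>
  In these coordinates the elements shortened by \<open>(1, 0)\<close> are the positive ones
  and those shortened by \<open>(-1, 0)\<close> the negative ones; only \<open>(0,
  0)\<close> is shortened by neither. At a level other than zero one of the reflections
  shortens all elements, which can happen because lengths are infinite there.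
\<close>
definition descent :: "bool \<Rightarrow> index \<Rightarrow> bool" where
  "descent b = (\<lambda>(k, j). if b then j > 0 \<or> (j = 0 \<and> k > 0) else j < 0 \<or> (j = 0 \<and> k < 0))"

lemma flip_flip [simp]: "flip b (flip b w) = w"
  by (cases w) (simp add: flip_def)

lemma descent_flip [simp]: "descent b (flip b w) \<longleftrightarrow> \<not> descent b w"
  by (cases w) (auto simp: flip_def descent_def)

text \<open>
  Left multiplication by \<open>T\<^sub>s\<close> on functions, that is, on coefficients
  with respect to characteristic functions.
\<close>
definition left_simple :: "complex \<Rightarrow> bool \<Rightarrow> (index \<Rightarrow> complex) \<Rightarrow> index \<Rightarrow> complex" where
  "left_simple q b \<psi> w =
     (if descent b w then \<psi> (flip b w) + (q - 1) * \<psi> w else q * \<psi> (flip b w))"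

lemma left_simple_left_simple: "left_simple q b (left_simple q b \<psi>) w = (q - 1) * left_simple q b \<psi> w + q * \<psi> w"
  by (simp add: left_simple_def algebra_simps)

lemma left_simple_add: "left_simple q b (\<lambda>w. \<phi> w + \<psi> w) w = left_simple q b \<phi> w + left_simple q b \<psi> w"
  by (simp add: left_simple_def algebra_simps)

lemma left_simple_scale: "left_simple q b (\<lambda>w. c * \<psi> w) w = c * left_simple q b \<psi> w"
  by (simp add: left_simple_def algebra_simps)

lemma left_simple_sum: "left_simple q b (\<lambda>w. \<Sum>k\<in>K. \<psi> k w) w = (\<Sum>k\<in>K. left_simple q b (\<psi> k) w)"
  by (simp add: left_simple_def sum.distrib sum_distrib_left)

fun alternating :: "bool \<Rightarrow> nat \<Rightarrow> bool list" where
  "alternating b 0 = []"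
| "alternating b (Suc n) = b # alternating (\<not> b) n"

fun left_word :: "complex \<Rightarrow> bool list \<Rightarrow> (index \<Rightarrow> complex) \<Rightarrow> index \<Rightarrow> complex" where
  "left_word q [] \<psi> = \<psi>"
| "left_word q (b # bs) \<psi> = left_simple q b (left_word q bs \<psi>)"

text \<open>
  The elements of level zero form an infinite dihedral group, in which \<open>k\<close> has
  length \<open>\<bar>k\<bar>\<close> and the first letter of its unique reduced word is
  determined by the sign of \<open>k\<close>.
\<close>
definition reduced_word :: "int \<Rightarrow> bool list" where
  "reduced_word k = alternating (k > 0) (nat \<bar>k\<bar>)"

text \<open>
  Left multiplication by \<open>T\<close> of the element \<open>(k, 0)\<close>.
\<close>
definition left_elem :: "complex \<Rightarrow> int \<Rightarrow> (index \<Rightarrow> complex) \<Rightarrow> index \<Rightarrow> complex" where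
  "left_elem q k = left_word q (reduced_word k)"

lemma reduced_word_flip:
  assumes "\<not> descent b (k, 0)"
  shows "reduced_word (fst (flip b (k, 0))) = b # reduced_word k"
proof -
  have "nat \<bar>fst (flip b (k, 0))\<bar> = Suc (nat \<bar>k\<bar>)"
    using assms by (auto simp: flip_def descent_def split: if_splits)
  moreover have "fst (flip b (k, 0)) > 0 \<longleftrightarrow> b"
    using assms by (auto simp: flip_def descent_def split: if_splits)
  moreover have "alternating (k > 0) (nat \<bar>k\<bar>) = alternating (\<not> b) (nat \<bar>k\<bar>)"
    using assms by (cases "k = 0") (auto simp: descent_def split: if_splits)
  ultimately show ?thesis by (simp add: reduced_word_def)
qed

lemma left_simple_left_elem_ascent:
  "\<not> descent b (k, 0) \<Longrightarrow> left_simple q b (left_elem q k \<psi>) = left_elem q (fst (flip b (k, 0))) \<psi>"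
  by (simp add: left_elem_def reduced_word_flip)

lemma left_simple_left_elem_descent:
  assumes "descent b (k, 0)"
  shows "left_simple q b (left_elem q k \<psi>) w
    = (q - 1) * left_elem q k \<psi> w + q * left_elem q (fst (flip b (k, 0))) \<psi> w"
proof -
  obtain k' where k': "flip b (k, 0) = (k', 0)" by (simp add: flip_def)
  have "\<not> descent b (k', 0)" using assms descent_flip[of b "(k, 0)"] k' by simp
  moreover have "fst (flip b (k', 0)) = k" using flip_flip[of b "(k, 0)"] k' by simp
  ultimately have "left_elem q k \<psi> = left_simple q b (left_elem q k' \<psi>)"
    using left_simple_left_elem_ascent[of b k' q \<psi>] by simp
  then show ?thesis by (simp add: left_simple_left_simple k')
qed

text \<open>
  The coefficient functions of the elements of the affine Hecke algebra at level zero.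
\<close>
definition finitary :: "(index \<Rightarrow> complex) \<Rightarrow> bool" where
  "finitary h \<longleftrightarrow> finite {k. h (k, 0) \<noteq> 0} \<and> (\<forall>k j. j \<noteq> 0 \<longrightarrow> h (k, j) = 0)"

text \<open>
  The characteristic function of a double coset is \<open>T\<close> divided by
  \<open>q\<close>, which accounts for the factor in front.
\<close>
definition left_action :: "complex \<Rightarrow> (index \<Rightarrow> complex) \<Rightarrow> (index \<Rightarrow> complex) \<Rightarrow> index \<Rightarrow> complex" where
  "left_action q h \<psi> w = inverse q * (\<Sum>k\<in>{k. h (k, 0) \<noteq> 0}. h (k, 0) * left_elem q k \<psi> w)"

lemma left_action_eq_sum:
  assumes "finite K" "\<And>k. k \<notin> K \<Longrightarrow> h (k, 0) = 0"
  shows "left_action q h \<psi> w = inverse q * (\<Sum>k\<in>K. h (k, 0) * left_elem q k \<psi> w)"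
proof -
  have "(\<Sum>k\<in>{k. h (k, 0) \<noteq> 0}. h (k, 0) * left_elem q k \<psi> w) = (\<Sum>k\<in>K. h (k, 0) * left_elem q k \<psi> w)"
    by (rule sum.mono_neutral_left) (use assms in auto)
  then show ?thesis by (simp add: left_action_def)
qed

lemma finitary_add: "finitary g \<Longrightarrow> finitary h \<Longrightarrow> finitary (\<lambda>w. g w + h w)"
proof -
  assume "finitary g" "finitary h"
  moreover have "{k. g (k, 0) + h (k, 0) \<noteq> 0} \<subseteq> {k. g (k, 0) \<noteq> 0} \<union> {k. h (k, 0) \<noteq> 0}"
    by auto
  ultimately show ?thesis
    unfolding finitary_def by (auto intro: finite_subset)
qed

lemma finitary_scale: "finitary h \<Longrightarrow> finitary (\<lambda>w. c * h w)"
proof -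
  assume "finitary h"
  moreover have "{k. c * h (k, 0) \<noteq> 0} \<subseteq> {k. h (k, 0) \<noteq> 0}"
    by auto
  ultimately show ?thesis
    unfolding finitary_def by (auto intro: finite_subset)
qed

lemma finitary_left_simple:
  assumes "finitary h"
  shows "finitary (left_simple q b h)"
proof -
  let ?S = "{k. h (k, 0) \<noteq> 0}"
  have "{k. left_simple q b h (k, 0) \<noteq> 0} \<subseteq> ?S \<union> (\<lambda>k. fst (flip b (k, 0))) ` ?S"
  proof
    fix k assume "k \<in> {k. left_simple q b h (k, 0) \<noteq> 0}"
    then have "h (k, 0) \<noteq> 0 \<or> h (flip b (k, 0)) \<noteq> 0" by (auto simp: left_simple_def split: if_splits)
    moreover have "flip b (k, 0) = (fst (flip b (k, 0)), 0)" by (simp add: flip_def)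
    moreover have "k = fst (flip b (fst (flip b (k, 0)), 0))" by (simp add: flip_def)
    ultimately show "k \<in> ?S \<union> (\<lambda>k. fst (flip b (k, 0))) ` ?S" by (metis (mono_tags, lifting) UnI1 UnI2 image_eqI mem_Collect_eq)
  qed
  then have "finite {k. left_simple q b h (k, 0) \<noteq> 0}"
    using assms by (auto simp: finitary_def intro: finite_subset)
  then show ?thesis using assms by (auto simp: finitary_def left_simple_def flip_def)
qed

text \<open>
  Associativity of the form \<open>(T\<^sub>s h) \<psi> = T\<^sub>s (h \<psi>)\<close>. It
  holds because the operators \<open>left_elem\<close> satisfy the same multiplication rules
  as the basis elements of the Hecke algebra.
\<close>
lemma left_action_left_simple:
  assumes "finitary h"
  shows "left_action q (left_simple q b h) \<psi> = left_simple q b (left_action q h \<psi>)"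
proof
  fix w
  define f where "f = (\<lambda>k. fst (flip b (k, 0)))"
  have fl: "flip b (k, 0) = (f k, 0)" for k by (simp add: f_def flip_def)
  have ff: "f (f k) = k" for k by (simp add: f_def flip_def)
  have df: "descent b (f k, 0) \<longleftrightarrow> \<not> descent b (k, 0)" for k
    using descent_flip[of b "(k, 0)"] by (simp add: fl)
  let ?S = "{k. h (k, 0) \<noteq> 0}"
  define D where "D = {k \<in> ?S \<union> f ` ?S. descent b (k, 0)}"
  have "finite (?S \<union> f ` ?S)" using assms by (simp add: finitary_def)
  then have D: "finite D" unfolding D_def by (rule finite_subset[rotated]) auto
  define K where "K = D \<union> f ` D"
  have K: "finite K" using D by (simp add: K_def)
  have SK: "k \<in> K" if "h (k, 0) \<noteq> 0" for k
  proof (cases "descent b (k, 0)")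
    case True
    then show ?thesis using that by (simp add: K_def D_def)
  next
    case False
    then have "f k \<in> D" using that by (auto simp: D_def df)
    then show ?thesis using ff[of k] by (force simp: K_def)
  qed
  have outside: "h (k, 0) = 0" "left_simple q b h (k, 0) = 0" if "k \<notin> K" for k
  proof -
    have "f k \<notin> K"
    proof
      assume "f k \<in> K"
      moreover have "f ` K = K" by (auto simp: K_def image_Un image_image ff)
      ultimately have "f (f k) \<in> K" by blast
      then show False using that by (simp add: ff)
    qed
    then have "h (k, 0) = 0" "h (f k, 0) = 0" using that SK by blast+
    then show "h (k, 0) = 0" "left_simple q b h (k, 0) = 0" by (simp_all add: left_simple_def fl)
  qed
  have split: "sum g K = (\<Sum>k\<in>D. g k + g (f k))" for g :: "int \<Rightarrow> complex"
  proof -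
    have "inj_on f D" by (rule inj_onI) (metis ff)
    then have "sum g (f ` D) = (\<Sum>k\<in>D. g (f k))" by (simp add: sum.reindex)
    moreover have "D \<inter> f ` D = {}" using df by (auto simp: D_def)
    ultimately show ?thesis using D by (simp add: K_def sum.union_disjoint sum.distrib)
  qed
  \<comment> \<open>Pairing \<open>k\<close> with its flip reduces both sides to the two multiplication rules.\<close>
  have "left_simple q b (left_action q h \<psi>) w = inverse q * (\<Sum>k\<in>K. h (k, 0) * left_simple q b (left_elem q k \<psi>) w)"
  proof -
    have "left_action q h \<psi> = (\<lambda>w. inverse q * (\<Sum>k\<in>K. h (k, 0) * left_elem q k \<psi> w))"
      by (rule ext) (rule left_action_eq_sum[of K h, OF K outside(1)])
    then show ?thesis by (simp only: left_simple_scale left_simple_sum)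
  qed
  also have "(\<Sum>k\<in>K. h (k, 0) * left_simple q b (left_elem q k \<psi>) w) = (\<Sum>k\<in>K. left_simple q b h (k, 0) * left_elem q k \<psi> w)"
    unfolding split
  proof (rule sum.cong[OF refl])
    fix k assume "k \<in> D"
    then have d: "descent b (k, 0)" by (simp add: D_def)
    then show "h (k, 0) * left_simple q b (left_elem q k \<psi>) w + h (f k, 0) * left_simple q b (left_elem q (f k) \<psi>) w
        = left_simple q b h (k, 0) * left_elem q k \<psi> w + left_simple q b h (f k, 0) * left_elem q (f k) \<psi> w"
      using left_simple_left_elem_descent[OF d, of q \<psi> w] left_simple_left_elem_ascent[of b "f k" q \<psi>]
      by (simp add: df fl ff) (simp add: left_simple_def[of q b h] df fl ff algebra_simps)
  qed
  finally show "left_action q (left_simple q b h) \<psi> w = left_simple q b (left_action q h \<psi>) w"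
    by (simp add: left_action_eq_sum[of K "left_simple q b h", OF K outside(2)])
qed

lemma left_action_add:
  assumes "finitary g" "finitary h"
  shows "left_action q (\<lambda>w. g w + h w) \<psi> = (\<lambda>w. left_action q g \<psi> w + left_action q h \<psi> w)"
proof
  fix w
  let ?K = "{k. g (k, 0) \<noteq> 0} \<union> {k. h (k, 0) \<noteq> 0}"
  have K: "finite ?K" using assms by (simp add: finitary_def)
  have "left_action q g \<psi> w = inverse q * (\<Sum>k\<in>?K. g (k, 0) * left_elem q k \<psi> w)"
    "left_action q h \<psi> w = inverse q * (\<Sum>k\<in>?K. h (k, 0) * left_elem q k \<psi> w)"
    "left_action q (\<lambda>w. g w + h w) \<psi> w = inverse q * (\<Sum>k\<in>?K. (g (k, 0) + h (k, 0)) * left_elem q k \<psi> w)"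
    by (rule left_action_eq_sum[OF K]; auto)+
  then show "left_action q (\<lambda>w. g w + h w) \<psi> w = left_action q g \<psi> w + left_action q h \<psi> w"
    by (simp add: algebra_simps sum.distrib)
qed

lemma left_action_scale:
  assumes "finitary h"
  shows "left_action q (\<lambda>w. c * h w) \<psi> = (\<lambda>w. c * left_action q h \<psi> w)"
proof
  fix w
  let ?K = "{k. h (k, 0) \<noteq> 0}"
  have K: "finite ?K" using assms by (simp add: finitary_def)
  have "left_action q h \<psi> w = inverse q * (\<Sum>k\<in>?K. h (k, 0) * left_elem q k \<psi> w)"
    "left_action q (\<lambda>w. c * h w) \<psi> w = inverse q * (\<Sum>k\<in>?K. (c * h (k, 0)) * left_elem q k \<psi> w)"
    by (rule left_action_eq_sum[OF K]; auto)+
  then show "left_action q (\<lambda>w. c * h w) \<psi> w = c * left_action q h \<psi> w"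
    by (simp add: algebra_simps sum_distrib_left)
qed

section \<open>The Bernstein element\<close>

definition unit_coeffs :: "complex \<Rightarrow> index \<Rightarrow> complex" where
  "unit_coeffs q w = (if w = (0, 0) then q else 0)"

lemma finitary_unit: "finitary (unit_coeffs q)"
  by (auto simp: finitary_def unit_coeffs_def)

lemma left_elem_0 [simp]: "left_elem q 0 \<psi> = \<psi>"
  by (simp add: left_elem_def reduced_word_def)

lemma left_action_unit:
  assumes "q \<noteq> 0"
  shows "left_action q (unit_coeffs q) \<psi> = \<psi>"
proof
  fix w
  show "left_action q (unit_coeffs q) \<psi> w = \<psi> w"
    using assms by (subst left_action_eq_sum[of "{0}"]) (simp_all add: unit_coeffs_def)
qed

text \<open>
  The coefficients of \<open>Theta_plus + Theta_minus\<close>: the translations \<open>eta 1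
  1 0\<close> and \<open>eta 1 (-1) 0\<close> have the indices \<open>2\<close> and
  \<open>-2\<close>, the two reflections the indices \<open>1\<close> and \<open>-1\<close>.
\<close>
definition bernstein_coeffs :: "complex \<Rightarrow> index \<Rightarrow> complex" where
  "bernstein_coeffs q = (\<lambda>(k, j).
     if j \<noteq> 0 then 0 else if \<bar>k\<bar> = 2 then 1 else if \<bar>k\<bar> = 1 then 1 - q
     else if k = 0 then (q - 1)\<^sup>2 else 0)"

definition bernstein_op :: "complex \<Rightarrow> (index \<Rightarrow> complex) \<Rightarrow> index \<Rightarrow> complex" where
  "bernstein_op q = left_action q (bernstein_coeffs q)"

lemma bernstein_op_eq_left_simple:
  "bernstein_op q \<psi> w = inverse q * (left_simple q True (left_simple q False \<psi>) w + left_simple q False (left_simple q True \<psi>) w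
     - (q - 1) * (left_simple q True \<psi> w + left_simple q False \<psi> w) + (q - 1)\<^sup>2 * \<psi> w)"
proof -
  have "nat 2 = Suc (Suc 0)" by simp
  then have "left_elem q 2 \<psi> = left_simple q True (left_simple q False \<psi>)" "left_elem q (-2) \<psi> = left_simple q False (left_simple q True \<psi>)"
    "left_elem q 1 \<psi> = left_simple q True \<psi>" "left_elem q (-1) \<psi> = left_simple q False \<psi>"
    by (simp_all add: left_elem_def reduced_word_def del: nat_numeral)
  moreover have "bernstein_op q \<psi> w = inverse q * (\<Sum>k\<in>{2, -2, 1, -1, 0}. bernstein_coeffs q (k, 0) * left_elem q k \<psi> w)"
    unfolding bernstein_op_def by (rule left_action_eq_sum) (auto simp: bernstein_coeffs_def)
  ultimately show ?thesis by (simp add: bernstein_coeffs_def algebra_simps)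
qed

text \<open>
  Away from the unit the terms with \<open>q - 1\<close> cancel, and at the other levels so
  do all contributions from level \<open>- j\<close>: the Bernstein element preserves the
  levels. Since \<open>k - 2\<close> and \<open>k + 2\<close> have the parity of
  \<open>k\<close>, inversion either exchanges the first two lines or fixes both, and it
  respects the exceptional lines as well. The factor \<open>q\<close> on the left avoids
  denominators.
\<close>
lemma bernstein_op_formula:
  assumes "q \<noteq> 0"
  shows "q * bernstein_op q \<psi> (k, j) =
    (if j > 0 \<or> (j = 0 \<and> k > 1) then \<psi> (k - 2, j) + q\<^sup>2 * \<psi> (k + 2, j)
     else if j < 0 \<or> (j = 0 \<and> k < -1) then \<psi> (k + 2, j) + q\<^sup>2 * \<psi> (k - 2, j)
     else if k = 1 then q\<^sup>2 * \<psi> (3, 0) + q * \<psi> (-1, 0) - (q - 1) * \<psi> (0, 0)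
     else if k = -1 then q\<^sup>2 * \<psi> (-3, 0) + q * \<psi> (1, 0) - (q - 1) * \<psi> (0, 0)
     else q\<^sup>2 * (\<psi> (2, 0) + \<psi> (-2, 0)) - q * (q - 1) * (\<psi> (1, 0) + \<psi> (-1, 0))
       + (q - 1)\<^sup>2 * \<psi> (0, 0))"
proof -
  have F: "q * bernstein_op q \<psi> w = left_simple q True (left_simple q False \<psi>) w + left_simple q False (left_simple q True \<psi>) w
     - (q - 1) * (left_simple q True \<psi> w + left_simple q False \<psi> w) + (q - 1)\<^sup>2 * \<psi> w" for w
    using assms by (simp add: bernstein_op_eq_left_simple)
  consider (pos) "j > 0 \<or> (j = 0 \<and> k > 1)" | (neg) "j < 0 \<or> (j = 0 \<and> k < -1)"
    | (one) "j = 0" "k = 1" | (minus) "j = 0" "k = -1" | (zero) "j = 0" "k = 0"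
    by linarith
  then show ?thesis
  proof cases
    case pos
    then have d: "descent True (k, j)" "\<not> descent False (k, j)" "\<not> descent True (- 1 - k, - j)"
      "descent False (1 - k, - j)" by (auto simp: descent_def)
    show ?thesis unfolding F using pos d
      by (simp add: left_simple_def flip_def) (simp add: algebra_simps power2_eq_square)
  next
    case neg
    then have d: "\<not> descent True (k, j)" "descent False (k, j)" "descent True (- 1 - k, - j)"
      "\<not> descent False (1 - k, - j)" "\<not> j > 0" "j = 0 \<Longrightarrow> \<not> k > 1" by (auto simp: descent_def)
    show ?thesis unfolding F using neg d
      by (simp add: left_simple_def flip_def) (auto simp add: algebra_simps power2_eq_square)
  qed (simp_all add: F left_simple_def flip_def descent_def algebra_simps power2_eq_square)
qed

section \<open>Inversion and right multiplication\<close>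

text \<open>
  Inversion of the Weyl group up to sign: translations are inverted and reflections are
  involutions.
\<close>
definition inv_index :: "index \<Rightarrow> index" where
  "inv_index = (\<lambda>(k, j). if even k then (- k, - j) else (k, j))"

definition mirror :: "(index \<Rightarrow> complex) \<Rightarrow> index \<Rightarrow> complex" where
  "mirror \<psi> w = \<psi> (inv_index w)"

lemma inv_inv_index [simp]: "inv_index (inv_index w) = w"
  by (cases w) (simp add: inv_index_def)

lemma mirror_mirror [simp]: "mirror (mirror \<psi>) = \<psi>"
  by (simp add: mirror_def fun_eq_iff)

text \<open>
  The Bernstein element acts from the right as it does from the left. This is the source of
  its centrality, also on the levels other than zero.
\<close>
lemma bernstein_op_mirror:
  assumes "q \<noteq> 0"
  shows "bernstein_op q (mirror \<psi>) = mirror (bernstein_op q \<psi>)"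
proof
  fix w
  have "q * bernstein_op q (mirror \<psi>) w = q * mirror (bernstein_op q \<psi>) w"
  proof (cases w)
    case (Pair k j)
    show ?thesis
    proof (cases "even k")
      case True
      then have "k \<noteq> 1" "k \<noteq> -1" by auto
      then show ?thesis using True unfolding Pair mirror_def inv_index_def
        by (simp add: bernstein_op_formula[OF assms])
    next
      case False
      then have "k \<noteq> 0" by auto
      then show ?thesis using False unfolding Pair mirror_def inv_index_def
        by (simp add: bernstein_op_formula[OF assms])
    qed
  qed
  then show "bernstein_op q (mirror \<psi>) w = mirror (bernstein_op q \<psi>) w" using assms by simp
qed


section \<open>Polynomials in the Bernstein element\<close>

text \<open>
  The coefficient functions of the polynomials in the Bernstein element, generated by
  multiplication with that element from the left.
\<close>
inductive_set bernstein_span :: "complex \<Rightarrow> (index \<Rightarrow> complex) set" for q where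
  unit: "unit_coeffs q \<in> bernstein_span q"
| step: "h \<in> bernstein_span q \<Longrightarrow> bernstein_op q h \<in> bernstein_span q"
| plus: "g \<in> bernstein_span q \<Longrightarrow> h \<in> bernstein_span q \<Longrightarrow> (\<lambda>w. g w + h w) \<in> bernstein_span q"
| scale: "h \<in> bernstein_span q \<Longrightarrow> (\<lambda>w. c * h w) \<in> bernstein_span q"

lemma bernstein_op_expand:
  "bernstein_op q \<psi> = (\<lambda>w. inverse q * (left_simple q True (left_simple q False \<psi>) w + left_simple q False (left_simple q True \<psi>) w
     + (1 - q) * (left_simple q True \<psi> w + left_simple q False \<psi> w) + (q - 1)\<^sup>2 * \<psi> w))"
  by (simp add: bernstein_op_eq_left_simple fun_eq_iff algebra_simps)

lemma finitary_bernstein_op: "finitary h \<Longrightarrow> finitary (bernstein_op q h)"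
  unfolding bernstein_op_expand by (intro finitary_scale finitary_add finitary_left_simple)

lemma left_action_bernstein_op:
  assumes h: "finitary h"
  shows "left_action q (bernstein_op q h) \<psi> = bernstein_op q (left_action q h \<psi>)"
  unfolding bernstein_op_expand
  by (simp add: left_action_scale left_action_add left_action_left_simple h finitary_left_simple finitary_add finitary_scale)

lemma finitary_mirror: "finitary h \<Longrightarrow> finitary (mirror h)"
proof -
  assume h: "finitary h"
  have "{k. mirror h (k, 0) \<noteq> 0} \<subseteq> (\<lambda>k. fst (inv_index (k, 0))) ` {k. h (k, 0) \<noteq> 0}"
  proof
    fix k assume k: "k \<in> {k. mirror h (k, 0) \<noteq> 0}"
    show "k \<in> (\<lambda>k. fst (inv_index (k, 0))) ` {k. h (k, 0) \<noteq> 0}"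
      by (rule image_eqI[of _ _ "fst (inv_index (k, 0))"])
        (use k in \<open>auto simp: mirror_def inv_index_def split: if_splits\<close>)
  qed
  then have "finite {k. mirror h (k, 0) \<noteq> 0}"
    using h by (auto simp: finitary_def intro: finite_subset)
  then show ?thesis using h by (auto simp: finitary_def mirror_def inv_index_def)
qed

lemma mirror_unit: "mirror (unit_coeffs q) = unit_coeffs q"
  by (auto simp: mirror_def unit_coeffs_def inv_index_def fun_eq_iff)

text \<open>
  Right multiplication, transported from the left by the anti-automorphism induced by
  inversion.
\<close>
definition right_action :: "complex \<Rightarrow> (index \<Rightarrow> complex) \<Rightarrow> (index \<Rightarrow> complex) \<Rightarrow> index \<Rightarrow> complex" where
  "right_action q h \<psi> = mirror (left_action q (mirror h) (mirror \<psi>))"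

lemma bernstein_span_finitary:
  "h \<in> bernstein_span q \<Longrightarrow> finitary h"
  by (induction rule: bernstein_span.induct)
    (simp_all add: finitary_unit finitary_bernstein_op finitary_add finitary_scale)

lemma mirror_add: "mirror (\<lambda>w. g w + h w) = (\<lambda>w. mirror g w + mirror h w)"
  by (simp add: mirror_def fun_eq_iff)

lemma mirror_scale: "mirror (\<lambda>w. c * h w) = (\<lambda>w. c * mirror h w)"
  by (simp add: mirror_def fun_eq_iff)

text \<open>
  Both actions turn multiplication of \<open>h\<close> by the Bernstein element into
  \<open>bernstein_op\<close>, which is the same operator on either side, so equality
  propagates from the unit.
\<close>
lemma bernstein_span_left_action_eq_right_action:
  assumes q: "q \<noteq> 0" and h: "h \<in> bernstein_span q"
  shows "left_action q h \<psi> = right_action q h \<psi>"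
  using h
proof (induction arbitrary: \<psi> rule: bernstein_span.induct)
  case unit
  show ?case by (simp add: right_action_def mirror_unit left_action_unit q)
next
  case (step h)
  have fin: "finitary h" using step bernstein_span_finitary by blast
  have "right_action q (bernstein_op q h) \<psi> = mirror (bernstein_op q (left_action q (mirror h) (mirror \<psi>)))"
    by (simp add: right_action_def bernstein_op_mirror[OF q, symmetric] left_action_bernstein_op finitary_mirror fin)
  also have "\<dots> = bernstein_op q (right_action q h \<psi>)"
    by (simp add: right_action_def bernstein_op_mirror[OF q, symmetric])
  finally show ?case using step by (simp add: left_action_bernstein_op fin)
next
  case (plus g h)
  have "finitary g" "finitary h" using plus bernstein_span_finitary by blast+
  then have "left_action q (\<lambda>w. g w + h w) \<psi> = (\<lambda>w. left_action q g \<psi> w + left_action q h \<psi> w)"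
    "right_action q (\<lambda>w. g w + h w) \<psi> = (\<lambda>w. right_action q g \<psi> w + right_action q h \<psi> w)"
    by (simp_all add: left_action_add right_action_def mirror_add finitary_mirror)
  then show ?case using plus by simp
next
  case (scale h c)
  have "finitary h" using scale bernstein_span_finitary by blast
  then have "left_action q (\<lambda>w. c * h w) \<psi> = (\<lambda>w. c * left_action q h \<psi> w)"
    "right_action q (\<lambda>w. c * h w) \<psi> = (\<lambda>w. c * right_action q h \<psi> w)"
    by (simp_all add: left_action_scale right_action_def mirror_scale finitary_mirror)
  then show ?case using scale by simp
qed

lemma bernstein_span_left_action:
  assumes q: "q \<noteq> 0" and h: "h \<in> bernstein_span q" and g: "g \<in> bernstein_span q"
  shows "left_action q h g \<in> bernstein_span q"
  using h
proof (induction rule: bernstein_span.induct)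
  case unit
  show ?case using g by (simp add: left_action_unit q)
next
  case (step h)
  then show ?case by (simp add: left_action_bernstein_op bernstein_span_finitary bernstein_span.step)
next
  case (plus h h')
  then have "left_action q (\<lambda>w. h w + h' w) g = (\<lambda>w. left_action q h g w + left_action q h' g w)"
    by (simp add: fun_eq_iff left_action_add bernstein_span_finitary)
  then show ?case using plus bernstein_span.plus by simp
next
  case (scale h c)
  then have "left_action q (\<lambda>w. c * h w) g = (\<lambda>w. c * left_action q h g w)"
    by (simp add: fun_eq_iff left_action_scale bernstein_span_finitary)
  then show ?case using scale bernstein_span.scale by simp
qed

lemma bernstein_op_unit: "q \<noteq> 0 \<Longrightarrow> bernstein_op q (unit_coeffs q) = bernstein_coeffs q"
proof
  fix w :: index assume q: "q \<noteq> 0"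
  obtain k j where w: "w = (k, j)" by force
  have "q * bernstein_op q (unit_coeffs q) w = q * bernstein_coeffs q w"
    unfolding w by (auto simp: bernstein_op_formula[OF q] unit_coeffs_def bernstein_coeffs_def algebra_simps)
  then show "bernstein_op q (unit_coeffs q) w = bernstein_coeffs q w" using q by simp
qed

section \<open>Elements that commute with the generators\<close>

text \<open>
  Right multiplication by \<open>T\<^sub>s\<close>.
\<close>
definition right_simple :: "complex \<Rightarrow> bool \<Rightarrow> (index \<Rightarrow> complex) \<Rightarrow> index \<Rightarrow> complex" where
  "right_simple q b \<psi> = mirror (left_simple q b (mirror \<psi>))"

text \<open>
  From the right the reflection \<open>(-1, 0)\<close> preserves the level and exchanges the
  elements \<open>(k, n)\<close> and \<open>(k - 1, n)\<close> with \<open>k\<close> even.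
  On each such pair \<open>T\<^sub>s\<close> is invertible by its quadratic relation.
\<close>
lemma right_simple_level_positive:
  assumes q: "q \<noteq> 0" and n: "n > 0"
    and z: "\<And>k. right_simple q False \<psi> (k, n) = 0"
  shows "\<psi> (k, n) = 0"
proof -
  have even0: "\<psi> (k, n) = 0" if "even k" for k
  proof -
    have "right_simple q False \<psi> (k - 1, n) = q * \<psi> (k, n)"
      using that n by (simp add: right_simple_def mirror_def inv_index_def left_simple_def descent_def flip_def)
    then show ?thesis using z q by simp
  qed
  show ?thesis
  proof (cases "even k")
    case False
    then have "right_simple q False \<psi> (k + 1, n) = \<psi> (k, n) + (q - 1) * \<psi> (k + 1, n)"
      using n by (simp add: right_simple_def mirror_def inv_index_def left_simple_def descent_def flip_def add.commute[of 1 k])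
    then show ?thesis using z even0[of "k + 1"] False by simp
  qed (rule even0)
qed

lemma right_simple_level_negative:
  assumes q: "q \<noteq> 0" and n: "n < 0"
    and z: "\<And>k. right_simple q True \<psi> (k, n) = 0"
  shows "\<psi> (k, n) = 0"
proof -
  have even0: "\<psi> (k, n) = 0" if "even k" for k
  proof -
    have "right_simple q True \<psi> (k + 1, n) = q * \<psi> (k, n)"
      using that n by (simp add: right_simple_def mirror_def inv_index_def left_simple_def descent_def flip_def)
    then show ?thesis using z q by simp
  qed
  show ?thesis
  proof (cases "even k")
    case False
    then have "right_simple q True \<psi> (k - 1, n) = \<psi> (k, n) + (q - 1) * \<psi> (k - 1, n)"
      using n by (simp add: right_simple_def mirror_def inv_index_def left_simple_def descent_def flip_def add.commute[of 1 k])
    then show ?thesis using z even0[of "k - 1"] False by simp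
  qed (rule even0)
qed

text \<open>
  An element of odd length starts and ends with the same reflection. Multiplying it by the
  other reflection from the left gives an element of greater length that right
  multiplication of the support by that reflection cannot reach.
\<close>
lemma central_leading_odd:
  assumes z: "\<And>b k. left_simple q b \<psi> (k, 0) = right_simple q b \<psi> (k, 0)" and q: "q \<noteq> 0"
    and n: "n > 0" "odd n" and supp: "\<And>k. \<bar>k\<bar> > n \<Longrightarrow> \<psi> (k, 0) = 0"
  shows "\<psi> (n, 0) = 0" "\<psi> (- n, 0) = 0"
proof -
  have "\<psi> (- 1 - n, 0) = 0" "\<psi> (- n - 2, 0) = 0" "\<psi> (n + 1, 0) = 0" "\<psi> (n + 2, 0) = 0"
    using n by (auto intro!: supp)
  moreover have "even (n + 1)" "even (- 1 - n)" using n by auto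
  ultimately show "\<psi> (n, 0) = 0" "\<psi> (- n, 0) = 0"
    using z[of False "- 1 - n"] z[of True "n + 1"] n
    by (simp_all add: right_simple_def mirror_def inv_index_def left_simple_def descent_def flip_def algebra_simps)
qed

text \<open>
  The two elements of even length \<open>n\<close> are inverse to each other; multiplication
  by \<open>(1, 0)\<close> from the left sends one of them to \<open>(n + 1, 0)\<close>, and
  from the right it sends the other one there.
\<close>
lemma central_leading_even:
  assumes z: "\<And>b k. left_simple q b \<psi> (k, 0) = right_simple q b \<psi> (k, 0)"
    and n: "n > 0" "even n" and supp: "\<And>k. \<bar>k\<bar> > n \<Longrightarrow> \<psi> (k, 0) = 0"
  shows "\<psi> (- n, 0) = \<psi> (n, 0)"
proof -
  have "\<psi> (n + 1, 0) = 0" using n by (auto intro!: supp)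
  then show ?thesis
    using z[of True "n + 1"] n
    by (simp_all add: right_simple_def mirror_def inv_index_def left_simple_def descent_def flip_def algebra_simps)
qed

fun bernstein_power :: "complex \<Rightarrow> nat \<Rightarrow> index \<Rightarrow> complex" where
  "bernstein_power q 0 = unit_coeffs q"
| "bernstein_power q (Suc m) = bernstein_op q (bernstein_power q m)"

lemma bernstein_power_span: "bernstein_power q m \<in> bernstein_span q"
  by (induction m) (auto intro: bernstein_span.intros)

lemma bernstein_power_support:
  assumes q: "q \<noteq> 0" and k: "\<bar>k\<bar> > 2 * int m"
  shows "bernstein_power q m (k, 0) = 0"
  using k
proof (induction m arbitrary: k)
  case (Suc m)
  have "q * bernstein_power q (Suc m) (k, 0) = 0"
    using Suc.prems by (simp add: bernstein_op_formula[OF q]) (auto simp: Suc.IH)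
  then show ?case using q by simp
qed (auto simp: unit_coeffs_def)

lemma bernstein_power_leading:
  assumes q: "q \<noteq> 0"
  shows "bernstein_power q m (2 * int m, 0) \<noteq> 0"
proof (induction m)
  case (Suc m)
  have "q * bernstein_power q (Suc m) (2 * int (Suc m), 0) = bernstein_power q m (2 * int m, 0)"
    by (simp add: bernstein_op_formula[OF q] bernstein_power_support[OF q])
  then show ?case using Suc by (metis mult_zero_right)
qed (simp add: unit_coeffs_def q)

lemma left_simple_linear: "left_simple q b (\<lambda>w. \<phi> w + c * \<psi> w) w = left_simple q b \<phi> w + c * left_simple q b \<psi> w"
  by (simp add: left_simple_add left_simple_scale)

lemma right_simple_linear: "right_simple q b (\<lambda>w. \<phi> w + c * \<psi> w) w = right_simple q b \<phi> w + c * right_simple q b \<psi> w"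
  by (simp add: right_simple_def mirror_def left_simple_def algebra_simps)

text \<open>
  The Bernstein element is a symmetric expression in the two generators, and the quadratic
  relations make it commute with both.
\<close>
lemma left_simple_bernstein_op: "left_simple q b (bernstein_op q \<psi>) = bernstein_op q (left_simple q b \<psi>)"
  unfolding bernstein_op_expand
  by (cases b; simp add: fun_eq_iff left_simple_scale left_simple_add left_simple_left_simple left_simple_left_simple[abs_def]; auto simp: algebra_simps)

lemma right_simple_bernstein_op:
  assumes "q \<noteq> 0"
  shows "right_simple q b (bernstein_op q \<psi>) = bernstein_op q (right_simple q b \<psi>)"
  by (simp add: right_simple_def bernstein_op_mirror[OF assms, symmetric] left_simple_bernstein_op)

lemma bernstein_span_left_simple_eq_right_simple:
  assumes q: "q \<noteq> 0" and h: "h \<in> bernstein_span q"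
  shows "left_simple q b h = right_simple q b h"
  using h
proof (induction rule: bernstein_span.induct)
  case unit
  show ?case
  proof
    fix w :: index
    have "left_simple q b (unit_coeffs q) (k, j) = (if j = 0 \<and> k = (if b then 1 else - 1) then q else 0)" for k j
      by (auto simp: left_simple_def unit_coeffs_def descent_def flip_def)
    then show "left_simple q b (unit_coeffs q) w = right_simple q b (unit_coeffs q) w"
      unfolding right_simple_def mirror_unit
      by (cases w) (auto simp: mirror_def inv_index_def)
  qed
next
  case (step h)
  then show ?case by (simp add: left_simple_bernstein_op right_simple_bernstein_op[OF q])
next
  case (plus g h)
  then show ?case by (simp add: fun_eq_iff left_simple_linear[where c = 1, simplified] right_simple_linear[where c = 1, simplified])
next
  case (scale h c)
  then show ?case
    using left_simple_linear[of q b "\<lambda>w. 0" c h] right_simple_linear[of q b "\<lambda>w. 0" c h]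
    by (simp add: fun_eq_iff left_simple_scale) (simp add: right_simple_def left_simple_def mirror_def)
qed

text \<open>
  Induction on a bound for the lengths in the support, removing the top coefficients with a
  power of the Bernstein element.
\<close>
lemma central_in_bernstein_span:
  assumes q: "q \<noteq> 0" and fin: "finitary \<psi>"
    and z: "\<And>b k. left_simple q b \<psi> (k, 0) = right_simple q b \<psi> (k, 0)"
  shows "\<psi> \<in> bernstein_span q"
proof -
  have "\<psi> \<in> bernstein_span q"
    if "finitary \<psi>" "\<And>b k. left_simple q b \<psi> (k, 0) = right_simple q b \<psi> (k, 0)"
      "\<And>k. \<bar>k\<bar> > int n \<Longrightarrow> \<psi> (k, 0) = 0" for n \<psi>
    using that
  proof (induction n arbitrary: \<psi>)
    case 0
    define c where "c = \<psi> (0, 0) * inverse q"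
    have "\<psi> (k, j) = c * unit_coeffs q (k, j)" for k j
      using 0(1) 0(3)[of k] q by (cases "j = 0"; cases "k = 0") (simp_all add: c_def finitary_def unit_coeffs_def)
    then have "\<psi> = (\<lambda>w. c * unit_coeffs q w)" by auto
    then show ?case using bernstein_span.scale[OF bernstein_span.unit, of c q] by simp
  next
    case (Suc n)
    let ?n = "int (Suc n)"
    show ?case
    proof (cases "even ?n")
      case False
      have top: "\<psi> (?n, 0) = 0" "\<psi> (- ?n, 0) = 0"
        by (rule central_leading_odd[OF Suc.prems(2) q _ False]; use Suc.prems in simp)+
      have "\<psi> (k, 0) = 0" if "\<bar>k\<bar> > int n" for k
      proof -
        have "k = ?n \<or> k = - ?n \<or> \<bar>k\<bar> > ?n" using that by linarith
        then show ?thesis using Suc.prems(3) top by blast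
      qed
      then show ?thesis using Suc by blast
    next
      case True
      then have "even (Suc n)" by (simp only: even_of_nat_iff)
      then obtain m where m: "Suc n = 2 * m" by (rule evenE)
      define c where "c = - \<psi> (?n, 0) * inverse (bernstein_power q m (?n, 0))"
      define \<phi> where "\<phi> = (\<lambda>w. \<psi> w + c * bernstein_power q m w)"
      have nm: "?n = 2 * int m" using m by simp
      have fs: "bernstein_power q m (k, 0) = 0" if "\<bar>k\<bar> > ?n" for k
        using bernstein_power_support[OF q] that nm by simp
      have com: "left_simple q b \<phi> (k, 0) = right_simple q b \<phi> (k, 0)" for b k
        unfolding \<phi>_def left_simple_linear right_simple_linear using Suc.prems(2) bernstein_span_left_simple_eq_right_simple[OF q bernstein_power_span] by simp
      have top: "\<phi> (?n, 0) = 0"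
        using bernstein_power_leading[OF q, of m] nm by (simp add: \<phi>_def c_def)
      have supp: "\<phi> (k, 0) = 0" if "\<bar>k\<bar> > ?n" for k
        using fs[OF that] Suc.prems(3)[OF that] by (simp add: \<phi>_def)
      have bot: "\<phi> (- ?n, 0) = 0"
        using central_leading_even[OF com _ True supp] top by simp
      have "\<phi> (k, 0) = 0" if "\<bar>k\<bar> > int n" for k
      proof -
        have "k = ?n \<or> k = - ?n \<or> \<bar>k\<bar> > ?n" using that by linarith
        then show ?thesis using supp top bot by blast
      qed
      moreover have "finitary \<phi>" unfolding \<phi>_def
        using Suc.prems bernstein_power_span bernstein_span_finitary by (intro finitary_add finitary_scale) blast+
      ultimately have "\<phi> \<in> bernstein_span q" using Suc.IH com by blast
      then have "(\<lambda>w. \<phi> w + (- c) * bernstein_power q m w) \<in> bernstein_span q"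
        by (intro bernstein_span.plus bernstein_span.scale bernstein_power_span)
      then show ?thesis by (simp add: \<phi>_def)
    qed
  qed
  moreover have "\<exists>n. \<forall>k. \<bar>k\<bar> > int n \<longrightarrow> \<psi> (k, 0) = 0"
  proof -
    have f: "finite {k. \<psi> (k, 0) \<noteq> 0}" using fin by (simp add: finitary_def)
    then obtain M where M: "\<forall>k\<in>(\<lambda>k. nat \<bar>k\<bar>) ` {k. \<psi> (k, 0) \<noteq> 0}. k \<le> M"
      using finite_nat_set_iff_bounded_le by blast
    have "\<psi> (k, 0) = 0" if "\<bar>k\<bar> > int M" for k
      using M that by force
    then show ?thesis by blast
  qed
  ultimately show ?thesis using fin z by blast
qed

section \<open>Finiteness of the structure constants\<close>

text \<open>
  A composition of generators evaluated at \<open>w\<close> involves only finitely many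
  values of its argument. Hence it makes sense on all functions, and its matrix has finite
  rows. These rows are the structure constants, and their finiteness makes the product of an
  element of level zero with an infinite sum well defined.
\<close>
lemma left_word_local:
  obtains B where "finite B" "\<And>\<psi>. left_word q ws \<psi> w = (\<Sum>b\<in>B. \<psi> b * left_word q ws (\<lambda>w'. of_bool (w' = b)) w)"
    "\<And>b. b \<notin> B \<Longrightarrow> left_word q ws (\<lambda>w'. of_bool (w' = b)) w = 0"
proof -
  have "\<exists>B. finite B \<and> (\<forall>\<psi>. left_word q ws \<psi> w = (\<Sum>b\<in>B. \<psi> b * left_word q ws (\<lambda>w'. of_bool (w' = b)) w))
    \<and> (\<forall>b. b \<notin> B \<longrightarrow> left_word q ws (\<lambda>w'. of_bool (w' = b)) w = 0)"
  proof (induction ws arbitrary: w)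
    case Nil
    show ?case by (rule exI[of _ "{w}"]) auto
  next
    case (Cons c ws)
    let ?d = "\<lambda>b w'. of_bool (w' = b) :: complex"
    obtain B1 where B1: "finite B1" "\<And>\<psi>. left_word q ws \<psi> w = (\<Sum>b\<in>B1. \<psi> b * left_word q ws (?d b) w)"
      "\<And>b. b \<notin> B1 \<Longrightarrow> left_word q ws (?d b) w = 0" using Cons.IH[of w] by blast
    obtain B2 where B2: "finite B2" "\<And>\<psi>. left_word q ws \<psi> (flip c w) = (\<Sum>b\<in>B2. \<psi> b * left_word q ws (?d b) (flip c w))"
      "\<And>b. b \<notin> B2 \<Longrightarrow> left_word q ws (?d b) (flip c w) = 0" using Cons.IH[of "flip c w"] by blast
    let ?B = "B1 \<union> B2"
    have fin: "finite ?B" using B1(1) B2(1) by simp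
    have 1: "left_word q ws \<psi> w = (\<Sum>b\<in>?B. \<psi> b * left_word q ws (?d b) w)" for \<psi>
      by (rule trans[OF B1(2) sum.mono_neutral_left[OF fin]]) (use B1(3) in auto)
    have 2: "left_word q ws \<psi> (flip c w) = (\<Sum>b\<in>?B. \<psi> b * left_word q ws (?d b) (flip c w))" for \<psi>
      by (rule trans[OF B2(2) sum.mono_neutral_left[OF fin]]) (use B2(3) in auto)
    have "left_word q (c # ws) \<psi> w = (\<Sum>b\<in>?B. \<psi> b * left_word q (c # ws) (?d b) w)" for \<psi>
      unfolding left_word.simps left_simple_def 1[of \<psi>] 2[of \<psi>]
      by (simp add: sum_distrib_left sum.distrib sum_subtractf algebra_simps)
    moreover have "left_word q (c # ws) (?d b) w = 0" if "b \<notin> ?B" for b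
      using that B1(3) B2(3) by (simp add: left_simple_def)
    ultimately show ?case using fin by blast
  qed
  then show ?thesis using that by blast
qed

lemma left_elem_local:
  shows "finite {b. left_elem q n (\<lambda>w'. of_bool (w' = b)) w \<noteq> 0}"
    and "left_elem q n \<psi> w = (\<Sum>b\<in>{b. left_elem q n (\<lambda>w'. of_bool (w' = b)) w \<noteq> 0}.
      \<psi> b * left_elem q n (\<lambda>w'. of_bool (w' = b)) w)" (is "_ = sum ?f ?S")
proof -
  obtain B where B: "finite B"
    "\<And>\<psi>. left_word q (reduced_word n) \<psi> w = (\<Sum>b\<in>B. \<psi> b * left_word q (reduced_word n) (\<lambda>w'. of_bool (w' = b)) w)"
    "\<And>b. b \<notin> B \<Longrightarrow> left_word q (reduced_word n) (\<lambda>w'. of_bool (w' = b)) w = 0"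
    by (rule left_word_local[of q "reduced_word n" w]) (rule that)
  note B = B[folded left_elem_def]
  have sub: "?S \<subseteq> B" using B(3) by blast
  then show fin: "finite ?S" using B(1) finite_subset by blast
  have "sum ?f ?S = sum ?f B"
    by (rule sum.mono_neutral_left[OF B(1) sub]) auto
  then show "left_elem q n \<psi> w = sum ?f ?S" using B(2)[of \<psi>] by (rule trans[OF _ sym, rotated])
qed

text \<open>
  The truncation in the product: at a point of level \<open>n\<close>, multiplication with
  an element of level zero sees only the part of the other factor at level \<open>n\<close>.
\<close>
definition level_part :: "int \<Rightarrow> (index \<Rightarrow> complex) \<Rightarrow> index \<Rightarrow> complex" where
  "level_part n \<psi> w = (if snd w = n then \<psi> w else 0)"

section \<open>The group of matrices of determinant one\<close>

definition mat2 :: "'a \<Rightarrow> 'a \<Rightarrow> 'a \<Rightarrow> 'a \<Rightarrow> 'a::zero^2^2" where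
  "mat2 a b c d = vector [vector [a, b], vector [c, d]]"

lemma mat2_nth [simp]:
  "mat2 a b c d $ 1 $ 1 = a" "mat2 a b c d $ 1 $ 2 = b"
  "mat2 a b c d $ 2 $ 1 = c" "mat2 a b c d $ 2 $ 2 = d"
  by (simp_all add: mat2_def)

lemma mat2_eq_iff [simp]: "mat2 a b c d = mat2 a' b' c' d' \<longleftrightarrow> a = a' \<and> b = b' \<and> c = c' \<and> d = d'"
  by (auto simp: vec_eq_iff forall_2)

lemma mat2_cases: obtains a b c d where "A = mat2 a b c d"
proof
  show "A = mat2 (A $ 1 $ 1) (A $ 1 $ 2) (A $ 2 $ 1) (A $ 2 $ 2)"
    by (simp add: vec_eq_iff forall_2)
qed

lemma mat2_mult [simp]:
  fixes a b c d :: "'a::comm_ring_1"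
  shows "mat2 a b c d ** mat2 a' b' c' d' =
    mat2 (a * a' + b * c') (a * b' + b * d') (c * a' + d * c') (c * b' + d * d')"
  by (simp add: vec_eq_iff forall_2 matrix_matrix_mult_def sum_2)

lemma det_mat2 [simp]: "det (mat2 a b c d :: 'a::comm_ring_1^2^2) = a * d - b * c"
  by (simp add: det_2)

lemma mat_1_mat2: "mat 1 = (mat2 1 0 0 1 :: 'a::comm_ring_1^2^2)"
  by (simp add: vec_eq_iff forall_2 mat_def)

lemma matrix_inv_unique_right:
  fixes A B :: "'a::field^'n^'n"
  assumes "A ** B = mat 1"
  shows "matrix_inv A = B"
proof -
  have "B ** A = mat 1" using assms by (simp add: matrix_left_right_inverse)
  then have "matrix_inv A ** A = mat 1"
    unfolding matrix_inv_def using someI[of "\<lambda>C. A ** C = mat 1 \<and> C ** A = mat 1" B] assms by simp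
  then have "matrix_inv A ** (A ** B) = B" by (simp add: matrix_mul_assoc)
  then show ?thesis using assms by simp
qed

lemma matrix_inv_mat2:
  fixes a :: "'a::field"
  assumes "a * d - b * c = 1"
  shows "matrix_inv (mat2 a b c d) = mat2 d (- b) (- c) a"
  by (rule matrix_inv_unique_right) (use assms in \<open>simp add: mat_1_mat2 algebra_simps\<close>)

definition SL2 :: "('a::field^2^2) monoid" where
  "SL2 = \<lparr>carrier = {A. det A = 1}, mult = (**), one = mat 1\<rparr>"

lemma SL2_simps [simp]:
  "A \<in> carrier SL2 \<longleftrightarrow> det A = 1" "A \<otimes>\<^bsub>SL2\<^esub> B = A ** B" "\<one>\<^bsub>SL2\<^esub> = mat 1"
  by (simp_all add: SL2_def)

lemma SL2_inverse:
  fixes A :: "'a::field^2^2"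
  assumes "det A = 1"
  shows "det (matrix_inv A) = 1" "matrix_inv A ** A = mat 1" "A ** matrix_inv A = mat 1"
proof -
  obtain a b c d where "A = mat2 a b c d" by (rule mat2_cases)
  then show "det (matrix_inv A) = 1" "matrix_inv A ** A = mat 1" "A ** matrix_inv A = mat 1"
    using assms by (simp_all add: matrix_inv_mat2 mat_1_mat2 algebra_simps)
qed

lemma group_SL2: "group (SL2 :: ('a::field^2^2) monoid)"
proof (rule groupI)
  fix A :: "'a^2^2" assume "A \<in> carrier SL2"
  then show "\<exists>B\<in>carrier SL2. B \<otimes>\<^bsub>SL2\<^esub> A = \<one>\<^bsub>SL2\<^esub>"
    using SL2_inverse[of A] by (intro bexI[of _ "matrix_inv A"]) simp_all
qed (simp_all add: det_mul matrix_mul_assoc)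

interpretation SL2: group SL2
  by (rule group_SL2)

lemma inv_SL2: "det A = 1 \<Longrightarrow> inv\<^bsub>SL2\<^esub> A = matrix_inv A"
  by (rule SL2.inv_equality) (simp_all add: SL2_inverse)

lemma inv_SL2_mat2: "a * d - b * c = 1 \<Longrightarrow> inv\<^bsub>SL2\<^esub> (mat2 a b c d) = mat2 d (- b) (- c) a"
  by (simp add: inv_SL2 matrix_inv_mat2)

section \<open>Valuations and the Iwahori subgroup\<close>

lemma lex_le_iff: "lex_le (i, j) (k, l) \<longleftrightarrow> j < l \<or> (j = l \<and> i \<le> k)"
  by (auto simp: lex_le_def lex_less_def)

lemma lex_le_trans: "lex_le p r \<Longrightarrow> lex_le r s \<Longrightarrow> lex_le p s"
  by (cases p; cases r; cases s) (auto simp: lex_le_iff)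

text \<open>
  The product is defined by the sum of all nonzero terms over pairs of indices; this brings
  it into the iterated form of a composition of operators.
\<close>
lemma sum_nonzero_pairs:
  fixes h :: "'a \<Rightarrow> complex" and g :: "'b \<Rightarrow> complex"
  assumes h: "finite {u. h u \<noteq> 0}" and c: "\<And>u. finite {b. c u b \<noteq> 0}"
  shows "(\<Sum>(u, b)\<in>{(u, b). h u * g b * c u b \<noteq> 0}. h u * g b * c u b)
    = (\<Sum>u\<in>{u. h u \<noteq> 0}. h u * (\<Sum>b\<in>{b. c u b \<noteq> 0}. g b * c u b))"
proof -
  let ?S = "SIGMA u:{u. h u \<noteq> 0}. {b. c u b \<noteq> 0}"
  have "finite ?S" using h c by blast
  then have "(\<Sum>(u, b)\<in>{(u, b). h u * g b * c u b \<noteq> 0}. h u * g b * c u b)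
      = (\<Sum>(u, b)\<in>?S. h u * g b * c u b)"
    by (rule sum.mono_neutral_left) auto
  also have "\<dots> = (\<Sum>u\<in>{u. h u \<noteq> 0}. \<Sum>b\<in>{b. c u b \<noteq> 0}. h u * g b * c u b)"
    using h c by (simp add: sum.Sigma)
  finally show ?thesis by (simp add: sum_distrib_left mult.assoc)
qed

lemma sum_nonzero_bij:
  fixes F :: "'b \<Rightarrow> complex"
  assumes m: "bij m"
  shows "(\<Sum>p\<in>{p. F (m p) \<noteq> 0}. F (m p)) = (\<Sum>r\<in>{r. F r \<noteq> 0}. F r)"
proof (rule sum.reindex_bij_betw, rule bij_betw_imageI)
  show "inj_on m {p. F (m p) \<noteq> 0}" using m by (auto simp: bij_def intro: inj_on_subset)
  have "r \<in> m ` {p. F (m p) \<noteq> 0}" if "F r \<noteq> 0" for r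
  proof -
    obtain p where "r = m p" using m by (metis bij_pointE)
    then show ?thesis using that by blast
  qed
  then show "m ` {p. F (m p) \<noteq> 0} = {r. F r \<noteq> 0}" by blast
qed

context sl2_hecke
begin

lemma v_mult: "x \<noteq> 0 \<Longrightarrow> y \<noteq> 0 \<Longrightarrow> v (x * y) = (fst (v x) + fst (v y), snd (v x) + snd (v y))"
  using valuation by (simp add: rank_two_valuation_def)

lemma v_one: "v 1 = (0, 0)"
  using v_mult[of 1 1] by (cases "v 1") simp

lemma v_uminus: "x \<noteq> 0 \<Longrightarrow> v (- x) = v x"
proof -
  have "v (- 1) = (0, 0)" using v_mult[of "- 1" "- 1"] v_one by (cases "v (- 1)") simp
  then show "x \<noteq> 0 \<Longrightarrow> v (- x) = v x" using v_mult[of "- 1" x] by (cases "v x") simp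
qed

lemma v_inverse: "x \<noteq> 0 \<Longrightarrow> v (inverse x) = (- fst (v x), - snd (v x))"
  using v_mult[of x "inverse x"] v_one by (cases "v (inverse x)") simp

definition val_ge :: "int \<times> int \<Rightarrow> 'f \<Rightarrow> bool" where
  "val_ge p x \<longleftrightarrow> x = 0 \<or> lex_le p (v x)"

lemma val_ge_0 [simp]: "val_ge p 0"
  by (simp add: val_ge_def)

lemma val_ge_1: "val_ge p 1 \<longleftrightarrow> lex_le p (0, 0)"
  by (simp add: val_ge_def v_one)

lemma val_ge_uminus [simp]: "val_ge p (- x) \<longleftrightarrow> val_ge p x"
  by (cases "x = 0") (simp_all add: val_ge_def v_uminus)

lemma val_ge_add: "val_ge p x \<Longrightarrow> val_ge p y \<Longrightarrow> val_ge p (x + y)"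
  using valuation lex_le_trans unfolding rank_two_valuation_def val_ge_def
  by (metis add.left_neutral add.right_neutral)

lemma val_ge_diff: "val_ge p x \<Longrightarrow> val_ge p y \<Longrightarrow> val_ge p (x - y)"
  using val_ge_add[of p x "- y"] by simp

lemma val_ge_minus_commute: "val_ge p (x - y) \<longleftrightarrow> val_ge p (y - x)"
  using val_ge_uminus[of p "x - y"] by simp

lemma val_ge_mult: "val_ge (i, j) x \<Longrightarrow> val_ge (k, l) y \<Longrightarrow> val_ge (i + k, j + l) (x * y)"
  by (cases "x = 0"; cases "y = 0"; cases "v x"; cases "v y")
    (auto simp: val_ge_def v_mult lex_le_iff)

lemma val_ge_mono: "val_ge p x \<Longrightarrow> lex_le r p \<Longrightarrow> val_ge r x"
  unfolding val_ge_def using lex_le_trans by blast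

lemma integers_iff: "x \<in> rank_two_integers v \<longleftrightarrow> val_ge (0, 0) x"
  by (simp add: rank_two_integers_def val_ge_def)

lemma prime_ideal_iff: "x \<in> (\<lambda>y. t1 * y) ` rank_two_integers v \<longleftrightarrow> val_ge (1, 0) x"
proof
  assume "val_ge (1, 0) x"
  then have "val_ge (-1 + 1, 0 + 0) (inverse t1 * x)"
    using t1 by (intro val_ge_mult) (simp_all add: val_ge_def v_inverse lex_le_def)
  then have "inverse t1 * x \<in> rank_two_integers v" by (simp add: integers_iff)
  moreover have "x = t1 * (inverse t1 * x)" using t1 by simp
  ultimately show "x \<in> (\<lambda>y. t1 * y) ` rank_two_integers v" by blast
next
  assume "x \<in> (\<lambda>y. t1 * y) ` rank_two_integers v"
  then obtain y where "x = t1 * y" "val_ge (0, 0) y" using integers_iff by blast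
  then show "val_ge (1, 0) x"
    using val_ge_mult[of 1 0 t1 0 0 y] t1 by (simp add: val_ge_def lex_le_def)
qed

lemma val_ge_mult_0: "val_ge (0, 0) x \<Longrightarrow> val_ge p y \<Longrightarrow> val_ge p (x * y)"
  "val_ge p x \<Longrightarrow> val_ge (0, 0) y \<Longrightarrow> val_ge p (x * y)"
  using val_ge_mult[of 0 0 x "fst p" "snd p" y] val_ge_mult[of "fst p" "snd p" x 0 0 y] by simp_all

lemma val_ge_weaken: "val_ge (1, 0) x \<Longrightarrow> val_ge (0, 0) x"
  by (erule val_ge_mono) (simp add: lex_le_iff)

definition monomial :: "int \<Rightarrow> int \<Rightarrow> 'f" where
  "monomial i j = t1 powi i * t2 powi j"

lemma v_power: "x \<noteq> 0 \<Longrightarrow> v (x ^ n) = (int n * fst (v x), int n * snd (v x))"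
  by (induction n) (simp_all add: v_one v_mult algebra_simps)

lemma v_powi: "x \<noteq> 0 \<Longrightarrow> v (x powi i) = (i * fst (v x), i * snd (v x))"
  by (auto simp: power_int_def v_power v_inverse)

lemma monomial_nonzero [simp]: "monomial i j \<noteq> 0"
  using t1 t2 by (simp add: monomial_def)

lemma v_monomial: "v (monomial i j) = (i, j)"
  using t1 t2 by (simp add: monomial_def v_mult v_powi)

lemma monomial_mult: "monomial i j * monomial k l = monomial (i + k) (j + l)"
  using t1 t2 by (simp add: monomial_def power_int_add)

lemma monomial_0 [simp]: "monomial 0 0 = 1"
  by (simp add: monomial_def)

lemma monomial_mult_left: "monomial i j * (monomial k l * x) = monomial (i + k) (j + l) * x"
  by (simp add: monomial_mult mult.assoc[symmetric])

lemma val_ge_monomial_mult: "val_ge p (monomial i j * x) \<longleftrightarrow> val_ge (fst p - i, snd p - j) x"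
proof
  assume "val_ge p (monomial i j * x)"
  then have "val_ge (- i + fst p, - j + snd p) (monomial (- i) (- j) * (monomial i j * x))"
    by (intro val_ge_mult) (simp_all add: val_ge_def v_monomial lex_le_def)
  then show "val_ge (fst p - i, snd p - j) x" by (simp add: monomial_mult_left)
next
  assume "val_ge (fst p - i, snd p - j) x"
  then have "val_ge (i + (fst p - i), j + (snd p - j)) (monomial i j * x)"
    by (intro val_ge_mult) (simp_all add: val_ge_def v_monomial lex_le_def)
  then show "val_ge p (monomial i j * x)" by simp
qed

lemma monomial_1_0: "monomial 1 0 = t1"
  by (simp add: monomial_def)

lemma t1_mult_monomial: "t1 * monomial i j = monomial (i + 1) j" "monomial i j * t1 = monomial (i + 1) j"
    "t1 * (monomial i j * x) = monomial (i + 1) j * x" "monomial i j * (t1 * x) = monomial (i + 1) j * x"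
  using monomial_mult[of 1 0 i j] monomial_mult_left[of 1 0 i j x] monomial_mult_left[of i j 1 0 x]
  by (simp_all add: monomial_1_0 add.commute mult.commute)

lemma val_ge_t1_mult: "val_ge p (t1 * x) \<longleftrightarrow> val_ge (fst p - 1, snd p) x"
  using val_ge_monomial_mult[of p 1 0 x] by (simp add: monomial_1_0)

lemma iwahori_mat2:
  "mat2 a b c d \<in> iwahori \<longleftrightarrow>
     a * d - b * c = 1 \<and> val_ge (0, 0) a \<and> val_ge (0, 0) b \<and> val_ge (1, 0) c \<and> val_ge (0, 0) d"
  unfolding iwahori_def integers_iff prime_ideal_iff by (auto simp: forall_2 val_ge_weaken)

text \<open>
  If \<open>x\<close> and \<open>y\<close> are integral and \<open>x y\<close> is congruent
  to 1 modulo the prime ideal, then \<open>x\<close> is a unit; this is what makes the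
  diagonal entries of Iwahori matrices units.
\<close>
lemma unit_factor:
  assumes "val_ge (0, 0) x" "val_ge (0, 0) y" "x * y - z = 1" "val_ge (1, 0) z"
  shows "x \<noteq> 0" "v x = (0, 0)"
proof -
  have nz: "x * y \<noteq> 0"
  proof
    assume "x * y = 0"
    then have "z = - 1" using assms(3) by (metis diff_0 minus_minus)
    then have "val_ge (1, 0) 1" using assms by simp
    then show False by (simp add: val_ge_1 lex_le_iff)
  qed
  then show "x \<noteq> 0" by simp
  \<comment> \<open>A positive valuation of \<open>x\<close> would make \<open>1 = x y - z\<close> a non-unit.\<close>
  have "\<not> val_ge (1, 0) x"
  proof
    assume "val_ge (1, 0) x"
    then have "val_ge (1, 0) (x * y - z)" using assms by (intro val_ge_diff val_ge_mult_0)
    then show False using assms by (simp add: val_ge_1 lex_le_iff)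
  qed
  then show "v x = (0, 0)" using assms \<open>x \<noteq> 0\<close>
    by (cases "v x") (auto simp: val_ge_def lex_le_iff)
qed

lemma iwahori_diagonal:
  assumes "mat2 a b c d \<in> iwahori"
  shows "a \<noteq> 0" "v a = (0, 0)" "d \<noteq> 0" "v d = (0, 0)"
proof -
  have "val_ge (1, 0) (b * c)" using assms by (simp add: iwahori_mat2 val_ge_mult_0)
  then show "a \<noteq> 0" "v a = (0, 0)" "d \<noteq> 0" "v d = (0, 0)"
    using assms unit_factor[of a d "b * c"] unit_factor[of d a "b * c"]
    by (auto simp: iwahori_mat2 mult.commute)
qed

lemma subgroup_iwahori: "subgroup iwahori SL2"
proof (rule SL2.subgroupI)
  show "iwahori \<subseteq> carrier SL2" by (auto simp: iwahori_def)
  have "mat 1 \<in> iwahori" by (simp add: mat_1_mat2 iwahori_mat2 val_ge_1 lex_le_iff)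
  then show "iwahori \<noteq> {}" by blast
next
  fix A assume A: "A \<in> iwahori"
  obtain a b c d where "A = mat2 a b c d" by (rule mat2_cases)
  then show "inv\<^bsub>SL2\<^esub> A \<in> iwahori" using A by (simp add: iwahori_mat2 inv_SL2_mat2 algebra_simps)
next
  fix A B assume A: "A \<in> iwahori" and B: "B \<in> iwahori"
  obtain a b c d where A': "A = mat2 a b c d" by (rule mat2_cases)
  obtain a' b' c' d' where B': "B = mat2 a' b' c' d'" by (rule mat2_cases)
  have "det (A ** B) = 1" using A B by (simp add: det_mul iwahori_def)
  then show "A \<otimes>\<^bsub>SL2\<^esub> B \<in> iwahori"
    using A B unfolding A' B'
    by (simp add: iwahori_mat2) (intro conjI val_ge_add val_ge_mult_0; simp add: val_ge_weaken val_ge_mult_0)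
qed


section \<open>Residue systems\<close>

text \<open>
  Representatives of the residue field, extracted from the quotient ring in which its
  cardinality is prescribed.
\<close>
lemma exists_residue_system:
  "\<exists>S. finite S \<and> card S = q \<and> (\<forall>x\<in>S. val_ge (0, 0) x) \<and>
     (\<forall>x. val_ge (0, 0) x \<longrightarrow> (\<exists>!u. u \<in> S \<and> val_ge (1, 0) (x - u)))"
proof -
  define coset where "coset = (\<lambda>x. {y. val_ge (1, 0) (y - x)})"
  let ?O = "{x. val_ge (0, 0) x}"
  have quot: "carrier ((ring_of_type_algebra\<lparr>carrier := rank_two_integers v\<rparr>)
      Quot ((\<lambda>x. t1 * x) ` rank_two_integers v)) = coset ` ?O" (is "?Q = _")
  proof -
    have "((\<lambda>x. t1 * x) ` rank_two_integers v)
        +>\<^bsub>ring_of_type_algebra\<lparr>carrier := rank_two_integers v\<rparr>\<^esub> x = coset x" for x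
    proof -
      have "(\<Union>h\<in>{h. val_ge (1, 0) h}. {h + x}) = coset x"
        by (force simp: coset_def intro: bexI[of _ "y - x" for y])
      moreover have "(\<lambda>x. t1 * x) ` rank_two_integers v = {h. val_ge (1, 0) h}"
        using prime_ideal_iff by blast
      moreover have "J +>\<^bsub>ring_of_type_algebra\<lparr>carrier := rank_two_integers v\<rparr>\<^esub> x = (\<Union>h\<in>J. {h + x})" for J
        by (simp add: a_r_coset_def' ring_of_type_algebra_def)
      ultimately show ?thesis by simp
    qed
    moreover have "rank_two_integers v = ?O" using integers_iff by blast
    ultimately show ?thesis by (auto simp: FactRing_def A_RCOSETS_def')
  qed
  define f where "f = (\<lambda>c :: 'f set. SOME x. x \<in> c)"
  have self: "x \<in> coset x" for x by (simp add: coset_def)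
  have f: "f (coset x) \<in> coset x" for x
    unfolding f_def by (rule someI[of _ x]) (rule self)
  have coset_eq: "coset x = coset y" if "val_ge (1, 0) (x - y)" for x y
  proof -
    have "val_ge (1, 0) (z - x) \<longleftrightarrow> val_ge (1, 0) (z - y)" for z
      using that val_ge_add[of "(1, 0)" "z - x" "x - y"] val_ge_diff[of "(1, 0)" "z - y" "x - y"]
      by auto
    then show ?thesis by (simp add: coset_def)
  qed
  have f_coset: "coset (f (coset x)) = coset x" for x
    using f[of x] by (intro coset_eq) (simp add: coset_def)
  define S where "S = f ` coset ` ?O"
  have inj: "inj_on f (coset ` ?O)"
    by (rule inj_onI) (metis f_coset imageE)
  have "finite (coset ` ?O)" using finite_residues quot by simp
  then have fin: "finite S" by (simp add: S_def)
  have card: "card S = q"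
    unfolding S_def card_image[OF inj] using card_residues quot by simp
  have S: "val_ge (0, 0) u" if u: "u \<in> S" for u
  proof -
    obtain x where x: "val_ge (0, 0) x" "u = f (coset x)" using u unfolding S_def by blast
    have "val_ge (0, 0) (u - x)" using f[of x] x by (simp add: coset_def val_ge_weaken)
    then have "val_ge (0, 0) (u - x + x)" using x val_ge_add by blast
    then show ?thesis by simp
  qed
  have "\<exists>!u. u \<in> S \<and> val_ge (1, 0) (x - u)" if x: "val_ge (0, 0) x" for x
  proof (rule ex1I[of _ "f (coset x)"])
    have "val_ge (1, 0) (- (f (coset x) - x))" using f[of x] by (simp only: val_ge_uminus) (simp add: coset_def)
    then show "f (coset x) \<in> S \<and> val_ge (1, 0) (x - f (coset x))"
      using x by (simp add: S_def)
    fix u assume u: "u \<in> S \<and> val_ge (1, 0) (x - u)"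
    then obtain y where "u = f (coset y)" by (auto simp: S_def)
    then have "u = f (coset u)" using f_coset by simp
    then show "u = f (coset x)" using coset_eq[of x u] u by simp
  qed
  then show ?thesis using fin card S by blast
qed

definition residues :: "'f set" where
  "residues = (SOME S. finite S \<and> card S = q \<and> (\<forall>x\<in>S. val_ge (0, 0) x) \<and>
     (\<forall>x. val_ge (0, 0) x \<longrightarrow> (\<exists>!u. u \<in> S \<and> val_ge (1, 0) (x - u))))"

lemma residues:
  "finite residues" "card residues = q" "u \<in> residues \<Longrightarrow> val_ge (0, 0) u"
  "val_ge (0, 0) x \<Longrightarrow> \<exists>!u. u \<in> residues \<and> val_ge (1, 0) (x - u)"
  using someI_ex[OF exists_residue_system] unfolding residues_def by blast+

lemma q_positive: "q > 0"
proof -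
  have "residues \<noteq> {}" using residues(4)[of 0] by auto
  then show ?thesis using residues(1,2) by (metis card_gt_0_iff)
qed

lemma residues_diff_unit:
  assumes "u \<in> residues" "u' \<in> residues" "u \<noteq> u'"
  shows "u - u' \<noteq> 0" "v (u - u') = (0, 0)"
proof -
  have "\<not> val_ge (1, 0) (u - u')"
    using residues(4)[OF residues(3)[OF assms(1)]] assms val_ge_0[of "(1, 0)"] by (metis diff_self)
  moreover have "val_ge (0, 0) (u - u')" using assms residues(3) val_ge_diff by blast
  ultimately show "u - u' \<noteq> 0" "v (u - u') = (0, 0)"
    by (auto simp: val_ge_def) (cases "v (u - u')", auto simp: lex_le_iff)
qed

section \<open>The double cosets of the Iwahori subgroup\<close>

definition weyl :: "index \<Rightarrow> 'f^2^2" where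
  "weyl w = eta (if even (fst w) then 1 else 2) (fst w div 2) (snd w)"

lemma eta_mat2:
  "eta 1 i j = mat2 (monomial i j) 0 0 (monomial (- i) (- j))"
  "eta 2 i j = mat2 0 (monomial i j) (- monomial (- i) (- j)) 0"
  by (simp_all add: eta_def mat2_def monomial_def)

lemma weyl_even: "weyl (2 * i, j) = mat2 (monomial i j) 0 0 (monomial (- i) (- j))"
  and weyl_odd: "weyl (2 * i + 1, j) = mat2 0 (monomial i j) (- monomial (- i) (- j)) 0"
  by (simp_all add: weyl_def eta_mat2)

lemma index_cases:
  fixes w :: index
  obtains i j where "w = (2 * i, j)" | i j where "w = (2 * i + 1, j)"
proof -
  obtain k j where "w = (k, j)" by force
  then show ?thesis using that by (metis evenE oddE)
qed

lemma det_weyl: "det (weyl w) = 1"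
  by (cases w rule: index_cases) (simp_all add: weyl_even weyl_odd monomial_mult)

abbreviation I :: "('f^2^2) set" where "I \<equiv> iwahori"

definition cell :: "index \<Rightarrow> ('f^2^2) set" where
  "cell w = SL2.double_coset I (weyl w)"

lemma cellI: "g \<in> I \<Longrightarrow> h \<in> I \<Longrightarrow> g ** weyl w ** h \<in> cell w"
  by (auto simp: cell_def SL2.double_coset_def)

lemma cellE:
  assumes "x \<in> cell w"
  obtains g h where "x = g ** weyl w ** h" "g \<in> I" "h \<in> I"
  using assms by (auto simp: cell_def SL2.double_coset_def)

lemma one_iwahori: "mat 1 \<in> I"
  using subgroup.one_closed[OF subgroup_iwahori] by simp

lemma inv_iwahori: "g \<in> I \<Longrightarrow> matrix_inv g \<in> I"
  using subgroup.m_inv_closed[OF subgroup_iwahori, of g] by (simp add: inv_SL2 iwahori_def)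

lemma mult_iwahori: "g \<in> I \<Longrightarrow> h \<in> I \<Longrightarrow> g ** h \<in> I"
  using subgroup.m_closed[OF subgroup_iwahori, of g h] by simp

lemma weyl_in_cell: "weyl w \<in> cell w"
  using cellI[OF one_iwahori one_iwahori, of w] by simp

lemma cell_det: "x \<in> cell w \<Longrightarrow> det x = 1"
  by (erule cellE) (simp add: det_mul det_weyl iwahori_def)

lemma cell_left: "x \<in> cell w \<Longrightarrow> g \<in> I \<Longrightarrow> g ** x \<in> cell w"
  by (erule cellE) (metis cellI matrix_mul_assoc mult_iwahori)

lemma cell_right: "x \<in> cell w \<Longrightarrow> g \<in> I \<Longrightarrow> x ** g \<in> cell w"
  by (erule cellE) (metis cellI matrix_mul_assoc mult_iwahori)

lemma dcoset_eq_cell: "dcoset a i j = cell (2 * i + (if a = 1 then 0 else 1), j)"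
proof -
  have "eta a i j = weyl (2 * i + (if a = 1 then 0 else 1), j)"
    using exhaust_2[of a] by (auto simp: weyl_def)
  then show ?thesis by (auto simp: dcoset_def cell_def SL2.double_coset_def)
qed

text \<open>
  Comparing entries, the equation would give valuation \<open>(k + i, l + j)\<close> to the
  upper right entry of \<open>g\<close> and the negative of this to the lower left one. But
  the former is nonnegative and the latter positive.
\<close>
lemma even_odd_disjoint:
  assumes g: "g \<in> I" and h: "h \<in> I"
  shows "g ** weyl (2 * i, j) \<noteq> weyl (2 * k + 1, l) ** h"
proof
  assume eq: "g ** weyl (2 * i, j) = weyl (2 * k + 1, l) ** h"
  obtain a b c d where g': "g = mat2 a b c d" by (rule mat2_cases)
  obtain a' b' c' d' where h': "h = mat2 a' b' c' d'" by (rule mat2_cases)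
  note a' = iwahori_diagonal[OF h[unfolded h']]
  have ge: "val_ge (1, 0) c" "val_ge (0, 0) b" using g by (simp_all add: g' iwahori_mat2)
  have eqs: "b * monomial (- i) (- j) = monomial k l * d'" "c * monomial i j = - (monomial (- k) (- l) * a')"
    using eq by (simp_all add: g' h' weyl_even weyl_odd)
  then have nz: "c \<noteq> 0" "b \<noteq> 0" using a' by auto
  have "v (b * monomial (- i) (- j)) = v (monomial k l * d')" "v (c * monomial i j) = v (- (monomial (- k) (- l) * a'))"
    using eqs by simp_all
  then show False using nz a' ge
    by (cases "v b"; cases "v c") (auto simp: v_mult v_monomial v_uminus val_ge_def lex_le_iff)
qed

text \<open>
  Disjointness of the double cosets. For indices of equal parity, one entry of the equation
  is a nonzero entry of each monomial matrix, multiplied by a diagonal entry of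
  \<open>g\<close> or \<open>h\<close>. The latter are units, so the valuations of the
  former agree.
\<close>
lemma weyl_mult_eq_imp:
  assumes g: "g \<in> I" and h: "h \<in> I" and eq: "g ** weyl w = weyl w' ** h"
  shows "w = w'"
proof -
  obtain a b c d where g': "g = mat2 a b c d" by (rule mat2_cases)
  obtain a' b' c' d' where h': "h = mat2 a' b' c' d'" by (rule mat2_cases)
  note gd = iwahori_diagonal[OF g[unfolded g']] and hd = iwahori_diagonal[OF h[unfolded h']]
  have same: "i = k \<and> j = l" if "x * monomial i j = monomial k l * y" "x \<noteq> 0" "v x = (0, 0)" "y \<noteq> 0" "v y = (0, 0)"
    for x y i j k l
  proof -
    have "v (x * monomial i j) = (i, j)" "v (monomial k l * y) = (k, l)" using that(2-) by (simp_all add: v_mult v_monomial)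
    then show ?thesis using that(1) by simp
  qed
  have eq': "matrix_inv g ** weyl w' = weyl w ** matrix_inv h"
  proof -
    have "matrix_inv g ** g ** weyl w ** matrix_inv h = matrix_inv g ** weyl w' ** (h ** matrix_inv h)"
      using eq by (simp add: matrix_mul_assoc[symmetric])
    then show ?thesis using g h by (simp add: SL2_inverse iwahori_def)
  qed
  show ?thesis
  proof (cases w rule: index_cases)
    case (1 i j)
    note w = 1
    show ?thesis
    proof (cases w' rule: index_cases)
      case (1 k l)
      then show ?thesis using eq same[of a i j k l a'] gd hd w by (simp add: g' h' weyl_even)
    next
      case (2 k l)
      then show ?thesis using even_odd_disjoint[OF g h] eq w by blast
    qed
  next
    case (2 i j)
    note w = 2
    show ?thesis
    proof (cases w' rule: index_cases)
      case (1 k l)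
      then show ?thesis using even_odd_disjoint[OF inv_iwahori[OF g] inv_iwahori[OF h]] eq' w by blast
    next
      case (2 k l)
      then show ?thesis using eq same[of a i j k l d'] gd hd w by (simp add: g' h' weyl_odd)
    qed
  qed
qed

lemma cell_unique:
  assumes "x \<in> cell w" "x \<in> cell w'"
  shows "w = w'"
proof -
  obtain g h where 1: "x = g ** weyl w ** h" "g \<in> I" "h \<in> I" using assms(1) by (rule cellE)
  obtain g' h' where 2: "x = g' ** weyl w' ** h'" "g' \<in> I" "h' \<in> I" using assms(2) by (rule cellE)
  have "matrix_inv g' ** (g ** weyl w ** h) ** matrix_inv h = matrix_inv g' ** (g' ** weyl w' ** h') ** matrix_inv h"
    using 1 2 by simp
  then have "(matrix_inv g' ** g) ** weyl w ** (h ** matrix_inv h)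
      = (matrix_inv g' ** g') ** weyl w' ** (h' ** matrix_inv h)"
    by (simp add: matrix_mul_assoc)
  then have "(matrix_inv g' ** g) ** weyl w = weyl w' ** (h' ** matrix_inv h)"
    using 1 2 by (simp add: SL2_inverse iwahori_def)
  then show ?thesis
    by (rule weyl_mult_eq_imp[OF mult_iwahori[OF inv_iwahori[OF 2(2)] 1(2)]
      mult_iwahori[OF 2(3) inv_iwahori[OF 1(3)]]])
qed

section \<open>The simple reflections of SL2\<close>

definition reflection :: "bool \<Rightarrow> 'f^2^2" where
  "reflection b = weyl (if b then 1 else - 1, 0)"

text \<open>
  The root subgroups of the two simple affine roots.
\<close>
definition root_element :: "bool \<Rightarrow> 'f \<Rightarrow> 'f^2^2" where
  "root_element b u = (if b then mat2 1 u 0 1 else mat2 1 0 (t1 * u) 1)"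

lemma reflection_mat2:
  "reflection True = mat2 0 1 (- 1) 0" "reflection False = mat2 0 (monomial (- 1) 0) (- monomial 1 0) 0"
  using weyl_odd[of 0 0] weyl_odd[of "- 1" 0] by (simp_all add: reflection_def)

lemma minus_one_iwahori: "mat2 (- 1) 0 0 (- 1) \<in> I"
  by (simp add: iwahori_mat2 val_ge_1 lex_le_iff)

lemma reflection_mult_weyl: "reflection b ** weyl w \<in> cell (flip b w)"
proof -
  have "reflection b ** weyl w = weyl (flip b w) \<or> reflection b ** weyl w = mat2 (- 1) 0 0 (- 1) ** weyl (flip b w)"
  proof (cases w rule: index_cases)
    case (1 i j)
    have "flip b w = (2 * (if b then - i else - 1 - i) + 1, - j)" using 1 by (simp add: flip_def)
    then show ?thesis using 1
      by (cases b) (simp_all only: weyl_odd weyl_even reflection_mat2, simp_all add: monomial_mult add.commute)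
  next
    case (2 i j)
    have "flip b w = (2 * (if b then - i else - 1 - i), - j)" using 2 by (simp add: flip_def)
    then show ?thesis using 2
      by (cases b) (simp_all only: weyl_odd weyl_even reflection_mat2, simp_all add: monomial_mult add.commute)
  qed
  then show ?thesis using weyl_in_cell cell_left minus_one_iwahori by metis
qed

text \<open>
  Conjugation by a monomial matrix scales a root element by an even power of the parameters
  and exchanges upper and lower triangular matrices for odd indices.
\<close>
lemma ascent_conjugate:
  assumes w: "\<not> descent b w" and u: "val_ge (0, 0) u"
  shows "matrix_inv (weyl w) ** root_element b u ** weyl w \<in> I"
proof -
  have unip: "mat2 1 (monomial k l * u) 0 1 \<in> I" "mat2 1 (- (monomial k l * u)) 0 1 \<in> I" if "lex_le (0, 0) (k, l)" for k l
    using that u by (auto simp: iwahori_mat2 val_ge_1 val_ge_monomial_mult lex_le_iff elim!: val_ge_mono)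
  have unip': "mat2 1 0 (monomial k l * u) 1 \<in> I" "mat2 1 0 (- (monomial k l * u)) 1 \<in> I" if "lex_le (1, 0) (k, l)" for k l
    using that u by (auto simp: iwahori_mat2 val_ge_1 val_ge_monomial_mult lex_le_iff elim!: val_ge_mono)
  have square: "monomial (2 * i + 1) (2 * j) = t1 * (monomial i j * monomial i j)"
    "monomial (- 2 * i) (- 2 * j) = monomial (- i) (- j) * monomial (- i) (- j)" for i j
    by (simp_all add: monomial_mult t1_mult_monomial)
  have cancel: "monomial i j * monomial (- i) (- j) = 1" "monomial (- i) (- j) * monomial i j = 1" for i j
    by (simp_all add: monomial_mult)
  show ?thesis
  proof (cases w rule: index_cases)
    case (1 i j)
    have inv: "matrix_inv (weyl w) = mat2 (monomial (- i) (- j)) 0 0 (monomial i j)"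
      by (simp add: 1 weyl_even matrix_inv_mat2 monomial_mult)
    show ?thesis
    proof (cases b)
      case True
      have "matrix_inv (weyl w) ** root_element b u ** weyl w = mat2 1 (monomial (- 2 * i) (- 2 * j) * u) 0 1"
        unfolding inv unfolding 1 weyl_even square root_element_def by (simp add: True cancel mult_ac)
      moreover have "lex_le (0, 0) (- 2 * i, - 2 * j)" using w 1 True by (auto simp: lex_le_iff descent_def)
      ultimately show ?thesis using unip[of "- 2 * i" "- 2 * j"] by simp
    next
      case False
      have "matrix_inv (weyl w) ** root_element b u ** weyl w = mat2 1 0 (monomial (2 * i + 1) (2 * j) * u) 1"
        unfolding inv unfolding 1 weyl_even square root_element_def by (simp add: False cancel mult_ac)
      moreover have "lex_le (1, 0) (2 * i + 1, 2 * j)" using w 1 False by (auto simp: lex_le_iff descent_def)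
      ultimately show ?thesis using unip'[of "2 * i + 1" "2 * j"] by simp
    qed
  next
    case (2 i j)
    have inv: "matrix_inv (weyl w) = mat2 0 (- monomial i j) (monomial (- i) (- j)) 0"
      by (simp add: 2 weyl_odd matrix_inv_mat2 monomial_mult)
    show ?thesis
    proof (cases b)
      case True
      have "matrix_inv (weyl w) ** root_element b u ** weyl w = mat2 1 0 (- (monomial (- 2 * i) (- 2 * j) * u)) 1"
        unfolding inv unfolding 2 weyl_odd square root_element_def by (simp add: True cancel mult_ac)
      moreover have "lex_le (1, 0) (- 2 * i, - 2 * j)" using w 2 True by (auto simp: lex_le_iff descent_def)
      ultimately show ?thesis using unip'[of "- 2 * i" "- 2 * j"] by simp
    next
      case False
      have "matrix_inv (weyl w) ** root_element b u ** weyl w = mat2 1 (- (monomial (2 * i + 1) (2 * j) * u)) 0 1"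
        unfolding inv unfolding 2 weyl_odd square root_element_def by (simp add: False cancel mult_ac)
      moreover have "lex_le (0, 0) (2 * i + 1, 2 * j)" using w 2 False by (auto simp: lex_le_iff descent_def)
      ultimately show ?thesis using unip[of "2 * i + 1" "2 * j"] by simp
    qed
  qed
qed

lemma root_element_iwahori: "val_ge (0, 0) u \<Longrightarrow> root_element b u \<in> I"
  by (auto simp: root_element_def iwahori_mat2 val_ge_1 lex_le_iff val_ge_t1_mult elim!: val_ge_mono)

lemma conj_reflection:
  assumes "a * d - b * c = 1"
  shows "matrix_inv (reflection True) ** matrix_inv (root_element True u) ** mat2 a b c d ** reflection True
      = mat2 d (- c) (- (b - u * d)) (a - u * c)"
    and "matrix_inv (reflection False) ** matrix_inv (root_element False u) ** mat2 a b c d ** reflection False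
      = mat2 (d - t1 * u * b) (- (monomial (- 2) 0 * c - monomial (- 1) 0 * (u * a))) (- (monomial 2 0 * b)) a"
  by (simp_all add: root_element_def reflection_mat2 matrix_inv_mat2 monomial_mult t1_mult_monomial algebra_simps monomial_mult_left)

text \<open>
  Both reflections reduce the claim to one congruence modulo the prime ideal for
  \<open>u\<close>, whose coefficient is a diagonal entry of \<open>g\<close> and hence a
  unit.
\<close>
lemma reflection_coset:
  assumes "g \<in> I"
  shows "\<exists>!u. u \<in> residues \<and>
    matrix_inv (reflection b) ** matrix_inv (root_element b u) ** g ** reflection b \<in> I"
proof -
  obtain a b' c d where g': "g = mat2 a b' c d" by (rule mat2_cases)
  note diag = iwahori_diagonal[OF assms[unfolded g']]
  have g: "a * d - b' * c = 1" "val_ge (0, 0) a" "val_ge (0, 0) b'" "val_ge (1, 0) c" "val_ge (0, 0) d"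
    using assms by (simp_all add: g' iwahori_mat2)
  have unit: "val_ge p (x * y) \<longleftrightarrow> val_ge p y" if "x \<noteq> 0" "v x = (0, 0)" for p x y
    using that by (cases "y = 0") (simp_all add: val_ge_def v_mult)
  show ?thesis
  proof (cases b)
    case True
    have iff: "matrix_inv (reflection b) ** matrix_inv (root_element b u) ** g ** reflection b \<in> I
        \<longleftrightarrow> val_ge (1, 0) (inverse d * b' - u)" if "u \<in> residues" for u
    proof -
      have "d * (inverse d * b' - u) = b' - u * d" using diag by (simp add: algebra_simps)
      then have "val_ge (1, 0) (inverse d * b' - u) \<longleftrightarrow> val_ge (1, 0) (b' - u * d)"
        using unit[OF diag(3,4), of "(1, 0)" "inverse d * b' - u"] by simp
      moreover have "val_ge (0, 0) (a - u * c)"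
        using g residues(3)[OF that] by (intro val_ge_diff val_ge_mult_0) (simp_all add: val_ge_weaken)
      moreover have "val_ge (1, 0) (u * d - b') \<longleftrightarrow> val_ge (1, 0) (b' - u * d)"
        by (rule val_ge_minus_commute)
      moreover have "d * (a - u * c) - (- c) * - (b' - u * d) = 1" using g(1) by (simp add: algebra_simps)
      ultimately show ?thesis using g True
        by (simp add: g' conj_reflection[OF g(1)] iwahori_mat2 val_ge_weaken del: mult_minus_left mult_minus_right)
    qed
    have "val_ge (0, 0) (inverse d * b')"
      using g diag by (subst unit) (simp_all add: v_inverse)
    from residues(4)[OF this] show ?thesis by (simp add: iff cong: conj_cong)
  next
    case False
    have iff: "matrix_inv (reflection b) ** matrix_inv (root_element b u) ** g ** reflection b \<in> I
        \<longleftrightarrow> val_ge (1, 0) (inverse a * (monomial (- 1) 0 * c) - u)" if "u \<in> residues" for u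
    proof -
      have "monomial (- 2) 0 * c - monomial (- 1) 0 * (u * a) = monomial (- 1) 0 * (a * (inverse a * (monomial (- 1) 0 * c) - u))"
      proof -
        have eq: "a * (inverse a * (monomial (- 1) 0 * c) - u) = monomial (- 1) 0 * c - u * a"
        proof -
          have "a * (inverse a * z) = z" for z using diag by (simp add: mult.assoc[symmetric])
          then show ?thesis by (simp add: right_diff_distrib mult.commute[of a u])
        qed
        show ?thesis unfolding eq by (simp add: right_diff_distrib monomial_mult_left)
      qed
      then have "val_ge (1, 0) (inverse a * (monomial (- 1) 0 * c) - u)
          \<longleftrightarrow> val_ge (0, 0) (monomial (- 2) 0 * c - monomial (- 1) 0 * (u * a))"
        using unit[OF diag(1,2)] by (simp add: val_ge_monomial_mult)
      moreover have "val_ge (0, 0) (d - t1 * u * b')"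
        using g residues(3)[OF that] t1 unfolding mult.assoc
        by (intro val_ge_diff val_ge_mult_0) (simp_all add: val_ge_def[of _ t1] lex_le_iff)
      moreover have "val_ge (1, 0) (monomial 2 0 * b')"
        using g by (auto simp: val_ge_monomial_mult lex_le_iff elim!: val_ge_mono)
      moreover have "det (matrix_inv (reflection b) ** matrix_inv (root_element b u) ** g ** reflection b) = 1"
        using g(1) by (simp add: det_mul g' reflection_def det_weyl SL2_inverse root_element_def)
      ultimately show ?thesis using g False
        by (simp add: g' conj_reflection[OF g(1)] iwahori_mat2
            val_ge_minus_commute[of _ "monomial (- 1) 0 * (u * a)"])
    qed
    have "val_ge (0, 0) (inverse a * (monomial (- 1) 0 * c))"
      using g diag by (subst unit) (simp_all add: v_inverse val_ge_monomial_mult)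
    from residues(4)[OF this] show ?thesis by (simp add: iff cong: conj_cong)
  qed
qed

text \<open>
  The conjugate of a root element by its reflection is a unipotent matrix of the opposite
  root, and the identity of SL2 that factors such a matrix through the reflection applies.
  Its factors are in \<open>I\<close> because the difference of distinct residues is a unit.
\<close>
lemma reflection_quadratic:
  assumes "u \<in> residues" "u' \<in> residues" "u \<noteq> u'"
  shows "matrix_inv (reflection b) ** matrix_inv (root_element b u) ** root_element b u' ** reflection b
    \<in> SL2.double_coset I (reflection b)"
proof -
  define y where "y = u' - u"
  have y: "y \<noteq> 0" "v y = (0, 0)" using residues_diff_unit[of u' u] assms by (auto simp: y_def)
  have u': "u' = u + y" by (simp add: y_def)
  from y have iy: "val_ge (0, 0) y" "val_ge (0, 0) (inverse y)" by (auto simp: val_ge_def v_inverse lex_le_iff)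
  have "\<exists>A\<in>I. \<exists>B\<in>I. matrix_inv (reflection b) ** matrix_inv (root_element b u) ** root_element b u' ** reflection b
    = A ** reflection b ** B"
  proof (cases b)
    case True
    have "mat2 (inverse y) (- 1) 0 y \<in> I" "mat2 1 (- inverse y) 0 1 \<in> I"
      using y iy by (simp_all add: iwahori_mat2 val_ge_1 lex_le_iff)
    moreover have "matrix_inv (reflection b) ** matrix_inv (root_element b u) ** root_element b u' ** reflection b
      = mat2 (inverse y) (- 1) 0 y ** reflection b ** mat2 1 (- inverse y) 0 1"
      using True y conj_reflection(1)[of 1 1 u' 0 u]
      by (simp add: root_element_def reflection_mat2 u')
    ultimately show ?thesis by blast
  next
    case False
    have cancel: "y * (inverse y * z) = z" for z using y by (simp add: mult.assoc[symmetric])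
    have "mat2 (- y) 0 t1 (- inverse y) \<in> I" "mat2 1 0 (- (t1 * inverse y)) 1 \<in> I"
      using y iy t1 by (simp_all add: iwahori_mat2 val_ge_1 lex_le_iff val_ge_t1_mult val_ge_def[of _ t1])
    moreover have "matrix_inv (reflection b) ** matrix_inv (root_element b u) ** root_element b u' ** reflection b
      = mat2 (- y) 0 t1 (- inverse y) ** reflection b ** mat2 1 0 (- (t1 * inverse y)) 1"
      using False y conj_reflection(2)[of 1 1 0 "t1 * u'" u]
      by (simp add: root_element_def reflection_mat2 monomial_1_0 t1_mult_monomial monomial_mult monomial_mult_left u')
        (simp add: algebra_simps cancel t1_mult_monomial)
    ultimately show ?thesis by blast
  qed
  then show ?thesis unfolding SL2.double_coset_def by auto
qed

lemma inj_root_element: "inj_on (root_element b) S"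
  using t1 by (auto simp: inj_on_def root_element_def)

lemma det_root_element [simp]: "det (root_element b u) = 1"
  by (simp add: root_element_def)

lemma det_reflection [simp]: "det (reflection b) = 1"
  by (simp add: reflection_def det_weyl)

lemma hecke_reflection: "hecke_reflection SL2 I (reflection b) (root_element b ` residues)"
proof (rule hecke_reflection.intro[OF group_SL2 subgroup_iwahori], rule hecke_reflection_axioms.intro)
  show "reflection b \<otimes>\<^bsub>SL2\<^esub> reflection b \<in> I"
    using minus_one_iwahori by (cases b) (simp_all add: reflection_mat2 monomial_mult)
  show "root_element b ` residues \<subseteq> I"
    using root_element_iwahori residues(3) by blast
  show "\<exists>!u. u \<in> root_element b ` residues \<and>
      inv\<^bsub>SL2\<^esub> reflection b \<otimes>\<^bsub>SL2\<^esub> inv\<^bsub>SL2\<^esub> u \<otimes>\<^bsub>SL2\<^esub> g \<otimes>\<^bsub>SL2\<^esub> reflection b \<in> I" if g: "g \<in> I" for g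
  proof -
    obtain u where u: "u \<in> residues" "matrix_inv (reflection b) ** matrix_inv (root_element b u) ** g ** reflection b \<in> I"
      and uniq: "\<And>u'. u' \<in> residues \<Longrightarrow> matrix_inv (reflection b) ** matrix_inv (root_element b u') ** g ** reflection b \<in> I
        \<Longrightarrow> u' = u"
      using reflection_coset[OF g, of b] by blast
    show ?thesis
    proof (rule ex1I[of _ "root_element b u"])
      show "root_element b u \<in> root_element b ` residues \<and>
          inv\<^bsub>SL2\<^esub> reflection b \<otimes>\<^bsub>SL2\<^esub> inv\<^bsub>SL2\<^esub> root_element b u \<otimes>\<^bsub>SL2\<^esub> g \<otimes>\<^bsub>SL2\<^esub> reflection b \<in> I"
        using u by (simp add: inv_SL2)
      fix z assume z: "z \<in> root_element b ` residues \<and>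
          inv\<^bsub>SL2\<^esub> reflection b \<otimes>\<^bsub>SL2\<^esub> inv\<^bsub>SL2\<^esub> z \<otimes>\<^bsub>SL2\<^esub> g \<otimes>\<^bsub>SL2\<^esub> reflection b \<in> I"
      then obtain u' where u': "z = root_element b u'" "u' \<in> residues" by blast
      then show "z = root_element b u" using z uniq[of u'] by (simp add: inv_SL2)
    qed
  qed
  show "inv\<^bsub>SL2\<^esub> reflection b \<otimes>\<^bsub>SL2\<^esub> inv\<^bsub>SL2\<^esub> u \<otimes>\<^bsub>SL2\<^esub> u' \<otimes>\<^bsub>SL2\<^esub> reflection b
      \<in> SL2.double_coset I (reflection b)"
    if u: "u \<in> root_element b ` residues" "u' \<in> root_element b ` residues" "u \<noteq> u'" for u u'
  proof -
    obtain z z' where z: "u = root_element b z" "u' = root_element b z'" "z \<in> residues" "z' \<in> residues"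
      using u by blast
    then have "z \<noteq> z'" using u by blast
    then show ?thesis using reflection_quadratic[OF z(3,4), of b] by (simp add: z inv_SL2)
  qed
qed (simp_all add: residues(1))

interpretation R: hecke_reflection SL2 I "reflection b" "root_element b ` residues" for b
  by (rule hecke_reflection)

lemma card_root_elements: "card (root_element b ` residues) = q"
  using card_image[OF inj_root_element] residues(2) by simp

lemma double_coset_reflection: "SL2.double_coset I (reflection b ** weyl w) = cell (flip b w)"
  using R.double_coset_eq[of "weyl (flip b w)" "reflection b ** weyl w"] reflection_mult_weyl[of b w]
  by (simp add: cell_def det_weyl)

lemma ascent_weyl: "\<not> descent b w \<Longrightarrow> R.ascent b (weyl w)"
  unfolding R.ascent_def using ascent_conjugate residues(3) by (auto simp: det_weyl inv_SL2)

lemma weyl_0: "weyl (0, 0) = mat 1"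
  using weyl_even[of 0 0] by (simp add: mat_1_mat2)

lemma cell_0: "cell (0, 0) = I"
proof -
  have "x \<in> cell (0, 0)" if "x \<in> I" for x
    using cellI[OF that one_iwahori, of "(0, 0)"] by (simp add: weyl_0)
  moreover have "x \<in> I" if x: "x \<in> cell (0, 0)" for x
    using x by (rule cellE) (simp add: weyl_0 mult_iwahori)
  ultimately show ?thesis by blast
qed

section \<open>Structure constants\<close>

text \<open>
  By induction along the reduced word of \<open>k\<close>: the transversal grows by
  \<open>left_transversal_step\<close>, and summing over its new factor applies one more
  operator \<open>left_simple\<close>. The double coset of \<open>b\<close> may be at any
  level. In this way the double cosets that occur in a product are found explicitly.
\<close>
lemma cell_transversal_count:
  "\<exists>Y. finite Y \<and> SL2.left_transversal I Y (cell (k, 0)) \<and>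
     (\<forall>b w x. x \<in> cell w \<longrightarrow>
        (\<Sum>y\<in>Y. indicator (cell b) (matrix_inv y ** x)) = left_elem (of_nat q) k (\<lambda>w'. of_bool (w' = b)) w)"
proof (induction "nat \<bar>k\<bar>" arbitrary: k)
  case 0
  then have k: "k = 0" by simp
  have one: "matrix_inv (mat 1 :: 'f^2^2) = mat 1" by (rule matrix_inv_unique_right) simp
  have "SL2.left_transversal I {mat 1} (cell (k, 0))"
    unfolding SL2.left_transversal_def k cell_0
    using one_iwahori by (auto simp: iwahori_def inv_SL2 one)
  moreover have "indicator (cell b) x = (of_bool (w = b) :: complex)" if "x \<in> cell w" for x w b
    using that cell_unique[OF that, of b] by (auto simp: indicator_def)
  ultimately show ?case by (intro exI[of _ "{mat 1}"]) (simp add: k one)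
next
  case (Suc n)
  define c where "c = (k > 0)"
  define k' where "k' = fst (flip c (k, 0))"
  have desc: "descent c (k, 0)" using Suc(2) by (auto simp: c_def descent_def)
  have k': "flip c (k', 0) = (k, 0)" by (simp add: k'_def flip_def)
  have asc: "\<not> descent c (k', 0)" using desc descent_flip[of c "(k', 0)"] k' by simp
  have "n = nat \<bar>k'\<bar>" using Suc(2) by (auto simp: k'_def c_def flip_def)
  from Suc(1)[OF this] obtain Y where Y: "finite Y" "SL2.left_transversal I Y (cell (k', 0))"
    and count: "\<And>b w x. x \<in> cell w \<Longrightarrow> (\<Sum>y\<in>Y. indicator (cell b) (matrix_inv y ** x))
      = left_elem (of_nat q) k' (\<lambda>w'. of_bool (w' = b)) w" by blast
  let ?U = "root_element c ` residues"
  let ?m = "\<lambda>(u, y). u ** reflection c ** y"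
  have wasc: "R.ascent c (weyl (k', 0))" using ascent_weyl asc by blast
  have neq: "cell (k', 0) \<inter> cell (k, 0) = {}"
    using cell_unique desc asc by blast
  note step = R.left_transversal_step[OF wasc, unfolded SL2_simps double_coset_reflection k',
      folded cell_def, OF neq Y(2)]
  have Ydet: "det y = 1" if "y \<in> Y" for y
    using that Y(2) by (auto simp: SL2.left_transversal_def)
  have "(\<Sum>y\<in>?m ` (?U \<times> Y). indicator (cell b) (matrix_inv y ** x))
      = left_elem (of_nat q) k (\<lambda>w'. of_bool (w' = b)) w" if x: "x \<in> cell w" for b w x
  proof -
    define \<phi> where "\<phi> = (\<lambda>z. \<Sum>y\<in>Y. indicator (cell b) (matrix_inv y ** z) :: complex)"
    let ?\<delta> = "\<lambda>w'. of_bool (w' = b) :: complex"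
    have \<phi>: "\<phi> z = left_elem (of_nat q) k' ?\<delta> w'" if "z \<in> cell w'" for z w'
      unfolding \<phi>_def by (rule count[OF that])
    have inv_m: "matrix_inv (u ** reflection c ** y) = matrix_inv y ** (matrix_inv (reflection c) ** matrix_inv u)"
      if "u \<in> ?U" "y \<in> Y" for u y
    proof -
      have d: "det u = 1" "det y = 1" using that Ydet by auto
      then have "inv\<^bsub>SL2\<^esub> (u \<otimes>\<^bsub>SL2\<^esub> reflection c \<otimes>\<^bsub>SL2\<^esub> y)
          = inv\<^bsub>SL2\<^esub> y \<otimes>\<^bsub>SL2\<^esub> (inv\<^bsub>SL2\<^esub> reflection c \<otimes>\<^bsub>SL2\<^esub> inv\<^bsub>SL2\<^esub> u)"
        using SL2.inv_mult_group[of "u ** reflection c" y] SL2.inv_mult_group[of u "reflection c"]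
        by (simp add: det_mul)
      then show ?thesis using d by (simp add: inv_SL2 det_mul)
    qed
    have "(\<Sum>y\<in>?m ` (?U \<times> Y). indicator (cell b) (matrix_inv y ** x))
        = (\<Sum>p\<in>?U \<times> Y. indicator (cell b) (matrix_inv (?m p) ** x) :: complex)"
      using step(1) by (simp add: sum.reindex)
    also have "\<dots> = (\<Sum>u\<in>?U. \<Sum>y\<in>Y. indicator (cell b) (matrix_inv (?m (u, y)) ** x))"
      by (simp add: sum.cartesian_product case_prod_beta)
    also have "\<dots> = (\<Sum>u\<in>?U. \<phi> (matrix_inv (reflection c) ** matrix_inv u ** x))"
      unfolding \<phi>_def by (intro sum.cong refl) (simp add: inv_m matrix_mul_assoc)
    also have "\<dots> = (\<Sum>u\<in>?U. \<phi> (inv\<^bsub>SL2\<^esub> reflection c \<otimes>\<^bsub>SL2\<^esub> inv\<^bsub>SL2\<^esub> u \<otimes>\<^bsub>SL2\<^esub> x))"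
      by (intro sum.cong refl) (auto simp: inv_SL2)
    also have "\<dots> = left_simple (of_nat q) c (left_elem (of_nat q) k' ?\<delta>) w"
    proof (cases "descent c w")
      case False
      have "\<phi> z = left_elem (of_nat q) k' ?\<delta> (flip c w)" if "z \<in> SL2.double_coset I (reflection c \<otimes>\<^bsub>SL2\<^esub> weyl w)" for z
        using that \<phi> by (simp add: double_coset_reflection)
      from R.sum_ascent[OF ascent_weyl[OF False] x[unfolded cell_def] this]
      show ?thesis by (simp add: card_root_elements left_simple_def False)
    next
      case True
      let ?w = "flip c w"
      have asc: "\<not> descent c ?w" using True by simp
      have "x \<in> SL2.double_coset I (reflection c \<otimes>\<^bsub>SL2\<^esub> weyl ?w)"
        using x by (simp add: double_coset_reflection)
      moreover have "\<phi> z = left_elem (of_nat q) k' ?\<delta> ?w" if "z \<in> SL2.double_coset I (weyl ?w)" for z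
        using that \<phi> by (simp add: cell_def)
      moreover have "\<phi> z = left_elem (of_nat q) k' ?\<delta> w" if "z \<in> SL2.double_coset I (reflection c \<otimes>\<^bsub>SL2\<^esub> weyl ?w)" for z
        using that \<phi> by (simp add: double_coset_reflection)
      ultimately have "(\<Sum>u\<in>?U. \<phi> (inv\<^bsub>SL2\<^esub> reflection c \<otimes>\<^bsub>SL2\<^esub> inv\<^bsub>SL2\<^esub> u \<otimes>\<^bsub>SL2\<^esub> x))
          = left_elem (of_nat q) k' ?\<delta> ?w + (of_nat (card ?U) - 1) * left_elem (of_nat q) k' ?\<delta> w"
        by (rule R.sum_descent[OF ascent_weyl[OF asc]])
      then show ?thesis by (simp add: card_root_elements left_simple_def True)
    qed
    also have "left_simple (of_nat q) c (left_elem (of_nat q) k' ?\<delta>) = left_elem (of_nat q) k ?\<delta>"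
      using left_simple_left_elem_ascent[OF asc] k' by simp
    finally show ?thesis .
  qed
  moreover have "finite (?m ` (?U \<times> Y))" using Y(1) residues(1) by simp
  ultimately show ?case using step(2) by blast
qed

lemma coset_reps_transversal: "SL2.right_transversal I (coset_reps b k l) (dcoset b k l)"
proof -
  let ?A = "dcoset b k l"
  have A: "det x = 1" "h ** x \<in> ?A" if "x \<in> ?A" "h \<in> I" for x h
    using that cell_det cell_left unfolding dcoset_eq_cell by blast+
  have mem: "x \<in> right_coset z \<longleftrightarrow> x ** matrix_inv z \<in> I" if "det z = 1" for x z
  proof
    assume "x \<in> right_coset z"
    then obtain h where "x = h ** z" "h \<in> I" by (auto simp: right_coset_def)
    then show "x ** matrix_inv z \<in> I"
      using that by (simp add: matrix_mul_assoc[symmetric] SL2_inverse)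
  next
    assume "x ** matrix_inv z \<in> I"
    moreover have "x = (x ** matrix_inv z) ** z"
      using that by (simp add: matrix_mul_assoc[symmetric] SL2_inverse)
    ultimately show "x \<in> right_coset z" unfolding right_coset_def by blast
  qed
  have det: "det x = 1" if "x \<in> ?A" for x using A[OF that one_iwahori] by blast
  have self: "x \<in> right_coset x" for x
    unfolding right_coset_def using one_iwahori by (intro image_eqI[of _ _ "mat 1"]) simp_all
  have eq: "right_coset x = right_coset z" if xz: "x \<in> right_coset z" for x z
  proof -
    obtain h where h: "x = h ** z" "h \<in> I" using xz by (auto simp: right_coset_def)
    have "g ** x \<in> right_coset z" if "g \<in> I" for g
      using h mult_iwahori[OF that h(2)] by (auto simp: right_coset_def matrix_mul_assoc)
    moreover have "g ** z \<in> right_coset x" if "g \<in> I" for g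
    proof -
      have "det h = 1" using h by (simp add: iwahori_def)
      then have "g ** z = (g ** matrix_inv h) ** x"
        using h by (metis SL2_inverse(2) matrix_mul_assoc matrix_mul_rid)
      then show ?thesis using mult_iwahori[OF that inv_iwahori[OF h(2)]] unfolding right_coset_def by blast
    qed
    ultimately show ?thesis by (auto simp: right_coset_def)
  qed
  have ex: "\<exists>R. is_coset_reps R ?A"
  proof -
    define r where "r = (\<lambda>c :: ('f^2^2) set. SOME x. x \<in> c)"
    have r: "r (right_coset x) \<in> right_coset x" for x
      unfolding r_def by (rule someI[of _ x]) (rule self)
    let ?R = "(\<lambda>x. r (right_coset x)) ` ?A"
    have "right_coset (r (right_coset x)) = right_coset x" for x
      using eq[OF r] .
    moreover have "right_coset x \<subseteq> ?A" if "x \<in> ?A" for x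
      using A(2)[OF that] by (auto simp: right_coset_def)
    ultimately have "?A = (\<Union>z\<in>?R. right_coset z)" using self by auto
    moreover have "disjoint_family_on right_coset ?R"
      unfolding disjoint_family_on_def
    proof (intro ballI impI)
      fix z z' assume z: "z \<in> ?R" "z' \<in> ?R" "z \<noteq> z'"
      have "z = r (right_coset z)" "z' = r (right_coset z')" using z eq[OF r] by auto
      then have "right_coset z \<noteq> right_coset z'" using z by metis
      then show "right_coset z \<inter> right_coset z' = {}" using eq by blast
    qed
    ultimately show ?thesis unfolding is_coset_reps_def by blast
  qed
  define R where "R = coset_reps b k l"
  have "is_coset_reps R ?A" unfolding R_def coset_reps_def by (rule someI_ex[OF ex])
  then have R: "?A = (\<Union>z\<in>R. right_coset z)" "disjoint_family_on right_coset R"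
    by (simp_all add: is_coset_reps_def)
  have RA: "R \<subseteq> ?A" using R(1) self by blast
  have "\<exists>!z. z \<in> R \<and> x ** matrix_inv z \<in> I" if x: "x \<in> ?A" for x
  proof -
    obtain z where z: "z \<in> R" "x \<in> right_coset z" using x R(1) by blast
    show ?thesis
    proof (rule ex1I[of _ z])
      show "z \<in> R \<and> x ** matrix_inv z \<in> I" using z mem det RA by blast
      fix z' assume z': "z' \<in> R \<and> x ** matrix_inv z' \<in> I"
      then have "x \<in> right_coset z'" using mem det RA by blast
      then show "z' = z" using z z' R(2) by (auto simp: disjoint_family_on_def)
    qed
  qed
  moreover have inv: "inv\<^bsub>SL2\<^esub> z = matrix_inv z" if "z \<in> R" for z
    using that RA det by (intro inv_SL2) blast
  ultimately have "\<exists>!z. z \<in> R \<and> x \<otimes>\<^bsub>SL2\<^esub> inv\<^bsub>SL2\<^esub> z \<in> I" if "x \<in> ?A" for x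
    using that by (simp cong: conj_cong)
  moreover have "?A \<subseteq> carrier SL2" using det by auto
  ultimately show ?thesis
    unfolding SL2.right_transversal_def R_def[symmetric] using RA by (intro conjI ballI)
qed


lemma matrix_inv_weyl_in_cell: "matrix_inv (weyl w) \<in> cell (inv_index w)"
proof -
  have "matrix_inv (weyl w) = weyl (inv_index w) \<or> matrix_inv (weyl w) = mat2 (- 1) 0 0 (- 1) ** weyl (inv_index w)"
  proof (cases w rule: index_cases)
    case (1 i j)
    then have w': "inv_index w = (2 * (- i), - j)" by (simp add: inv_index_def)
    show ?thesis unfolding w' unfolding 1 weyl_even by (simp add: matrix_inv_mat2 monomial_mult)
  next
    case (2 i j)
    then have w': "inv_index w = (2 * i + 1, j)" by (simp add: inv_index_def)
    show ?thesis unfolding w' unfolding 2 weyl_odd by (simp add: matrix_inv_mat2 monomial_mult)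
  qed
  then show ?thesis using weyl_in_cell cell_left minus_one_iwahori by metis
qed

lemma matrix_inv_mult_SL2:
  fixes A B :: "'f^2^2"
  assumes "det A = 1" "det B = 1"
  shows "matrix_inv (A ** B) = matrix_inv B ** matrix_inv A"
  using assms SL2.inv_mult_group[of A B] by (simp add: inv_SL2 det_mul)

lemma matrix_inv_inv_SL2: "det A = 1 \<Longrightarrow> matrix_inv (matrix_inv A) = (A :: 'f^2^2)"
  using SL2.inv_inv[of A] by (simp add: inv_SL2 SL2_inverse)

lemma matrix_inv_cell: "x \<in> cell w \<Longrightarrow> matrix_inv x \<in> cell (inv_index w)"
proof (erule cellE)
  fix g h assume x: "x = g ** weyl w ** h" "g \<in> I" "h \<in> I"
  have d: "det g = 1" "det h = 1" using x by (simp_all add: iwahori_def)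
  have "matrix_inv x = matrix_inv h ** matrix_inv (weyl w) ** matrix_inv g"
    unfolding x(1) using d by (simp add: matrix_inv_mult_SL2 det_mul det_weyl matrix_mul_assoc)
  then show ?thesis
    using x matrix_inv_weyl_in_cell by (simp add: cell_left cell_right inv_iwahori)
qed

lemma matrix_inv_cell_iff: "det x = 1 \<Longrightarrow> matrix_inv x \<in> cell (inv_index w) \<longleftrightarrow> x \<in> cell w"
  using matrix_inv_cell[of x w] matrix_inv_cell[of "matrix_inv x" "inv_index w"]
  by (auto simp: matrix_inv_inv_SL2)

lemma inv_cell: "cell (inv_index w) = (\<lambda>x. inv\<^bsub>SL2\<^esub> x) ` cell w"
proof -
  have "x \<in> (\<lambda>x. inv\<^bsub>SL2\<^esub> x) ` cell w" if x: "x \<in> cell (inv_index w)" for x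
  proof (rule image_eqI[of _ _ "matrix_inv x"])
    show "matrix_inv x \<in> cell w" using matrix_inv_cell[OF x] by simp
    show "x = inv\<^bsub>SL2\<^esub> matrix_inv x"
      using cell_det[OF x] by (simp add: inv_SL2 SL2_inverse matrix_inv_inv_SL2)
  qed
  moreover have "inv\<^bsub>SL2\<^esub> x \<in> cell (inv_index w)" if x: "x \<in> cell w" for x
    using matrix_inv_cell[OF x] cell_det[OF x] by (simp add: inv_SL2)
  ultimately show ?thesis by blast
qed

definition index_of :: "2 \<times> int \<times> int \<Rightarrow> index" where
  "index_of = (\<lambda>(a, i, j). (2 * i + (if a = 1 then 0 else 1), j))"

lemma chi_eq: "chi a i j = indicator (cell (index_of (a, i, j)))"
  by (simp add: chi_def dcoset_eq_cell index_of_def)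

lemma eta_eq: "eta a i j = weyl (index_of (a, i, j))"
  using exhaust_2[of a] by (auto simp: weyl_def index_of_def)

lemma bij_index_of: "bij index_of"
proof (rule bijI)
  show "inj index_of"
  proof (rule injI)
    fix p p' :: "2 \<times> int \<times> int"
    obtain a i j b k l where p: "p = (a, i, j)" "p' = (b, k, l)" by (cases p; cases p') auto
    assume "index_of p = index_of p'"
    then show "p = p'" unfolding p index_of_def using exhaust_2[of a] exhaust_2[of b]
      by (auto split: if_splits) presburger+
  qed
  show "surj index_of"
  proof (rule surjI)
    fix w :: index
    show "index_of (if even (fst w) then 1 else 2, fst w div 2, snd w) = w"
      by (cases w) (auto simp: index_of_def)
  qed
qed

lemma dcoset_level_iff: "x \<in> cell w \<Longrightarrow> x \<in> dcoset_level j \<longleftrightarrow> snd w = j"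
proof
  assume x: "x \<in> cell w"
  show "snd w = j" if "x \<in> dcoset_level j"
    using that cell_unique[OF x] by (auto simp: dcoset_level_def dcoset_eq_cell)
  assume j: "snd w = j"
  show "x \<in> dcoset_level j"
  proof (cases w rule: index_cases)
    case (1 i l)
    then show ?thesis using x j unfolding dcoset_level_def dcoset_eq_cell
      by (intro UN_I[of i] UnI1) auto
  next
    case (2 i l)
    then show ?thesis using x j unfolding dcoset_level_def dcoset_eq_cell
      by (intro UN_I[of i] UnI2) auto
  qed
qed

lemma dcoset_level_cell: "x \<in> dcoset_level j \<Longrightarrow> \<exists>w. x \<in> cell w"
  by (auto simp: dcoset_level_def dcoset_eq_cell)

lemma eta_of_cell: "x \<in> cell w \<Longrightarrow> eta_of x = weyl w"
proof -
  assume x: "x \<in> cell w"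
  obtain p where p: "index_of p = w" using bij_index_of by (metis bij_pointE)
  obtain a i j where p': "p = (a, i, j)" by (cases p) auto
  show ?thesis unfolding eta_of_def
  proof (rule the_equality)
    show "\<exists>a i j. x \<in> dcoset a i j \<and> weyl w = eta a i j"
      using x p unfolding p' eta_eq by (intro exI[of _ a] exI[of _ i] exI[of _ j]) (auto simp: dcoset_eq_cell index_of_def)
    fix y assume "\<exists>a i j. x \<in> dcoset a i j \<and> y = eta a i j"
    then obtain a i j where "x \<in> cell (index_of (a, i, j))" "y = weyl (index_of (a, i, j))"
      by (auto simp: dcoset_eq_cell index_of_def eta_eq)
    then show "y = weyl w" using cell_unique[OF x] by simp
  qed
qed

lemma conv_chi_card:
  assumes x: "x \<in> cell w"
  shows "conv_chi a i j b k l x =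
    (if snd w = j + l \<and> j * l \<ge> 0 then inverse (of_nat q) *
      of_nat (card {z \<in> coset_reps b k l. weyl w \<otimes>\<^bsub>SL2\<^esub> inv\<^bsub>SL2\<^esub> z \<in> cell (index_of (a, i, j))}) else 0)"
proof -
  let ?R = "coset_reps b k l"
  have R: "inv\<^bsub>SL2\<^esub> z = matrix_inv z" if "z \<in> ?R" for z
    using that coset_reps_transversal[of b k l] by (intro inv_SL2) (auto simp: SL2.right_transversal_def)
  have "{z \<in> ?R. chi a i j (weyl w ** matrix_inv z) \<noteq> 0}
      = {z \<in> ?R. weyl w \<otimes>\<^bsub>SL2\<^esub> inv\<^bsub>SL2\<^esub> z \<in> cell (index_of (a, i, j))}" (is "?S = ?S'")
    using R by (auto simp: chi_eq indicator_def)
  moreover have "(\<Sum>z\<in>?S. chi a i j (weyl w ** matrix_inv z)) = of_nat (card ?S)"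
  proof -
    have "(\<Sum>z\<in>?S. chi a i j (weyl w ** matrix_inv z)) = (\<Sum>z\<in>?S. 1)"
      by (rule sum.cong) (auto simp: chi_eq indicator_def split: if_splits)
    then show ?thesis by simp
  qed
  ultimately show ?thesis
    using eta_of_cell[OF x] dcoset_level_iff[OF x] by (simp add: conv_chi_def)
qed

lemma sum_indicator_card:
  assumes "finite Y"
  shows "(\<Sum>y\<in>Y. indicator A (f y)) = (of_nat (card {y \<in> Y. f y \<in> A}) :: complex)"
proof -
  have "(\<Sum>y\<in>Y. indicator A (f y) :: complex) = (\<Sum>y\<in>{y \<in> Y. f y \<in> A}. 1)"
    by (rule sum.mono_neutral_cong_right) (use assms in auto)
  then show ?thesis by simp
qed

text \<open>
  The structure constants with the left factor at level zero are matrix entries of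
  \<open>left_elem\<close>.
\<close>
lemma conv_chi_left:
  assumes x: "x \<in> cell w" and a: "index_of (a, i, j) = (n, 0)"
  shows "conv_chi a i j b k l x =
    (if snd w = l then inverse (of_nat q) * left_elem (of_nat q) n (\<lambda>w'. of_bool (w' = index_of (b, k, l))) w else 0)"
proof -
  let ?B = "cell (index_of (b, k, l))"
  obtain Y where Y: "finite Y" "SL2.left_transversal I Y (cell (n, 0))"
    and count: "(\<Sum>y\<in>Y. indicator ?B (matrix_inv y ** weyl w))
      = left_elem (of_nat q) n (\<lambda>w'. of_bool (w' = index_of (b, k, l))) w"
    using cell_transversal_count[of n] weyl_in_cell by blast
  have j: "j = 0" using a by (simp add: index_of_def)
  then have a0: "index_of (a, i, 0) = (n, 0)" using a by simp
  have B: "dcoset b k l = ?B" by (simp add: dcoset_eq_cell index_of_def)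
  have "card {z \<in> coset_reps b k l. weyl w \<otimes>\<^bsub>SL2\<^esub> inv\<^bsub>SL2\<^esub> z \<in> cell (n, 0)}
      = card {y \<in> Y. inv\<^bsub>SL2\<^esub> y \<otimes>\<^bsub>SL2\<^esub> weyl w \<in> ?B}"
    by (rule SL2.card_right_transversal_eq_left[OF coset_reps_transversal[of b k l, unfolded B] Y(2)])
      (simp_all add: cell_left cell_right det_weyl)
  also have "{y \<in> Y. inv\<^bsub>SL2\<^esub> y \<otimes>\<^bsub>SL2\<^esub> weyl w \<in> ?B} = {y \<in> Y. matrix_inv y ** weyl w \<in> ?B}"
    using Y(2) by (auto simp: SL2.left_transversal_def inv_SL2 cell_det)
  finally show ?thesis
    using count by (simp add: conv_chi_card[OF x] a0 j sum_indicator_card[OF Y(1)])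
qed

text \<open>
  With the right factor at level zero, inversion of the group reduces to the left-hand case.
\<close>
lemma conv_chi_right:
  assumes x: "x \<in> cell w" and b: "index_of (b, k, l) = (n, 0)"
  shows "conv_chi a i j b k l x =
    (if snd w = j then inverse (of_nat q) * left_elem (of_nat q) (fst (inv_index (n, 0)))
      (\<lambda>w'. of_bool (w' = inv_index (index_of (a, i, j)))) (inv_index w) else 0)"
proof -
  let ?A = "cell (index_of (a, i, j))"
  define n' where "n' = fst (inv_index (n, 0))"
  have n': "inv_index (n, 0) = (n', 0)" by (simp add: n'_def inv_index_def)
  obtain Y where Y: "finite Y" "SL2.left_transversal I Y (cell (n', 0))"
    and count: "(\<Sum>y\<in>Y. indicator (cell (inv_index (index_of (a, i, j)))) (matrix_inv y ** matrix_inv (weyl w)))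
      = left_elem (of_nat q) n' (\<lambda>w'. of_bool (w' = inv_index (index_of (a, i, j)))) (inv_index w)"
    using cell_transversal_count[of n'] matrix_inv_weyl_in_cell[of w] by blast
  have l: "l = 0" using b by (simp add: index_of_def)
  have B: "dcoset b k l = cell (n, 0)" using b by (simp add: dcoset_eq_cell index_of_def)
  have "card {z \<in> coset_reps b k l. weyl w \<otimes>\<^bsub>SL2\<^esub> inv\<^bsub>SL2\<^esub> z \<in> ?A}
      = card {y \<in> Y. weyl w \<otimes>\<^bsub>SL2\<^esub> y \<in> ?A}"
    by (rule SL2.card_right_transversal_eq_inverse[OF subgroup_iwahori coset_reps_transversal[of b k l, unfolded B] Y(2)])
      (simp_all add: cell_left cell_right det_weyl inv_cell[of "(n, 0)", unfolded n'])
  also have "{y \<in> Y. weyl w \<otimes>\<^bsub>SL2\<^esub> y \<in> ?A}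
      = {y \<in> Y. matrix_inv y ** matrix_inv (weyl w) \<in> cell (inv_index (index_of (a, i, j)))}"
  proof -
    have "weyl w ** y \<in> ?A \<longleftrightarrow> matrix_inv y ** matrix_inv (weyl w) \<in> cell (inv_index (index_of (a, i, j)))" if "y \<in> Y" for y
    proof -
      have "det y = 1" using that Y(2) by (auto simp: SL2.left_transversal_def)
      then show ?thesis using matrix_inv_cell_iff[of "weyl w ** y"]
        by (simp add: matrix_inv_mult_SL2 det_weyl det_mul)
    qed
    then show ?thesis by auto
  qed
  finally show ?thesis
    using count by (simp add: conv_chi_card[OF x] l n'_def[symmetric] sum_indicator_card[OF Y(1)])
qed

section \<open>The product in terms of coefficients\<close>

definition coeffs :: "('f^2^2 \<Rightarrow> complex) \<Rightarrow> index \<Rightarrow> complex" where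
  "coeffs f w = f (weyl w)"

definition cell_function :: "(index \<Rightarrow> complex) \<Rightarrow> 'f^2^2 \<Rightarrow> complex" where
  "cell_function \<phi> x = (if \<exists>w. x \<in> cell w then \<phi> (THE w. x \<in> cell w) else 0)"

lemma cell_function_cell: "x \<in> cell w \<Longrightarrow> cell_function \<phi> x = \<phi> w"
proof -
  assume x: "x \<in> cell w"
  then have "(THE w. x \<in> cell w) = w" using cell_unique by blast
  moreover have "\<exists>w. x \<in> cell w" using x by blast
  ultimately show ?thesis unfolding cell_function_def by (simp only: if_True)
qed

lemma cell_function_outside: "(\<And>w. x \<notin> cell w) \<Longrightarrow> cell_function \<phi> x = 0"
  by (simp add: cell_function_def)

lemma coeffs_cell_function [simp]: "coeffs (cell_function \<phi>) = \<phi>"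
  by (simp add: coeffs_def cell_function_cell[OF weyl_in_cell] fun_eq_iff)

lemma cell_function_eqI:
  assumes "\<And>x w. x \<in> cell w \<Longrightarrow> f x = \<phi> w" "\<And>x. (\<And>w. x \<notin> cell w) \<Longrightarrow> f x = 0"
  shows "f = cell_function \<phi>"
proof
  fix x show "f x = cell_function \<phi> x"
    using assms cell_function_cell cell_function_outside by (cases "\<exists>w. x \<in> cell w") metis+
qed

lemma conv_outside: "(\<And>w. x \<notin> cell w) \<Longrightarrow> conv f g x = 0"
proof -
  assume "\<And>w. x \<notin> cell w"
  then have "x \<notin> dcoset_level j" for j using dcoset_level_cell by blast
  then have "conv_chi a i j b k l x = 0" for a i j b k l by (simp add: conv_chi_def)
  then show ?thesis by (simp add: conv_def Let_def case_prod_beta)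
qed

lemma conv_sum_pairs:
  assumes x: "x \<in> cell w"
    and c: "\<And>a i j b k l. coeffs f (index_of (a, i, j)) * coeffs g (index_of (b, k, l)) * conv_chi a i j b k l x
      = T (index_of (a, i, j)) (index_of (b, k, l))"
  shows "conv f g x = (\<Sum>(u, w')\<in>{(u, w'). T u w' \<noteq> 0}. T u w')"
proof -
  let ?term = "\<lambda>((a, i, j), (b, k, l)). f (eta a i j) * g (eta b k l) * conv_chi a i j b k l x"
  have t: "?term p = (case map_prod index_of index_of p of (u, w') \<Rightarrow> T u w')" for p
    by (cases p) (auto simp: eta_eq c[symmetric] coeffs_def)
  have bij: "bij (map_prod index_of index_of)"
    using bij_index_of by (simp add: bij_def prod.inj_map map_prod_surj)
  have "conv f g x = (\<Sum>p\<in>{p. ?term p \<noteq> 0}. ?term p)" by (simp add: conv_def Let_def)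
  also have "\<dots> = (\<Sum>p\<in>{p. (case map_prod index_of index_of p of (u, w') \<Rightarrow> T u w') \<noteq> 0}.
      case map_prod index_of index_of p of (u, w') \<Rightarrow> T u w')"
    by (simp only: t)
  also have "\<dots> = (\<Sum>r\<in>{r. (case r of (u, w') \<Rightarrow> T u w') \<noteq> 0}. case r of (u, w') \<Rightarrow> T u w')"
    by (rule sum_nonzero_bij[OF bij])
  also have "{r. (case r of (u, w') \<Rightarrow> T u w') \<noteq> 0} = {(u, w'). T u w' \<noteq> 0}" by auto
  finally show ?thesis .
qed

abbreviation Q :: complex where "Q \<equiv> of_nat q"

lemma Q_nonzero: "Q \<noteq> 0"
  using q_positive by simp

lemma finitary_support_finite:
  assumes "finitary h"
  shows "finite {u. h u \<noteq> 0}"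
    and "(\<Sum>u\<in>{u. h u \<noteq> 0}. h u * G u) = (\<Sum>k\<in>{k. h (k, 0) \<noteq> 0}. h (k, 0) * G (k, 0))"
proof -
  have eq: "{u. h u \<noteq> 0} = (\<lambda>k. (k, 0)) ` {k. h (k, 0) \<noteq> 0}"
  proof (rule Set.set_eqI)
    fix u :: index
    obtain k j where u: "u = (k, j)" by (cases u)
    have "j = 0" if "h (k, j) \<noteq> 0" using assms that unfolding finitary_def by blast
    then show "u \<in> {u. h u \<noteq> 0} \<longleftrightarrow> u \<in> (\<lambda>k. (k, 0)) ` {k. h (k, 0) \<noteq> 0}"
      unfolding u by auto
  qed
  show "finite {u. h u \<noteq> 0}" unfolding eq using assms by (simp add: finitary_def)
  show "(\<Sum>u\<in>{u. h u \<noteq> 0}. h u * G u) = (\<Sum>k\<in>{k. h (k, 0) \<noteq> 0}. h (k, 0) * G (k, 0))"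
    unfolding eq by (subst sum.reindex) (auto simp: inj_on_def)
qed

text \<open>
  Only the part of \<open>g\<close> at the level of \<open>w\<close> contributes at
  \<open>w\<close>; apart from this truncation the product is the operator
  \<open>left_action\<close>.
\<close>
lemma conv_finitary_left:
  assumes h: "finitary (coeffs f)"
  shows "conv f g = cell_function (\<lambda>w. left_action Q (coeffs f) (level_part (snd w) (coeffs g)) w)"
proof (rule cell_function_eqI)
  fix x w assume x: "x \<in> cell w"
  let ?\<delta> = "\<lambda>b w'. of_bool (w' = b) :: complex"
  let ?c = "\<lambda>u b. if snd b = snd w then inverse Q * left_elem Q (fst u) (?\<delta> b) w else 0"
  have fin: "finite {b. ?c u b \<noteq> 0}" for u
    by (rule finite_subset[OF _ left_elem_local(1)[of Q "fst u" w]]) auto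
  have inner: "(\<Sum>b\<in>{b. ?c u b \<noteq> 0}. coeffs g b * ?c u b) = inverse Q * left_elem Q (fst u) (level_part (snd w) (coeffs g)) w" for u
  proof -
    let ?S = "{b. left_elem Q (fst u) (?\<delta> b) w \<noteq> 0}"
    have "(\<Sum>b\<in>{b. ?c u b \<noteq> 0}. coeffs g b * ?c u b)
        = (\<Sum>b\<in>?S. inverse Q * (level_part (snd w) (coeffs g) b * left_elem Q (fst u) (?\<delta> b) w))"
      by (rule sum.mono_neutral_cong_left[OF left_elem_local(1)]) (auto simp: level_part_def)
    then show ?thesis using left_elem_local(2)[of Q "fst u" "level_part (snd w) (coeffs g)" w]
      by (simp add: sum_distrib_left)
  qed
  have "coeffs f (index_of (a, i, j)) * coeffs g (index_of (b, k, l)) * conv_chi a i j b k l x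
      = coeffs f (index_of (a, i, j)) * coeffs g (index_of (b, k, l)) * ?c (index_of (a, i, j)) (index_of (b, k, l))" for a i j b k l
  proof (cases "j = 0")
    case True
    then have "index_of (a, i, j) = (fst (index_of (a, i, j)), 0)" by (simp add: index_of_def)
    from conv_chi_left[OF x this, of b k l] show ?thesis by (simp add: index_of_def True)
  next
    case False
    then show ?thesis using h by (simp add: finitary_def index_of_def)
  qed
  from conv_sum_pairs[OF x, of f g, OF this]
  show "conv f g x = left_action Q (coeffs f) (level_part (snd w) (coeffs g)) w"
    unfolding sum_nonzero_pairs[OF finitary_support_finite(1)[OF h] fin] inner finitary_support_finite(2)[OF h]
    by (simp add: left_action_def sum_distrib_left mult.left_commute)
qed (rule conv_outside)

lemma conv_finitary_right:
  assumes h: "finitary (coeffs g)"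
  shows "conv f g = cell_function (\<lambda>w. right_action Q (coeffs g) (level_part (snd w) (coeffs f)) w)"
proof (rule cell_function_eqI)
  fix x w assume x: "x \<in> cell w"
  let ?\<delta> = "\<lambda>b w'. of_bool (w' = b) :: complex"
  let ?w = "inv_index w"
  let ?n = "\<lambda>u. fst (inv_index u)"
  let ?c = "\<lambda>u b. if snd b = snd w then inverse Q * left_elem Q (?n u) (?\<delta> (inv_index b)) ?w else 0"
  have finS': "finite {b. left_elem Q (?n u) (?\<delta> (inv_index b)) ?w \<noteq> 0}" (is "finite ?S'") for u
  proof -
    have "?S' = inv_index ` {b. left_elem Q (?n u) (?\<delta> b) ?w \<noteq> 0}"
    proof (rule Set.set_eqI)
      fix b show "b \<in> ?S' \<longleftrightarrow> b \<in> inv_index ` {b. left_elem Q (?n u) (?\<delta> b) ?w \<noteq> 0}"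
        using image_eqI[of b inv_index "inv_index b"] by auto
    qed
    then show ?thesis using left_elem_local(1) by simp
  qed
  have fin: "finite {b. ?c u b \<noteq> 0}" for u
    by (rule finite_subset[OF _ finS'[of u]]) auto
  have inner: "(\<Sum>b\<in>{b. ?c u b \<noteq> 0}. coeffs f b * ?c u b)
      = inverse Q * left_elem Q (?n u) (mirror (level_part (snd w) (coeffs f))) ?w" for u
  proof -
    let ?S = "{b. left_elem Q (?n u) (?\<delta> b) ?w \<noteq> 0}"
    let ?f = "level_part (snd w) (coeffs f)"
    let ?S' = "{b. left_elem Q (?n u) (?\<delta> (inv_index b)) ?w \<noteq> 0}"
    have "(\<Sum>b\<in>{b. ?c u b \<noteq> 0}. coeffs f b * ?c u b)
        = (\<Sum>b\<in>?S'. inverse Q * (?f b * left_elem Q (?n u) (?\<delta> (inv_index b)) ?w))"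
      by (rule sum.mono_neutral_cong_left[OF finS']) (auto simp: level_part_def)
    also have "\<dots> = (\<Sum>b\<in>?S. inverse Q * (mirror ?f b * left_elem Q (?n u) (?\<delta> b) ?w))"
      by (rule sum.reindex_bij_witness[of _ inv_index inv_index]) (simp_all add: mirror_def)
    finally show ?thesis using left_elem_local(2)[of Q "?n u" "mirror ?f" ?w]
      by (simp add: sum_distrib_left)
  qed
  let ?T = "\<lambda>b u. coeffs g b * coeffs f u * ?c b u"
  have "coeffs f (index_of (a, i, j)) * coeffs g (index_of (b, k, l)) * conv_chi a i j b k l x
      = ?T (index_of (b, k, l)) (index_of (a, i, j))" for a i j b k l
  proof (cases "l = 0")
    case True
    then have "index_of (b, k, l) = (fst (index_of (b, k, l)), 0)" by (simp add: index_of_def)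
    from conv_chi_right[OF x this, of a i j] show ?thesis by (simp add: index_of_def True)
  next
    case False
    then show ?thesis using h by (simp add: finitary_def index_of_def)
  qed
  from conv_sum_pairs[OF x, of f g "\<lambda>u b. ?T b u", OF this]
  have "conv f g x = (\<Sum>(u, b)\<in>{(u, b). ?T b u \<noteq> 0}. ?T b u)" .
  also have "\<dots> = (\<Sum>(b, u)\<in>{(b, u). ?T b u \<noteq> 0}. ?T b u)"
    by (rule sum.reindex_bij_witness[of _ prod.swap prod.swap]) auto
  also have "\<dots> = (\<Sum>k\<in>{k. coeffs g (k, 0) \<noteq> 0}. coeffs g (k, 0) *
      (inverse Q * left_elem Q (?n (k, 0)) (mirror (level_part (snd w) (coeffs f))) ?w))"
    unfolding sum_nonzero_pairs[OF finitary_support_finite(1)[OF h] fin] inner finitary_support_finite(2)[OF h] ..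
  also have "\<dots> = right_action Q (coeffs g) (level_part (snd w) (coeffs f)) w"
  proof -
    have m: "mirror (coeffs g) (k, 0) = coeffs g (?n (k, 0), 0)" for k
      by (simp add: mirror_def inv_index_def)
    have nn: "?n (?n (k, 0), 0) = k" for k by (simp add: inv_index_def)
    have "(\<Sum>k\<in>{k. coeffs g (k, 0) \<noteq> 0}. coeffs g (k, 0) * left_elem Q (?n (k, 0)) \<psi> ?w)
      = (\<Sum>k\<in>{k. mirror (coeffs g) (k, 0) \<noteq> 0}. mirror (coeffs g) (k, 0) * left_elem Q k \<psi> ?w)" for \<psi>
      by (rule sum.reindex_bij_witness[of _ "\<lambda>k. ?n (k, 0)" "\<lambda>k. ?n (k, 0)"])
        (simp_all add: m nn)
    then show ?thesis
      by (simp add: right_action_def mirror_def[of "left_action _ _ _"] left_action_def sum_distrib_left mult.left_commute)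
        (simp add: sum_distrib_left[symmetric])
  qed
  finally show "conv f g x = right_action Q (coeffs g) (level_part (snd w) (coeffs f)) w" .
qed (rule conv_outside)


lemma cell_function_mult_left:
  "finitary h \<Longrightarrow> conv (cell_function h) (cell_function g)
    = cell_function (\<lambda>w. left_action Q h (level_part (snd w) g) w)"
  using conv_finitary_left[of "cell_function h" "cell_function g"] by simp

lemma cell_function_mult_right:
  "finitary h \<Longrightarrow> conv (cell_function g) (cell_function h)
    = cell_function (\<lambda>w. right_action Q h (level_part (snd w) g) w)"
  using conv_finitary_right[of "cell_function h" "cell_function g"] by simp

lemma left_elem_level_0:
  assumes "\<And>k j. j \<noteq> 0 \<Longrightarrow> \<psi> (k, j) = 0" "j \<noteq> 0"
  shows "left_elem q n \<psi> (k, j) = 0"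
proof -
  have "j \<noteq> 0 \<Longrightarrow> left_word q bs \<psi> (k, j) = 0" for bs k j
    by (induction bs arbitrary: k j) (simp_all add: assms left_simple_def flip_def)
  then show ?thesis using assms by (simp add: left_elem_def)
qed

lemma cell_function_mult_finitary:
  assumes "finitary h" "finitary g"
  shows "conv (cell_function h) (cell_function g) = cell_function (left_action Q h g)"
proof -
  have "left_action Q h (level_part (snd w) g) w = left_action Q h g w" for w
  proof (cases w)
    case (Pair k j)
    show ?thesis
    proof (cases "j = 0")
      case True
      then have "level_part (snd w) g = g"
        using assms(2) Pair by (auto simp: level_part_def fun_eq_iff finitary_def)
      then show ?thesis by simp
    next
      case False
      then have "level_part (snd w) g = (\<lambda>w. 0)"
        using assms(2) Pair by (auto simp: level_part_def fun_eq_iff finitary_def)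
      then show ?thesis using False assms(2) Pair
        by (simp add: left_action_def left_elem_level_0 finitary_def)
    qed
  qed
  then show ?thesis using cell_function_mult_left[OF assms(1)] by simp
qed

section \<open>The functions in the Hecke algebra\<close>

lemma module_functions: "Modules.module (\<lambda>c (f :: 'f^2^2 \<Rightarrow> complex) x. c * f x)"
  by unfold_locales (simp_all add: fun_eq_iff algebra_simps)

interpretation H: Modules.module "\<lambda>c (f :: 'f^2^2 \<Rightarrow> complex) x. c * f x"
  by (rule module_functions)

lemma hecke_add: "f \<in> hecke \<Longrightarrow> g \<in> hecke \<Longrightarrow> (\<lambda>x. f x + g x) \<in> hecke"
  using H.span_add[of f hecke_generators g] by (simp add: hecke_def plus_fun_def)

lemma hecke_scale: "f \<in> hecke \<Longrightarrow> (\<lambda>x. c * f x) \<in> hecke"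
  unfolding hecke_def by (rule H.span_scale)

lemma hecke_zero: "(\<lambda>x. 0) \<in> hecke"
  using H.span_zero[of hecke_generators] by (simp add: hecke_def zero_fun_def)

lemma cell_iff: "x \<in> cell w \<Longrightarrow> x \<in> cell w' \<longleftrightarrow> w' = w"
  using cell_unique by blast

lemma chi_cell: "x \<in> cell w \<Longrightarrow> chi a i j x = of_bool (index_of (a, i, j) = w)"
  by (simp add: chi_eq indicator_def cell_iff)

lemma chi_series_cell:
  assumes "x \<in> cell w"
  shows "chi_series a j R c x = (\<Sum>r\<in>{r \<in> R. index_of (a, r, j) = w}. c r)"
  unfolding chi_series_def by (rule sum.cong) (auto simp: chi_cell[OF assms])

lemma chi_series_outside: "(\<And>w. x \<notin> cell w) \<Longrightarrow> chi_series a j R c x = 0"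
  by (simp add: chi_series_def chi_eq)

text \<open>
  Both properties hold for the generators and pass to linear combinations.
\<close>
lemma hecke_cell_function:
  assumes "f \<in> hecke"
  shows "f = cell_function (coeffs f)" and "finite {k. coeffs f (k, 0) \<noteq> 0}"
proof -
  define P where "P = (\<lambda>f. (\<forall>w. \<forall>x\<in>cell w. f x = coeffs f w) \<and> (\<forall>x. (\<forall>w. x \<notin> cell w) \<longrightarrow> f x = 0)
    \<and> finite {k. coeffs f (k, 0) \<noteq> 0})"
  have fin: "finite {k. coeffs (chi_series a j R c) (k, 0) \<noteq> 0}" if "finite R \<or> j \<noteq> 0" for a j R c
  proof -
    have "{k. coeffs (chi_series a j R c) (k, 0) \<noteq> 0} \<subseteq> (if j = 0 then (\<lambda>r. fst (index_of (a, r, j))) ` R else {})"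
    proof
      fix k assume "k \<in> {k. coeffs (chi_series a j R c) (k, 0) \<noteq> 0}"
      then have "(\<Sum>r\<in>{r \<in> R. index_of (a, r, j) = (k, 0)}. c r) \<noteq> 0"
        by (simp add: coeffs_def chi_series_cell[OF weyl_in_cell])
      then have "{r \<in> R. index_of (a, r, j) = (k, 0)} \<noteq> {}" by (metis sum.empty)
      then obtain r where r: "r \<in> R" "index_of (a, r, j) = (k, 0)" by blast
      then have "j = 0" by (simp add: index_of_def)
      moreover have "k = fst (index_of (a, r, j))" using r by simp
      ultimately show "k \<in> (if j = 0 then (\<lambda>r. fst (index_of (a, r, j))) ` R else {})" using r by auto
    qed
    moreover have "finite (if j = 0 then (\<lambda>r. fst (index_of (a, r, j))) ` R else {})" using that by auto
    ultimately show ?thesis by (rule finite_subset)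
  qed
  have gen: "P (chi_series a j R c)" if "finite R \<or> j \<noteq> 0" for a j R c
    using fin[OF that] chi_series_outside
    unfolding P_def by (auto simp: coeffs_def chi_series_cell chi_series_cell[OF weyl_in_cell])
  have "P f"
  proof (rule H.span_induct[of f hecke_generators "P"])
    show "f \<in> H.span hecke_generators" using assms by (simp add: hecke_def)
    show "P g" if "g \<in> hecke_generators" for g
      using that gen by (auto simp: hecke_generators_def)
    show "H.subspace (Collect P)"
    proof (rule H.subspaceI)
      show "0 \<in> Collect P" by (simp add: P_def coeffs_def)
      fix f g assume "f \<in> Collect P" "g \<in> Collect P"
      moreover have "{k. coeffs (f + g) (k, 0) \<noteq> 0} \<subseteq> {k. coeffs f (k, 0) \<noteq> 0} \<union> {k. coeffs g (k, 0) \<noteq> 0}"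
        by (auto simp: coeffs_def)
      ultimately show "f + g \<in> Collect P"
        unfolding P_def mem_Collect_eq by (auto simp: coeffs_def intro: finite_subset)
    next
      fix c f assume "f \<in> Collect P"
      moreover have "{k. coeffs (\<lambda>x. c * f x) (k, 0) \<noteq> 0} \<subseteq> {k. coeffs f (k, 0) \<noteq> 0}"
        by (auto simp: coeffs_def)
      ultimately show "(\<lambda>x. c * f x) \<in> Collect P"
        unfolding P_def mem_Collect_eq by (auto simp: coeffs_def intro: finite_subset)
    qed
  qed
  then show "f = cell_function (coeffs f)" "finite {k. coeffs f (k, 0) \<noteq> 0}"
    by (auto simp: P_def intro!: cell_function_eqI)
qed

lemma chi_hecke: "chi a i 0 \<in> hecke"
proof -
  have "chi a i 0 = chi_series a 0 {i..i} (\<lambda>_. 1)"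
  proof
    fix x
    have "{r \<in> {i..i}. chi a r 0 x \<noteq> 0} = (if chi a i 0 x = 0 then {} else {i})" by auto
    then show "chi a i 0 x = chi_series a 0 {i..i} (\<lambda>_. 1) x" by (simp add: chi_series_def)
  qed
  then have "chi a i 0 \<in> hecke_generators" unfolding hecke_generators_def by blast
  then show ?thesis unfolding hecke_def by (rule H.span_base)
qed

lemma cell_function_hecke0:
  assumes h: "finitary h"
  shows "cell_function h \<in> hecke0"
proof -
  let ?chi = "\<lambda>k. indicator (cell (k, 0)) :: 'f^2^2 \<Rightarrow> complex"
  let ?K = "{k. h (k, 0) \<noteq> 0}"
  have chi: "?chi k \<in> hecke" for k
  proof -
    have "?chi k = chi (if even k then 1 else 2) (k div 2) 0" by (auto simp: chi_eq index_of_def)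
    then show ?thesis using chi_hecke by simp
  qed
  have sum_hecke: "(\<lambda>x. \<Sum>k\<in>K. h (k, 0) * ?chi k x) \<in> hecke" if "finite K" for K
    using that
  proof induction
    case (insert k K)
    show ?case unfolding sum.insert[OF insert.hyps]
      by (rule hecke_add[OF hecke_scale[OF chi] insert.IH])
  qed (simp add: hecke_zero)
  have sum_eq: "(\<lambda>x. \<Sum>k\<in>?K. h (k, 0) * ?chi k x) = cell_function h"
  proof (rule cell_function_eqI)
    fix x w assume x: "x \<in> cell w"
    have "(\<Sum>k\<in>?K. h (k, 0) * ?chi k x) = (\<Sum>u\<in>{u. h u \<noteq> 0}. h u * of_bool (u = w))"
      unfolding finitary_support_finite(2)[OF h]
      by (intro sum.cong) (simp_all add: indicator_def cell_iff[OF x])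
    also have "\<dots> = (\<Sum>u\<in>{u. h u \<noteq> 0}. if u = w then h u else 0)"
      by (intro sum.cong) auto
    also have "\<dots> = h w" using finitary_support_finite(1)[OF h] by (simp add: sum.delta)
    finally show "(\<Sum>k\<in>?K. h (k, 0) * ?chi k x) = h w" .
  qed (simp add: indicator_def)
  have "finite ?K" using h by (simp add: finitary_def)
  from sum_hecke[OF this] have "cell_function h \<in> hecke" by (simp only: sum_eq)
  moreover have "x \<in> dcoset_level 0" if "cell_function h x \<noteq> 0" for x
  proof -
    obtain w where w: "x \<in> cell w" using \<open>cell_function h x \<noteq> 0\<close> cell_function_outside by blast
    then have "h w \<noteq> 0" using that cell_function_cell by simp
    then have "snd w = 0" using h by (cases w) (auto simp: finitary_def)
    then show ?thesis using dcoset_level_iff[OF w] by simp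
  qed
  ultimately show ?thesis by (simp add: hecke0_def)
qed

lemma hecke0_finitary:
  assumes "f \<in> hecke0"
  shows "f = cell_function (coeffs f)" "finitary (coeffs f)"
proof -
  have f: "f \<in> hecke" "\<And>x. f x \<noteq> 0 \<Longrightarrow> x \<in> dcoset_level 0" using assms by (auto simp: hecke0_def)
  show "f = cell_function (coeffs f)" using hecke_cell_function[OF f(1)] by simp
  have "coeffs f (k, j) = 0" if "j \<noteq> 0" for k j
    using f(2)[of "weyl (k, j)"] dcoset_level_iff[OF weyl_in_cell, of "(k, j)" 0] that
    by (auto simp: coeffs_def)
  then show "finitary (coeffs f)" using hecke_cell_function(2)[OF f(1)] by (simp add: finitary_def)
qed

section \<open>The center\<close>

lemma iota_eq: "iota = cell_function (unit_coeffs Q)"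
proof (rule cell_function_eqI)
  fix x w assume "x \<in> cell w"
  then show "iota x = unit_coeffs Q w" by (auto simp: iota_def chi_cell unit_coeffs_def index_of_def)
qed (simp add: iota_def chi_eq)

lemma Theta_sum_eq: "(\<lambda>x. Theta_plus x + Theta_minus x) = cell_function (bernstein_coeffs Q)"
proof (rule cell_function_eqI)
  fix x w assume x: "x \<in> cell w"
  have square: "z * (z + inverse z - 2) = (z - 1)\<^sup>2" if "z \<noteq> 0" for z :: complex
    using that by (simp add: algebra_simps power2_eq_square)
  obtain k j where w: "w = (k, j)" by (cases w)
  have "j \<noteq> 0 \<or> k = 2 \<or> k = - 2 \<or> k = 1 \<or> k = - 1 \<or> k = 0 \<or> \<bar>k\<bar> > 2" by linarith
  then show "Theta_plus x + Theta_minus x = bernstein_coeffs Q w"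
    unfolding Theta_plus_def Theta_minus_def chi_cell[OF x] w square[OF Q_nonzero]
    by (elim disjE) (auto simp: index_of_def bernstein_coeffs_def)
qed (simp add: Theta_plus_def Theta_minus_def chi_eq)

abbreviation generated where
  "generated \<equiv> generated_algebra conv iota {\<lambda>x. Theta_plus x + Theta_minus x}"

lemma cell_function_add: "(\<lambda>x. cell_function g x + cell_function h x) = cell_function (\<lambda>w. g w + h w)"
  by (rule cell_function_eqI) (simp_all add: cell_function_cell cell_function_outside)

lemma cell_function_scale: "(\<lambda>x. c * cell_function h x) = cell_function (\<lambda>w. c * h w)"
  by (rule cell_function_eqI) (simp_all add: cell_function_cell cell_function_outside)

lemma generated_eq: "generated = cell_function ` bernstein_span Q"
proof (intro equalityI subsetI)
  fix f assume "f \<in> generated"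
  then show "f \<in> cell_function ` bernstein_span Q"
  proof induction
    case one
    show ?case unfolding iota_eq by (intro imageI bernstein_span.unit)
  next
    case (gen f)
    then have "f = cell_function (bernstein_op Q (unit_coeffs Q))" by (simp add: Theta_sum_eq bernstein_op_unit[OF Q_nonzero])
    then show ?case by (auto intro: bernstein_span.intros)
  next
    case (add f g)
    then show ?case by (auto simp: cell_function_add intro!: imageI bernstein_span.plus)
  next
    case (scale f c)
    then show ?case by (auto simp: cell_function_scale intro!: imageI bernstein_span.scale)
  next
    case (mul f g)
    then show ?case
      by (auto simp: cell_function_mult_finitary bernstein_span_finitary intro!: imageI bernstein_span_left_action Q_nonzero)
  qed
next
  fix f assume "f \<in> cell_function ` bernstein_span Q"
  then obtain h where h: "h \<in> bernstein_span Q" and f: "f = cell_function h" by blast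
  from h show "f \<in> generated" unfolding f
  proof induction
    case unit
    show ?case unfolding iota_eq[symmetric] by (rule generated_algebra.one)
  next
    case (step h)
    have fin: "finitary (bernstein_coeffs Q)" "finitary h"
      using step bernstein_span_finitary bernstein_span.step[OF bernstein_span.unit, of Q]
      by (auto simp: bernstein_op_unit[OF Q_nonzero])
    have "cell_function (bernstein_coeffs Q) \<in> generated"
      unfolding Theta_sum_eq[symmetric] by (rule generated_algebra.gen) simp
    from generated_algebra.mul[OF this step.IH] show ?case
      by (simp add: cell_function_mult_finitary fin bernstein_op_def)
  next
    case (plus g h)
    from generated_algebra.add[OF plus.IH] show ?case by (simp add: cell_function_add)
  next
    case (scale h c)
    from generated_algebra.scale[OF scale.IH, of c] show ?case by (simp add: cell_function_scale)
  qed
qed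

text \<open>
  Left and right multiplication by such an element agree before truncation, at every level,
  and hence after it.
\<close>
lemma generated_central: "generated \<subseteq> algebra_center conv hecke"
proof
  fix f assume "f \<in> generated"
  then obtain h where h: "h \<in> bernstein_span Q" and f: "f = cell_function h" unfolding generated_eq by blast
  have fin: "finitary h" using h by (rule bernstein_span_finitary)
  have "conv f g = conv g f" if "g \<in> hecke" for g
  proof -
    have g: "cell_function (coeffs g) = g" using hecke_cell_function(1)[OF that] by (rule sym)
    show ?thesis
      using cell_function_mult_left[OF fin, of "coeffs g"] cell_function_mult_right[OF fin, of "coeffs g"]
      by (simp only: f g bernstein_span_left_action_eq_right_action[OF Q_nonzero h])
  qed
  moreover have "f \<in> hecke" using cell_function_hecke0[OF fin] f by (simp add: hecke0_def)
  ultimately show "f \<in> algebra_center conv hecke" by (simp add: algebra_center_def)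
qed

text \<open>
  The coefficients of \<open>T\<^sub>s\<close> for the simple reflection \<open>s\<close>
  given by \<open>b\<close>.
\<close>
definition simple_coeffs :: "bool \<Rightarrow> index \<Rightarrow> complex" where
  "simple_coeffs b w = (if w = (if b then 1 else - 1, 0) then Q else 0)"

lemma finitary_simple: "finitary (simple_coeffs b)"
  by (auto simp: finitary_def simple_coeffs_def)

lemma left_action_simple: "left_action Q (simple_coeffs b) \<psi> = left_simple Q b \<psi>"
proof
  fix w
  let ?k = "if b then 1 else - 1 :: int"
  have "left_action Q (simple_coeffs b) \<psi> w = inverse Q * (\<Sum>k\<in>{?k}. simple_coeffs b (k, 0) * left_elem Q k \<psi> w)"
    by (rule left_action_eq_sum) (auto simp: simple_coeffs_def)
  then show "left_action Q (simple_coeffs b) \<psi> w = left_simple Q b \<psi> w"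
    using Q_nonzero by (simp add: simple_coeffs_def left_elem_def reduced_word_def)
qed

lemma right_action_simple: "right_action Q (simple_coeffs b) \<psi> = right_simple Q b \<psi>"
proof -
  have "mirror (simple_coeffs b) = simple_coeffs b"
    by (auto simp: mirror_def simple_coeffs_def inv_index_def fun_eq_iff)
  then show ?thesis by (simp add: right_action_def right_simple_def left_action_simple)
qed

lemma central_left_simple_eq_right_simple:
  assumes A: "hecke0 \<subseteq> A" "A \<subseteq> hecke" and z: "z \<in> algebra_center conv A"
  shows "left_simple Q b (level_part (snd w) (coeffs z)) w = right_simple Q b (level_part (snd w) (coeffs z)) w"
proof -
  let ?t = "cell_function (simple_coeffs b)"
  have "?t \<in> A" using A cell_function_hecke0[OF finitary_simple] by blast
  then have "conv z ?t = conv ?t z" using z by (simp add: algebra_center_def)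
  moreover have "z = cell_function (coeffs z)"
    using z A hecke_cell_function(1) by (auto simp: algebra_center_def)
  ultimately have "coeffs (conv (cell_function (coeffs z)) ?t) w = coeffs (conv ?t (cell_function (coeffs z))) w"
    by metis
  then show ?thesis
    by (simp add: cell_function_mult_left cell_function_mult_right finitary_simple left_action_simple right_action_simple)
qed

text \<open>
  At a positive level the reflection \<open>(-1, 0)\<close> lengthens every element and
  changes its level, so that truncation annihilates its left product; centrality turns this
  into the vanishing of an injective right multiplication.
\<close>
lemma center_hecke_subset: "algebra_center conv hecke \<subseteq> algebra_center conv hecke0"
proof
  fix z assume z: "z \<in> algebra_center conv hecke"
  then have zh: "z \<in> hecke" by (simp add: algebra_center_def)
  have sub: "hecke0 \<subseteq> hecke" by (auto simp: hecke0_def)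
  have LR: "left_simple Q b (level_part j (coeffs z)) (k, j) = right_simple Q b (level_part j (coeffs z)) (k, j)" for b k j
    using central_left_simple_eq_right_simple[OF sub order.refl z, of b "(k, j)"] by simp
  have "coeffs z (k, j) = 0" if "j \<noteq> 0" for k j
  proof (cases "j > 0")
    case True
    have "left_simple Q False (level_part j (coeffs z)) (k, j) = 0" for k
      using True by (simp add: left_simple_def descent_def flip_def level_part_def)
    then have "level_part j (coeffs z) (k, j) = 0"
      using right_simple_level_positive[OF Q_nonzero True] LR by metis
    then show ?thesis by (simp add: level_part_def)
  next
    case False
    then have j: "j < 0" using that by simp
    have "left_simple Q True (level_part j (coeffs z)) (k, j) = 0" for k
      using j by (simp add: left_simple_def descent_def flip_def level_part_def)
    then have "level_part j (coeffs z) (k, j) = 0"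
      using right_simple_level_negative[OF Q_nonzero j] LR by metis
    then show ?thesis by (simp add: level_part_def)
  qed
  then have "finitary (coeffs z)" using hecke_cell_function(2)[OF zh] by (simp add: finitary_def)
  from cell_function_hecke0[OF this] have "z \<in> hecke0" using hecke_cell_function(1)[OF zh] by simp
  then show "z \<in> algebra_center conv hecke0" using z sub by (auto simp: algebra_center_def)
qed

lemma center_hecke0_subset: "algebra_center conv hecke0 \<subseteq> generated"
proof
  fix z assume z: "z \<in> algebra_center conv hecke0"
  then have z0: "z \<in> hecke0" by (simp add: algebra_center_def)
  note fin = hecke0_finitary(2)[OF z0]
  have sub: "hecke0 \<subseteq> hecke" by (auto simp: hecke0_def)
  have "level_part 0 (coeffs z) = coeffs z"
    using fin by (auto simp: level_part_def fun_eq_iff finitary_def)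
  then have "left_simple Q b (coeffs z) (k, 0) = right_simple Q b (coeffs z) (k, 0)" for b k
    using central_left_simple_eq_right_simple[OF order.refl sub z, of b "(k, 0)"] by simp
  then have "coeffs z \<in> bernstein_span Q"
    by (rule central_in_bernstein_span[OF Q_nonzero fin])
  then show "z \<in> generated" unfolding generated_eq using hecke0_finitary(1)[OF z0] by blast
qed

theorem centers:
  "algebra_center conv hecke = algebra_center conv hecke0" "algebra_center conv hecke0 = generated"
  by (rule equalityI[OF center_hecke_subset order.trans[OF center_hecke0_subset generated_central]],
      rule equalityI[OF center_hecke0_subset order.trans[OF generated_central center_hecke_subset]])

end

theorem theorem3p3:
  fixes v :: "'f::field \<Rightarrow> int \<times> int" and t1 t2 :: 'f and q :: nat
  assumes "sl2_hecke v t1 t2 q"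
  shows "algebra_center (sl2_hecke.conv v t1 t2 q) (sl2_hecke.hecke v t1 t2)
           = algebra_center (sl2_hecke.conv v t1 t2 q) (sl2_hecke.hecke0 v t1 t2)
       \<and> algebra_center (sl2_hecke.conv v t1 t2 q) (sl2_hecke.hecke0 v t1 t2)
           = generated_algebra (sl2_hecke.conv v t1 t2 q) (sl2_hecke.iota v t1 t2 q)
               {\<lambda>x. sl2_hecke.Theta_plus v t1 t2 x + sl2_hecke.Theta_minus v t1 t2 q x}"
  by (rule conjI[OF sl2_hecke.centers[OF assms]])

end
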